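(* Let $A \in \{0,\star\}^{d\times d}$ and $B\in\{0,\star\}^{d\times m}$ be such that $(A,B)$ is structurally controllable, and let each nonzero entry $B_{ij}$ carry a cost $w_{ij}\ge 0$. Then the matrix $B^{*}$ produced by the combined algorithm (described in the context) is a 2-approximate solution of the problem $\min_{B'\in\mathcal{K}}\|B'\|_w$; that is, $B^{*}\in\mathcal{K}$ and $\|B^{*}\|_w\le 2\min_{B'\in\mathcal{K}}\|B'\|_w$. Moreover, the complexity of the algorithm is $O((d+m)^3)$, where $d$ and $m$ are the numbers of states and inputs.
   Context: A matrix with entries in $\{0,\star\}$ is a sparsity matrix: each entry is either a fixed zero or an independent free parameter $\star$. A numerical realization is obtained by assigning real values to the $\star$ entries (zeros stay zero). The pair $(A,B)$ with $A\in\{0,\star\}^{d\times d}$, $B\in\{0,\star\}^{d\times m}$ is structurally controllable if there is at least one numerical realization $(A',B')$ of $(A,B)$ such that the linear system $\dot x = A'x+B'u$ is controllable. $Z(B)=\{(i,j) : B_{ij}=0\}$, and $\mathcal{K}$ is the set of all $B'\in\{0,\star\}^{d\times m}$ with $Z(B)\subset Z(B')$ and $(A,B')$ structurally controllable. For a matrix $B'\in\{0,\star\}^{d\times m}$ with $Z(B)\subset Z(B')$, $\|B'\|_w=\sum_{(i,j): B'_{ij}\ne0} w_{ij}$. $G(A)$ is the digraph with vertex set $\{v_1,\dots,v_d\}$ and a directed edge $(v_j,v_i)$ whenever $A_{ij}\neq 0$. A strongly connected component (SCC) is a maximal strongly connected subgraph of $G(A)$; it is a source strongly connected component (SSCC)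 if there is no directed edge from a vertex of another SCC into any of its vertices. $\Gamma(A,B)$ is the undirected bipartite graph with parts $V_A^1\sqcup V_B$ and $V_A^2$, where $V_A^1=\{v_1^1,\dots,v_d^1\}$, $V_A^2=\{v_1^2,\dots,v_d^2\}$, $V_B=\{u_1,\dots,u_m\}$, and edge set $\mathcal{E}_A\sqcup\mathcal{E}_B$, where $\mathcal{E}_A=\{(v_j^1,v_i^2): A_{ij}\ne0\}$ and $\mathcal{E}_B=\{(u_j,v_i^2): B_{ij}\neq0\}$. Given a non-negative edge cost function, a minimum cost maximum matching (MCMM) is a matching of maximum cardinality whose total cost is minimal among all maximum cardinality matchings. SSCC-selection algorithm. Set $w_{ij}=\infty$ whenever $B_{ij}=0$ (for practical purposes, $w_{ij}=w_{\max}+1$, where $w_{\max}$ is the largest cost of a nonzero entry of $B$). Determine the SSCCs $\mathcal{S}_1,\dots,\mathcal{S}_q$ of $G(A)$ and set $L=\emptyset$. For each $\mathcal{S}_j$: for each state vertex $v_i\in\mathcal{S}_j$ choose the smallest cost $w_{ik}$ among $w_{i1},\dots,w_{im}$; then among all $v_i\in\mathcal{S}_j$ choose a vertex $v_\ell$ whose chosen cost $w_{\ell k}$ is least (ties broken arbitrarily), and add $(u_k,v_\ell)$ to $L$. Output the $d\times m$ matrix with entry $\star$ at $(\ell,k)$ if $(u_k,v_\ell)\in L$ and $0$ otherwise. Matching algorithm. Construct $\Gamma(A,B)$, with cost $c(e)=0$ for $e\in\mathcal{E}_A$ and $c(e)=w_{kj}$ for $e=(u_j,v_k^2)\in\mathcal{E}_B$.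 Find an MCMM $M^{*}$ in $\Gamma(A,B)$ with cost $c$ (by the Hungarian algorithm). Output the $d\times m$ matrix with entry $\star$ at $(\ell,k)$ if $(u_k,v_\ell^2)\in M^{*}\cap\mathcal{E}_B$ and $0$ otherwise. Combined algorithm. (1) Let $B'$ be the output of the SSCC-selection algorithm. (2) Let $\widetilde B$ be the output of the matching algorithm. (3) Set $B''=B'$. (4) Let $\mathcal{S}_1,\dots,\mathcal{S}_r$ (after relabelling, $r\le q$) be the SSCCs for which there exist $v_\ell\in\mathcal{S}_j$ and $k\in\{1,\dots,m\}$ with $\widetilde B_{\ell k}=\star$. (5) For $j=1,\dots,r$, set $B''_{\ell k}=0$ for all $v_\ell\in\mathcal{S}_j$ and all $k\in\{1,\dots,m\}$. (6) Output $B^{*}=B''\sqcup\widetilde B$, the matrix whose $\star$ entries are the positions that are $\star$ in $B''$ or in $\widetilde B$. Complexity counts elementary operations (arithmetic operations and comparisons on costs at unit cost). *)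

theory Defs
  imports
    "HOL-Library.Extended_Real"
    "HOL-Library.Monad_Syntax"
    "Jordan_Normal_Form.Matrix"
    "Graph_Theory.Graph_Theory"
begin

section \<open>Sparsity matrices and structural controllability\<close>

text \<open>States are numbered 0, ..., d - 1 and inputs 0, ..., m - 1.\<close>

datatype entry = Zero | Star

definition zeros :: "entry mat \<Rightarrow> (nat \<times> nat) set" where
  "zeros B = {(i, j). i < dim_row B \<and> j < dim_col B \<and> B $$ (i, j) = Zero}"

definition realization :: "entry mat \<Rightarrow> real mat \<Rightarrow> bool" where
  "realization S N \<longleftrightarrow> N \<in> carrier_mat (dim_row S) (dim_col S) \<and> (\<forall>(i, j) \<in> zeros S. N $$ (i, j) = 0)"

text \<open>
  Controllability in the sense of steering: every initial state can be transferred to every final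
  state in finite time. Inputs are continuous and trajectories are classical solutions of
  x' = A x + B u on [0, T].
\<close>

definition controllable :: "real mat \<Rightarrow> real mat \<Rightarrow> bool" where
  "controllable A B \<longleftrightarrow>
    (\<forall>x0 \<in> carrier_vec (dim_row A). \<forall>x1 \<in> carrier_vec (dim_row A).
      \<exists>T > 0. \<exists>(u :: real \<Rightarrow> real vec) (x :: real \<Rightarrow> real vec).
        (\<forall>t. u t \<in> carrier_vec (dim_col B)) \<and>
        (\<forall>j < dim_col B. continuous_on {0..T} (\<lambda>t. u t $ j)) \<and>
        (\<forall>t. x t \<in> carrier_vec (dim_row A)) \<and>
        (\<forall>t \<in> {0..T}. \<forall>i < dim_row A.
          ((\<lambda>s. x s $ i) has_real_derivative (A *\<^sub>v x t + B *\<^sub>v u t) $ i) (at t within {0..T})) \<and>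
        x 0 = x0 \<and> x T = x1)"

definition struct_controllable :: "entry mat \<Rightarrow> entry mat \<Rightarrow> bool" where
  "struct_controllable A B \<longleftrightarrow> (\<exists>A' B'. realization A A' \<and> realization B B' \<and> controllable A' B')"

definition feasible :: "entry mat \<Rightarrow> entry mat \<Rightarrow> entry mat set" where
  "feasible A B = {B' \<in> carrier_mat (dim_row B) (dim_col B).
     zeros B \<subseteq> zeros B' \<and> struct_controllable A B'}"

definition wnorm :: "(nat \<Rightarrow> nat \<Rightarrow> real) \<Rightarrow> entry mat \<Rightarrow> real" where
  "wnorm w B' = (\<Sum>(i, j) \<in> {(i, j). i < dim_row B' \<and> j < dim_col B' \<and> B' $$ (i, j) \<noteq> Zero}. w i j)"


section \<open>The graphs\<close>

text \<open>The arc from vertex j to vertex i is the pair (j, i).\<close>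

definition state_digraph :: "entry mat \<Rightarrow> nat pair_pre_digraph" where
  "state_digraph A = \<lparr>pverts = {..<dim_row A},
     parcs = {(j, i). i < dim_row A \<and> j < dim_row A \<and> A $$ (i, j) \<noteq> Zero}\<rparr>"

text \<open>The source strongly connected components, represented by their vertex sets.\<close>

definition source_sccs :: "entry mat \<Rightarrow> nat set set" where
  "source_sccs A = {verts S | S. S \<in> pre_digraph.sccs (with_proj (state_digraph A)) \<and>
     \<not> (\<exists>S' \<in> pre_digraph.sccs (with_proj (state_digraph A)). S' \<noteq> S \<and>
          (\<exists>e \<in> parcs (state_digraph A). fst e \<in> verts S' \<and> snd e \<in> verts S))}"

text \<open>
  An edge of the bipartite graph is a pair consisting of its end in the first part (a state vertex
  V1 j or an input vertex U j) and the index of its end in the second part.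
\<close>

datatype left_vertex = V1 nat | U nat

definition state_edges :: "entry mat \<Rightarrow> (left_vertex \<times> nat) set" where
  "state_edges A = {(V1 j, i) | i j. i < dim_row A \<and> j < dim_col A \<and> A $$ (i, j) \<noteq> Zero}"

definition input_edges :: "entry mat \<Rightarrow> (left_vertex \<times> nat) set" where
  "input_edges B = {(U j, i) | i j. i < dim_row B \<and> j < dim_col B \<and> B $$ (i, j) \<noteq> Zero}"

definition is_matching :: "('a \<times> 'b) set \<Rightarrow> ('a \<times> 'b) set \<Rightarrow> bool" where
  "is_matching E M \<longleftrightarrow> M \<subseteq> E \<and> (\<forall>e \<in> M. \<forall>f \<in> M. e \<noteq> f \<longrightarrow> fst e \<noteq> fst f \<and> snd e \<noteq> snd f)"

definition is_maximum_matching :: "('a \<times> 'b) set \<Rightarrow> ('a \<times> 'b) set \<Rightarrow> bool" where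
  "is_maximum_matching E M \<longleftrightarrow> is_matching E M \<and> (\<forall>M'. is_matching E M' \<longrightarrow> card M' \<le> card M)"

definition is_mcmm :: "('a \<times> 'b) set \<Rightarrow> ('a \<times> 'b \<Rightarrow> real) \<Rightarrow> ('a \<times> 'b) set \<Rightarrow> bool" where
  "is_mcmm E c M \<longleftrightarrow> is_maximum_matching E M \<and>
     (\<forall>M'. is_maximum_matching E M' \<longrightarrow> sum c M \<le> sum c M')"

fun edge_cost :: "(nat \<Rightarrow> nat \<Rightarrow> real) \<Rightarrow> left_vertex \<times> nat \<Rightarrow> real" where
  "edge_cost w (V1 j, k) = 0"
| "edge_cost w (U j, k) = w k j"


section \<open>The three algorithms as nondeterministic procedures\<close>

text \<open>
  Each predicate below says that the last argument is a possible output of the procedure, for some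
  way of breaking ties and some choice of the minimum cost maximum matching.
\<close>

definition ext_cost :: "entry mat \<Rightarrow> (nat \<Rightarrow> nat \<Rightarrow> real) \<Rightarrow> nat \<Rightarrow> nat \<Rightarrow> ereal" where
  "ext_cost B w i k = (if B $$ (i, k) = Zero then \<infinity> else ereal (w i k))"

text \<open>
  Here ch i is the input chosen for the state vertex i, and sel S is the state vertex chosen for
  the component S.
\<close>

definition sscc_selection_output ::
  "entry mat \<Rightarrow> entry mat \<Rightarrow> (nat \<Rightarrow> nat \<Rightarrow> real) \<Rightarrow> entry mat \<Rightarrow> bool" where
  "sscc_selection_output A B w B' \<longleftrightarrow>
    (\<exists>(ch :: nat \<Rightarrow> nat) (sel :: nat set \<Rightarrow> nat).
      (\<forall>S \<in> source_sccs A.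
        (\<forall>i \<in> S. ch i < dim_col B \<and> (\<forall>k < dim_col B. ext_cost B w i (ch i) \<le> ext_cost B w i k)) \<and>
        sel S \<in> S \<and> (\<forall>i \<in> S. ext_cost B w (sel S) (ch (sel S)) \<le> ext_cost B w i (ch i))) \<and>
      (let L = {(ch (sel S), sel S) | S. S \<in> source_sccs A} in
        B' = mat (dim_row B) (dim_col B) (\<lambda>(l, k). if (k, l) \<in> L then Star else Zero)))"

definition matching_output ::
  "entry mat \<Rightarrow> entry mat \<Rightarrow> (nat \<Rightarrow> nat \<Rightarrow> real) \<Rightarrow> entry mat \<Rightarrow> bool" where
  "matching_output A B w Bt \<longleftrightarrow>
    (\<exists>M. is_mcmm (state_edges A \<union> input_edges B) (edge_cost w) M \<and>
      Bt = mat (dim_row B) (dim_col B)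
        (\<lambda>(l, k). if (U k, l) \<in> M \<inter> input_edges B then Star else Zero))"

definition hit_sccs :: "entry mat \<Rightarrow> entry mat \<Rightarrow> nat set set" where
  "hit_sccs A Bt = {S \<in> source_sccs A. \<exists>l \<in> S. \<exists>k < dim_col Bt. Bt $$ (l, k) = Star}"

definition clear_rows :: "nat set \<Rightarrow> entry mat \<Rightarrow> entry mat" where
  "clear_rows R B' = mat (dim_row B') (dim_col B') (\<lambda>(l, k). if l \<in> R then Zero else B' $$ (l, k))"

definition join :: "entry mat \<Rightarrow> entry mat \<Rightarrow> entry mat" where
  "join B1 B2 = mat (dim_row B1) (dim_col B1)
     (\<lambda>(l, k). if B1 $$ (l, k) = Star \<or> B2 $$ (l, k) = Star then Star else Zero)"

definition combined_output ::
  "entry mat \<Rightarrow> entry mat \<Rightarrow> (nat \<Rightarrow> nat \<Rightarrow> real) \<Rightarrow> entry mat \<Rightarrow> bool" where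
  "combined_output A B w Bs \<longleftrightarrow>
    (\<exists>B' Bt. sscc_selection_output A B w B' \<and> matching_output A B w Bt \<and>
      Bs = join (clear_rows (\<Union> (hit_sccs A Bt)) B') Bt)"


section \<open>Programs with operation counts\<close>

text \<open>
  A timed value carries the number of elementary operations spent on computing it. The command
  op e charges one operation; in the programs below its argument is always a single primitive: one
  array (or input matrix) access or update, one arithmetic operation, one comparison or one
  Boolean connective on values already at hand. Loops charge one further operation for each
  iteration, and the creation of an array charges its size. Arrays are functions on indices; every
  array is used single-threadedly, so an update can be done in place.
\<close>

datatype 'a timed = Timed (result: 'a) (steps: nat)

definition bind_timed :: "'a timed \<Rightarrow> ('a \<Rightarrow> 'b timed) \<Rightarrow> 'b timed" where
  "bind_timed p f =
     Timed (result (f (result p))) (steps p + steps (f (result p)))"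

adhoc_overloading Monad_Syntax.bind \<rightleftharpoons> bind_timed

definition return :: "'a \<Rightarrow> 'a timed" where
  "return x = Timed x 0"

definition op :: "'a \<Rightarrow> 'a timed" where
  "op x = Timed x 1"

definition new_array :: "nat \<Rightarrow> 'a \<Rightarrow> ('i \<Rightarrow> 'a) timed" where
  "new_array n x = Timed (\<lambda>_. x) n"

text \<open>loop n f s runs f 0, ..., f (n - 1) in this order, starting from the state s.\<close>

primrec loop :: "nat \<Rightarrow> (nat \<Rightarrow> 's \<Rightarrow> 's timed) \<Rightarrow> 's \<Rightarrow> 's timed" where
  "loop 0 f s = return s"
| "loop (Suc n) f s = do { s' \<leftarrow> loop n f s; s'' \<leftarrow> op s'; f n s'' }"

text \<open>repeat n f s iterates f until f reports completion, but at most n times.\<close>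

primrec repeat :: "nat \<Rightarrow> ('s \<Rightarrow> (bool \<times> 's) timed) \<Rightarrow> 's \<Rightarrow> 's timed" where
  "repeat 0 f s = return s"
| "repeat (Suc n) f s = do {
     (finished, s') \<leftarrow> f s;
     b \<leftarrow> op finished;
     if b then return s' else repeat n f s' }"


section \<open>Source strongly connected components and selection\<close>

text \<open>Warshall's algorithm: R (i, j) says that vertex j is reachable from vertex i.\<close>

definition reach_alg :: "nat \<Rightarrow> entry mat \<Rightarrow> (nat \<times> nat \<Rightarrow> bool) timed" where
  "reach_alg d A = do {
     R \<leftarrow> new_array (d * d) False;
     R \<leftarrow> loop d (\<lambda>i. loop d (\<lambda>j R. do {
       a \<leftarrow> op (A $$ (j, i));
       b \<leftarrow> op (a = Star);
       e \<leftarrow> op (i = j);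
       r \<leftarrow> op (b \<or> e);
       op (R((i, j) := r)) })) R;
     loop d (\<lambda>k. loop d (\<lambda>i. loop d (\<lambda>j R. do {
       ik \<leftarrow> op (R (i, k));
       kj \<leftarrow> op (R (k, j));
       b \<leftarrow> op (ik \<and> kj);
       if b then op (R((i, j) := True)) else return R }))) R }"

text \<open>
  The result marks the smallest vertex of each source strongly connected component: a vertex r is
  unmarked if some i reaches r but not conversely, or if some i < r is in its component.
\<close>

definition heads_alg :: "nat \<Rightarrow> (nat \<times> nat \<Rightarrow> bool) \<Rightarrow> (nat \<Rightarrow> bool) timed" where
  "heads_alg d R = do {
     hds \<leftarrow> new_array d True;
     loop d (\<lambda>r. loop d (\<lambda>i hds. do {
       ir \<leftarrow> op (R (i, r));
       ri \<leftarrow> op (R (r, i));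
       nri \<leftarrow> op (\<not> ri);
       lt \<leftarrow> op (i < r);
       bad \<leftarrow> op (nri \<or> lt);
       b \<leftarrow> op (ir \<and> bad);
       if b then op (hds(r := False)) else return hds })) hds }"

definition same_scc_alg :: "(nat \<times> nat \<Rightarrow> bool) \<Rightarrow> nat \<Rightarrow> nat \<Rightarrow> bool timed" where
  "same_scc_alg R i j = do {
     ij \<leftarrow> op (R (i, j));
     ji \<leftarrow> op (R (j, i));
     op (ij \<and> ji) }"

definition max_cost_alg :: "nat \<Rightarrow> nat \<Rightarrow> entry mat \<Rightarrow> (nat \<Rightarrow> nat \<Rightarrow> real) \<Rightarrow> real timed" where
  "max_cost_alg d m B w =
     loop d (\<lambda>i. loop m (\<lambda>k x. do {
       e \<leftarrow> op (B $$ (i, k));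
       star \<leftarrow> op (e = Star);
       if star then do {
         y \<leftarrow> op (w i k);
         b \<leftarrow> op (x < y);
         if b then return y else return x }
       else return x })) 0"

text \<open>The cost array with the entries outside B replaced by big.\<close>

definition cost_array_alg ::
  "nat \<Rightarrow> nat \<Rightarrow> entry mat \<Rightarrow> (nat \<Rightarrow> nat \<Rightarrow> real) \<Rightarrow> real \<Rightarrow> (nat \<times> nat \<Rightarrow> real) timed" where
  "cost_array_alg d m B w big = do {
     W \<leftarrow> new_array (d * m) big;
     loop d (\<lambda>i. loop m (\<lambda>k W. do {
       e \<leftarrow> op (B $$ (i, k));
       star \<leftarrow> op (e = Star);
       if star then do {
         y \<leftarrow> op (w i k);
         op (W((i, k) := y)) }
       else return W })) W }"

definition cheapest_input_alg :: "nat \<Rightarrow> (nat \<times> nat \<Rightarrow> real) \<Rightarrow> nat \<Rightarrow> nat timed" where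
  "cheapest_input_alg m W i =
     loop m (\<lambda>k best. do {
       x \<leftarrow> op (W (i, k));
       y \<leftarrow> op (W (i, best));
       b \<leftarrow> op (x < y);
       if b then return k else return best }) 0"

definition sscc_selection_alg ::
  "nat \<Rightarrow> nat \<Rightarrow> (nat \<times> nat \<Rightarrow> bool) \<Rightarrow> (nat \<Rightarrow> bool) \<Rightarrow> entry mat \<Rightarrow> (nat \<Rightarrow> nat \<Rightarrow> real) \<Rightarrow>
   (nat \<times> nat \<Rightarrow> entry) timed" where
  "sscc_selection_alg d m R hds B w = do {
     wmax \<leftarrow> max_cost_alg d m B w;
     big \<leftarrow> op (wmax + 1);
     W \<leftarrow> cost_array_alg d m B w big;
     X \<leftarrow> new_array (d * m) Zero;
     loop d (\<lambda>r X. do {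
       h \<leftarrow> op (hds r);
       if h then do {
         k0 \<leftarrow> cheapest_input_alg m W r;
         (l, k) \<leftarrow> loop d (\<lambda>i (l, k). do {
           b \<leftarrow> same_scc_alg R r i;
           if b then do {
             k' \<leftarrow> cheapest_input_alg m W i;
             x \<leftarrow> op (W (i, k'));
             y \<leftarrow> op (W (l, k));
             c \<leftarrow> op (x < y);
             if c then return (i, k') else return (l, k) }
           else return (l, k) }) (r, k0);
         op (X((l, k) := Star)) }
       else return X }) X }"


section \<open>The Hungarian algorithm\<close>

text \<open>
  Given a real cost array c for n rows and N \<ge> n columns, the algorithm assigns the rows one after
  another, each by a cheapest augmenting path. It keeps row potentials u, column potentials v and
  the partial assignment p from columns to rows; the reduced costs c (i, j) - u i - v j stay
  non-negative and vanish on the assigned pairs.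

  While a path from the free row i is searched, used j says that column j belongs to the
  alternating tree, slack j (for j outside the tree) is the least reduced cost of an entry of
  column j in a tree row, and way j is the tree column whose assigned row attains it (None stands
  for the root row i). Each round moves a column of least slack into the tree; the search is
  finished when that column is unassigned.
\<close>

type_synonym potentials = "(nat \<Rightarrow> real) \<times> (nat \<Rightarrow> real)"

type_synonym search_state =
  "potentials \<times> (nat \<Rightarrow> bool) \<times> (nat \<Rightarrow> real) \<times> (nat \<Rightarrow> nat option) \<times> nat option"

definition least_slack_alg ::
  "nat \<Rightarrow> (nat \<Rightarrow> bool) \<Rightarrow> (nat \<Rightarrow> real) \<Rightarrow> nat option timed" where
  "least_slack_alg N used slack =
     loop N (\<lambda>j best. do {
       uj \<leftarrow> op (used j);
       if uj then return best
       else (case best of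
           None \<Rightarrow> return (Some j)
         | Some j' \<Rightarrow> do {
             x \<leftarrow> op (slack j);
             y \<leftarrow> op (slack j');
             b \<leftarrow> op (x < y);
             if b then return (Some j) else return best }) }) None"

definition shift_alg ::
  "nat \<Rightarrow> (nat \<Rightarrow> nat option) \<Rightarrow> (nat \<Rightarrow> bool) \<Rightarrow> real \<Rightarrow> nat \<Rightarrow> potentials \<Rightarrow> (nat \<Rightarrow> real) \<Rightarrow>
   (potentials \<times> (nat \<Rightarrow> real)) timed" where
  "shift_alg N p used delta i uv slack = (case uv of (u, v) \<Rightarrow> do {
     x \<leftarrow> op (u i);
     x \<leftarrow> op (x + delta);
     u \<leftarrow> op (u(i := x));
     loop N (\<lambda>j ((u, v), slack). do {
       uj \<leftarrow> op (used j);
       if uj then do {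
         pj \<leftarrow> op (p j);
         r \<leftarrow> op (the pj);
         x \<leftarrow> op (u r);
         x \<leftarrow> op (x + delta);
         u \<leftarrow> op (u(r := x));
         y \<leftarrow> op (v j);
         y \<leftarrow> op (y - delta);
         v \<leftarrow> op (v(j := y));
         return ((u, v), slack) }
       else do {
         x \<leftarrow> op (slack j);
         x \<leftarrow> op (x - delta);
         slack \<leftarrow> op (slack(j := x));
         return ((u, v), slack) } }) ((u, v), slack) })"

definition relax_alg ::
  "nat \<Rightarrow> (nat \<times> nat \<Rightarrow> real) \<Rightarrow> potentials \<Rightarrow> (nat \<Rightarrow> bool) \<Rightarrow> nat \<Rightarrow> nat option \<Rightarrow>
   (nat \<Rightarrow> real) \<times> (nat \<Rightarrow> nat option) \<Rightarrow> ((nat \<Rightarrow> real) \<times> (nat \<Rightarrow> nat option)) timed" where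
  "relax_alg N c uv used r from sw = (case uv of (u, v) \<Rightarrow> do {
     ur \<leftarrow> op (u r);
     loop N (\<lambda>j (slack, way). do {
       uj \<leftarrow> op (used j);
       if uj then return (slack, way)
       else do {
         x \<leftarrow> op (c (r, j));
         x \<leftarrow> op (x - ur);
         vj \<leftarrow> op (v j);
         x \<leftarrow> op (x - vj);
         y \<leftarrow> op (slack j);
         b \<leftarrow> op (x < y);
         if b then do {
           slack \<leftarrow> op (slack(j := x));
           way \<leftarrow> op (way(j := from));
           return (slack, way) }
         else return (slack, way) } }) sw })"

definition search_round_alg ::
  "nat \<Rightarrow> (nat \<times> nat \<Rightarrow> real) \<Rightarrow> (nat \<Rightarrow> nat option) \<Rightarrow> nat \<Rightarrow> search_state \<Rightarrow>
   (bool \<times> search_state) timed" where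
  "search_round_alg N c p i st = (case st of (uv, used, slack, way, fin) \<Rightarrow> do {
     best \<leftarrow> least_slack_alg N used slack;
     case best of
       None \<Rightarrow> return (True, (uv, used, slack, way, None))
     | Some j \<Rightarrow> do {
         delta \<leftarrow> op (slack j);
         (uv, slack) \<leftarrow> shift_alg N p used delta i uv slack;
         used \<leftarrow> op (used(j := True));
         pj \<leftarrow> op (p j);
         (case pj of
            None \<Rightarrow> return (True, (uv, used, slack, way, Some j))
          | Some r \<Rightarrow> do {
              (slack, way) \<leftarrow> relax_alg N c uv used r (Some j) (slack, way);
              return (False, (uv, used, slack, way, None)) }) } })"

definition augment_alg ::
  "nat \<Rightarrow> (nat \<Rightarrow> nat option) \<Rightarrow> nat \<Rightarrow> nat \<Rightarrow> (nat \<Rightarrow> nat option) \<Rightarrow> (nat \<Rightarrow> nat option) timed" where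
  "augment_alg N way i j p = do {
     (p, j) \<leftarrow> repeat N (\<lambda>(p, j). do {
       wj \<leftarrow> op (way j);
       case wj of
         None \<Rightarrow> do {
           p \<leftarrow> op (p(j := Some i));
           return (True, (p, j)) }
       | Some j' \<Rightarrow> do {
           r \<leftarrow> op (p j');
           p \<leftarrow> op (p(j := r));
           return (False, (p, j')) } }) (p, j);
     return p }"

definition assign_row_alg ::
  "nat \<Rightarrow> (nat \<times> nat \<Rightarrow> real) \<Rightarrow> nat \<Rightarrow> potentials \<times> (nat \<Rightarrow> nat option) \<Rightarrow>
   (potentials \<times> (nat \<Rightarrow> nat option)) timed" where
  "assign_row_alg N c i st = (case st of (uv, p) \<Rightarrow> do {
     used \<leftarrow> new_array N False;
     slack \<leftarrow> new_array N 0;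
     way \<leftarrow> new_array N None;
     slack \<leftarrow> loop N (\<lambda>j slack. do {
       x \<leftarrow> op (c (i, j));
       ui \<leftarrow> op (fst uv i);
       x \<leftarrow> op (x - ui);
       vj \<leftarrow> op (snd uv j);
       x \<leftarrow> op (x - vj);
       op (slack(j := x)) }) slack;
     (uv, used, slack, way, fin) \<leftarrow>
       repeat N (search_round_alg N c p i) (uv, used, slack, way, None);
     (case fin of
        None \<Rightarrow> return (uv, p)
      | Some j \<Rightarrow> do {
          p \<leftarrow> augment_alg N way i j p;
          return (uv, p) }) })"

definition hungarian_alg :: "nat \<Rightarrow> nat \<Rightarrow> (nat \<times> nat \<Rightarrow> real) \<Rightarrow> (nat \<Rightarrow> nat option) timed" where
  "hungarian_alg n N c = do {
     u \<leftarrow> new_array n 0;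
     v \<leftarrow> new_array N 0;
     p \<leftarrow> new_array N None;
     (uv, p) \<leftarrow> loop n (assign_row_alg N c) ((u, v), p);
     return p }"


section \<open>The matching algorithm and the combined algorithm\<close>

text \<open>
  Row i of the assignment problem is the vertex i of the second part, column j < d is V1 j, and
  column d + k is U k. Non-edges get the cost big = d * wmax + 1, which exceeds the cost of every
  matching, so an optimal assignment uses as few non-edges as possible; dropping them leaves a
  minimum cost maximum matching.
\<close>

definition assignment_costs_alg ::
  "nat \<Rightarrow> nat \<Rightarrow> entry mat \<Rightarrow> entry mat \<Rightarrow> (nat \<Rightarrow> nat \<Rightarrow> real) \<Rightarrow> (nat \<times> nat \<Rightarrow> real) timed" where
  "assignment_costs_alg d m A B w = do {
     wmax \<leftarrow> max_cost_alg d m B w;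
     big \<leftarrow> loop d (\<lambda>_ x. op (x + wmax)) 1;
     c \<leftarrow> new_array (d * (d + m)) big;
     c \<leftarrow> loop d (\<lambda>i. loop d (\<lambda>j c. do {
       e \<leftarrow> op (A $$ (i, j));
       star \<leftarrow> op (e = Star);
       if star then op (c((i, j) := 0)) else return c })) c;
     loop d (\<lambda>i. loop m (\<lambda>k c. do {
       e \<leftarrow> op (B $$ (i, k));
       star \<leftarrow> op (e = Star);
       if star then do {
         y \<leftarrow> op (w i k);
         j \<leftarrow> op (d + k);
         op (c((i, j) := y)) }
       else return c })) c }"

definition matching_alg ::
  "nat \<Rightarrow> nat \<Rightarrow> entry mat \<Rightarrow> entry mat \<Rightarrow> (nat \<Rightarrow> nat \<Rightarrow> real) \<Rightarrow> (nat \<times> nat \<Rightarrow> entry) timed" where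
  "matching_alg d m A B w = do {
     c \<leftarrow> assignment_costs_alg d m A B w;
     N \<leftarrow> op (d + m);
     p \<leftarrow> hungarian_alg d N c;
     X \<leftarrow> new_array (d * m) Zero;
     loop m (\<lambda>k X. do {
       j \<leftarrow> op (d + k);
       pj \<leftarrow> op (p j);
       case pj of
         None \<Rightarrow> return X
       | Some l \<Rightarrow> do {
           e \<leftarrow> op (B $$ (l, k));
           star \<leftarrow> op (e = Star);
           if star then op (X((l, k) := Star)) else return X } }) X }"

text \<open>Set the rows of all source components that contain a star row of Bt to zero in X.\<close>

definition clear_hit_alg ::
  "nat \<Rightarrow> nat \<Rightarrow> (nat \<times> nat \<Rightarrow> bool) \<Rightarrow> (nat \<Rightarrow> bool) \<Rightarrow> (nat \<times> nat \<Rightarrow> entry) \<Rightarrow>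
   (nat \<times> nat \<Rightarrow> entry) \<Rightarrow> (nat \<times> nat \<Rightarrow> entry) timed" where
  "clear_hit_alg d m R hds Bt X =
     loop d (\<lambda>r X. do {
       h \<leftarrow> op (hds r);
       if h then do {
         hit \<leftarrow> loop d (\<lambda>l hit. do {
           b \<leftarrow> same_scc_alg R r l;
           if b then loop m (\<lambda>k hit. do {
             e \<leftarrow> op (Bt (l, k));
             star \<leftarrow> op (e = Star);
             op (hit \<or> star) }) hit
           else return hit }) False;
         if hit then loop d (\<lambda>l X. do {
           b \<leftarrow> same_scc_alg R r l;
           if b then loop m (\<lambda>k X. op (X((l, k) := Zero))) X
           else return X }) X
         else return X }
       else return X }) X"

definition join_alg ::
  "nat \<Rightarrow> nat \<Rightarrow> (nat \<times> nat \<Rightarrow> entry) \<Rightarrow> (nat \<times> nat \<Rightarrow> entry) \<Rightarrow> (nat \<times> nat \<Rightarrow> entry) timed" where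
  "join_alg d m Bt X =
     loop d (\<lambda>l. loop m (\<lambda>k X. do {
       e \<leftarrow> op (Bt (l, k));
       star \<leftarrow> op (e = Star);
       if star then op (X((l, k) := Star)) else return X })) X"

text \<open>Writing out the final array as a matrix is charged by its size.\<close>

definition output_alg :: "nat \<Rightarrow> nat \<Rightarrow> (nat \<times> nat \<Rightarrow> entry) \<Rightarrow> entry mat timed" where
  "output_alg d m X = Timed (mat d m X) (d * m)"

definition combined_alg ::
  "nat \<Rightarrow> nat \<Rightarrow> entry mat \<Rightarrow> entry mat \<Rightarrow> (nat \<Rightarrow> nat \<Rightarrow> real) \<Rightarrow> entry mat timed" where
  "combined_alg d m A B w = do {
     R \<leftarrow> reach_alg d A;
     hds \<leftarrow> heads_alg d R;
     X \<leftarrow> sscc_selection_alg d m R hds B w;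
     Bt \<leftarrow> matching_alg d m A B w;
     X \<leftarrow> clear_hit_alg d m R hds Bt X;
     X \<leftarrow> join_alg d m Bt X;
     output_alg d m X }"

end

theory Submission
  imports
    Defs
    "HOL-Computational_Algebra.Polynomial_Factorial"
    "HOL-Computational_Algebra.Field_as_Ring"
    "Jordan_Normal_Form.Determinant"
begin

text \<open>
  A pair is structurally controllable iff the matching graph has a matching that covers all rows
  and every source component contains an entry of the input matrix (Lin's theorem). Necessity: a
  controllable realization has trivial left kernel, so some minor of full size has a nonzero
  Leibniz term; and a source component without input evolves autonomously. Sufficiency: the
  matching splits the states into stems, which start at inputs, and cycles. The cycles are attached
  one after another by a single edge, and the product of the weights of each cycle is chosen so
  that the spectrum of the new cycle avoids the zeros of a transfer function.

  Both parts of the output cost at most as much as any feasible matrix X. The rows of a maximum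
  matching of X form a competitor of the minimum cost maximum matching, and X has an entry in each
  of the disjoint source components, where the selection picks a cheapest one.
\<close>


section \<open>Invariant subspaces of cacti\<close>

text \<open>\<open>controllable\<close> speaks of trajectories and not of ranks, so both directions
  of Lin's theorem argue with trajectories. For sufficiency they are polynomials on
  \<open>[0, 1]\<close>: a truncated exponential series solves the homogeneous system to any order
  at one end, two such series are blended, and the remaining error, flat at both ends, is
  compensated by inputs built from its derivatives. No matrix exponential or integral occurs. The
  flatness required is read off the derivation that places a basis vector in \<open>invspan\<close>,
  so membership in that inductive set is all that the weights have to achieve. Weights cannot be
  chosen blindly: two loops of equal weight, hung on the same vertex, move in lockstep and cannot be
  steered independently. Instead of a genericity argument over all weights at once, each cycle has a
  single free parameter \<open>c\<close>, and everything built before is summarized by one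
  annihilating polynomial. In the cost bound the same matrix is charged twice, once for each
  necessary condition of Lin's theorem; this is the origin of the factor 2.\<close>

definition unit :: "'v \<Rightarrow> 'v \<Rightarrow> real" where
  "unit x = (\<lambda>y. if y = x then 1 else 0)"

locale linear_endo =
  fixes T :: "('v \<Rightarrow> real) \<Rightarrow> 'v \<Rightarrow> real"
  assumes T_add: "T (\<lambda>y. v y + w y) = (\<lambda>y. T v y + T w y)"
    and T_scale: "T (\<lambda>y. c * v y) = (\<lambda>y. c * T v y)"

text \<open>The vector \<open>p(T) v\<close>, evaluated by Horner's scheme.\<close>

definition pact :: "(('v \<Rightarrow> real) \<Rightarrow> 'v \<Rightarrow> real) \<Rightarrow> real poly \<Rightarrow> ('v \<Rightarrow> real) \<Rightarrow> 'v \<Rightarrow> real" where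
  "pact T p v = fold_coeffs (\<lambda>a w y. a * v y + T w y) p (\<lambda>_. 0)"

text \<open>The least \<open>T\<close>-invariant subspace containing \<open>G\<close>. For a system
  graph without arcs into inputs, and \<open>G\<close> the unit vectors of the inputs, it is the
  input space plus the Kalman reachable subspace.\<close>

inductive_set invspan :: "(('v \<Rightarrow> real) \<Rightarrow> 'v \<Rightarrow> real) \<Rightarrow> ('v \<Rightarrow> real) set \<Rightarrow> ('v \<Rightarrow> real) set"
  for T G where
  gen: "g \<in> G \<Longrightarrow> g \<in> invspan T G"
| zero: "(\<lambda>_. 0) \<in> invspan T G"
| add: "v \<in> invspan T G \<Longrightarrow> w \<in> invspan T G \<Longrightarrow> (\<lambda>y. v y + w y) \<in> invspan T G"
| scale: "v \<in> invspan T G \<Longrightarrow> (\<lambda>y. c * v y) \<in> invspan T G"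
| apply_op: "v \<in> invspan T G \<Longrightarrow> T v \<in> invspan T G"

lemma invspan_diff:
  assumes "v \<in> invspan T G" "w \<in> invspan T G"
  shows "(\<lambda>y. v y - w y) \<in> invspan T G"
  using invspan.add[OF assms(1) invspan.scale[OF assms(2), of "-1"]] by simp

context linear_endo
begin

lemma T_zero [simp]: "T (\<lambda>_. 0) = (\<lambda>_. 0)"
  using T_scale[of 0 "\<lambda>_. 0"] by simp

lemma pact_0 [simp]: "pact T 0 v = (\<lambda>_. 0)"
  by (simp add: pact_def)

lemma pact_pCons [simp]: "pact T (pCons a p) v = (\<lambda>y. a * v y + T (pact T p v) y)"
  by (cases "p = 0"; cases "a = 0") (simp_all add: pact_def)

lemma pact_1 [simp]: "pact T 1 v = v"
  unfolding one_pCons by simp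

lemma pact_add: "pact T (p + q) v = (\<lambda>y. pact T p v y + pact T q v y)"
  by (induction p q rule: poly_induct2) (simp_all add: T_add algebra_simps)

lemma pact_smult: "pact T (smult c p) v = (\<lambda>y. c * pact T p v y)"
  by (induction p) (simp_all add: T_scale algebra_simps)

lemma pact_diff: "pact T (p - q) v = (\<lambda>y. pact T p v y - pact T q v y)"
  using pact_add[of p "smult (-1) q" v] pact_smult[of "-1" q v] by simp

lemma pact_T: "pact T p (T v) = T (pact T p v)"
  by (induction p) (simp_all add: T_add T_scale)

lemma pact_zero_vec [simp]: "pact T p (\<lambda>_. 0) = (\<lambda>_. 0)"
  by (induction p) simp_all

lemma pact_mult: "pact T (p * q) v = pact T p (pact T q v)"
  by (induction p) (simp_all add: pact_add pact_smult)

lemma pact_monom: "pact T (monom 1 n) v = (T ^^ n) v"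
  by (induction n) (simp_all add: monom_Suc monom_0 flip: one_pCons)

lemma pact_monom_diff: "pact T (monom 1 n - [:c:]) v = (\<lambda>y. (T ^^ n) v y - c * v y)"
  by (simp add: pact_diff pact_monom)

lemma pact_funpow: "pact T p ((T ^^ k) v) = (T ^^ k) (pact T p v)"
  by (induction k) (simp_all add: pact_T)

lemma funpow_zero [simp]: "(T ^^ k) (\<lambda>_. 0) = (\<lambda>_. 0)"
  by (induction k) simp_all

text \<open>Powers of \<open>T\<close> below \<open>n\<close> contribute nothing at
  \<open>x\<close>, so only the coefficient of degree \<open>n\<close> is seen there. This is the
  means to exhibit a nonzero coefficient of a coupling.\<close>

lemma pact_leading:
  assumes "\<forall>i<n. (T ^^ i) v x = 0" "degree p \<le> n"
  shows "pact T p v x = coeff p n * (T ^^ n) v x"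
  using assms
proof (induction n arbitrary: v p)
  case 0
  then obtain a where "p = [:a:]" by (metis degree_eq_zeroE le_0_eq)
  then show ?case by simp
next
  case (Suc n)
  obtain a q where p: "p = pCons a q" by (cases p)
  have "degree q \<le> n" using Suc.prems(2) p by (auto split: if_splits)
  moreover have "\<forall>i<n. (T ^^ i) (T v) x = 0"
    using Suc.prems(1) by (metis Suc_less_eq comp_apply funpow_Suc_right)
  ultimately have "pact T q (T v) x = coeff q n * (T ^^ n) (T v) x"
    using Suc.IH by blast
  moreover have "v x = 0" using Suc.prems(1) by (metis funpow_0 zero_less_Suc)
  ultimately show ?case by (simp add: p pact_T funpow_swap1)
qed

lemma pact_invspan:
  assumes "v \<in> invspan T G" shows "pact T p v \<in> invspan T G"
  using assms by (induction p) (auto intro: invspan.zero invspan.add invspan.scale invspan.apply_op)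

lemma funpow_invspan:
  assumes "v \<in> invspan T G" shows "(T ^^ n) v \<in> invspan T G"
  using assms by (induction n) (auto intro: invspan.apply_op)

end

text \<open>
  If T' feeds the coordinate x of v into the direction e, i.e. T' v = T v + v x * e, then
  f(T') v = f(T) v + (coupling T x v f)(T') e. The coupling does not depend on e or on the action
  of T' on e, which makes it possible to choose the weights of a cycle afterwards.
\<close>

definition coupling :: "(('v \<Rightarrow> real) \<Rightarrow> 'v \<Rightarrow> real) \<Rightarrow> 'v \<Rightarrow> ('v \<Rightarrow> real) \<Rightarrow> real poly \<Rightarrow> real poly" where
  "coupling T x v f = (\<Sum>j<degree f. monom (pact T (poly_shift (Suc j) f) v x) j)"

context linear_endo
begin

lemma coeff_coupling: "coeff (coupling T x v f) j = pact T (poly_shift (Suc j) f) v x"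
proof (cases "j < degree f")
  case True
  then show ?thesis
    by (simp add: coupling_def coeff_sum sum.delta)
next
  case False
  then have "poly_shift (Suc j) f = 0"
    by (intro poly_eqI) (simp add: coeff_poly_shift coeff_eq_0)
  with False show ?thesis by (simp add: coupling_def coeff_sum sum.delta)
qed

text \<open>One Horner step: applying \<open>T'\<close> once more shifts the feeds made earlier and
  adds a new one, the current \<open>x\<close>-coordinate.\<close>

lemma coupling_pCons:
  "coupling T x v (pCons a f) = pCons (pact T f v x) (coupling T x v f)"
proof (rule poly_eqI)
  fix j
  have "poly_shift (Suc j) (pCons a f) = poly_shift j f"
    by (intro poly_eqI) (simp add: coeff_poly_shift)
  moreover have "poly_shift 0 f = f"
    by (intro poly_eqI) (simp add: coeff_poly_shift)
  ultimately show "coeff (coupling T x v (pCons a f)) j = coeff (pCons (pact T f v x) (coupling T x v f)) j"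
    by (cases j) (simp_all add: coeff_coupling)
qed

lemma coupling_0 [simp]: "coupling T x v 0 = 0"
  by (simp add: coupling_def)

text \<open>If the degree of \<open>f\<close> is at most \<open>n\<close>, the coupling of
  \<open>f\<close> itself vanishes, since no signal has arrived at \<open>x\<close> yet. The extra
  factor makes the polynomial long enough: the coefficient of index \<open>degree f\<close> becomes
  the leading coefficient of \<open>f\<close> times \<open>(T ^^ n) v x\<close>.\<close>

lemma coupling_nonzero:
  assumes "\<forall>i<n. (T ^^ i) v x = 0" "(T ^^ n) v x \<noteq> 0" "f \<noteq> 0"
  shows "coupling T x v (monom 1 (Suc n) * f) \<noteq> 0"
proof -
  let ?g = "poly_shift (Suc (degree f)) (monom 1 (Suc n) * f)"
  have cg: "coeff ?g i = (if i + Suc (degree f) < Suc n then 0 else coeff f (i + degree f - n))" for i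
    by (auto simp: coeff_poly_shift coeff_monom_mult)
  have "degree ?g \<le> n"
    by (rule degree_le) (auto simp: cg coeff_eq_0)
  then have "pact T ?g v x = coeff ?g n * (T ^^ n) v x"
    using assms(1) pact_leading by blast
  also have "\<dots> \<noteq> 0" using assms(2,3) by (simp add: cg)
  finally show ?thesis using coeff_coupling[of x v "monom 1 (Suc n) * f" "degree f"] by fastforce
qed

end

text \<open>The polynomials are pairwise coprime for distinct c, so each prime factor of p excludes at most one c.\<close>

lemma finite_not_coprime_monom_diff:
  fixes p :: "real poly"
  assumes "p \<noteq> 0" "0 < n"
  shows "finite {c. \<not> coprime p (monom 1 n - [:c:])}"
proof -
  have "{c. \<not> coprime p (monom 1 n - [:c:])} \<subseteq> (\<Union>q\<in>prime_factors p. {c. q dvd monom 1 n - [:c:]})"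
  proof
    fix c assume "c \<in> {c. \<not> coprime p (monom 1 n - [:c:])}"
    then have "\<not> is_unit (gcd p (monom 1 n - [:c:]))" by (metis is_unit_gcd mem_Collect_eq)
    moreover have "gcd p (monom 1 n - [:c:]) \<noteq> 0" using assms by simp
    ultimately obtain q where "prime q" "q dvd gcd p (monom 1 n - [:c:])"
      using prime_divisor_exists by blast
    then have "q \<in> prime_factors p" "q dvd monom 1 n - [:c:]"
      using assms by (auto simp: prime_factors_dvd)
    then show "c \<in> (\<Union>q\<in>prime_factors p. {c. q dvd monom 1 n - [:c:]})" by blast
  qed
  moreover have "finite {c. q dvd monom 1 n - [:c:]}" if "q \<in> prime_factors p" for q
  proof -
    have "c = c'" if d: "q dvd monom 1 n - [:c:]" "q dvd monom 1 n - [:c':]" for c c'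
    proof (rule ccontr)
      assume "c \<noteq> c'"
      have "q dvd (monom 1 n - [:c:]) - (monom 1 n - [:c':])" using d by (rule dvd_diff)
      also have "\<dots> = [:c' - c:]" by simp
      finally have "is_unit q" using \<open>c \<noteq> c'\<close>
        by (metis dvd_trans eq_iff_diff_eq_0 is_unit_const_poly_iff dvd_field_iff)
      then show False using \<open>q \<in> prime_factors p\<close> by (metis in_prime_factors_imp_prime not_prime_unit)
    qed
    then have "{c. q dvd monom 1 n - [:c:]} \<subseteq> {SOME c. q dvd monom 1 n - [:c:]}"
      by (metis (mono_tags, lifting) mem_Collect_eq singleton_iff someI subsetI)
    then show ?thesis using finite_subset by blast
  qed
  ultimately show ?thesis
    by (meson finite_UN finite_set_mset finite_subset)
qed

lemma bezout_poly:
  fixes p q :: "real poly"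
  assumes "coprime p q"
  obtains a b where "a * p + b * q = 1"
  using assms bezout_coefficients_fst_snd[of p q] by (metis coprime_imp_gcd_eq_1)

text \<open>The vectors whose whole orbit vanishes at \<open>x\<close> form an invariant subspace.
  If it contained all generators it would contain \<open>unit x\<close>, whose value at
  \<open>x\<close> is 1.\<close>

lemma invspan_observable:
  assumes "linear_endo T" "unit x \<in> invspan T (unit ` S)"
  obtains u n where "u \<in> S" "(T ^^ n) (unit u) x \<noteq> 0"
proof -
  interpret linear_endo T by fact
  have "\<forall>n. (T ^^ n) v x = 0"
    if "v \<in> invspan T (unit ` S)" and none: "\<forall>u\<in>S. \<forall>n. (T ^^ n) (unit u) x = 0" for v
    using that(1)
  proof induction
    case (add v w)
    have "(T ^^ n) (\<lambda>y. v y + w y) = (\<lambda>y. (T ^^ n) v y + (T ^^ n) w y)" for n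
      by (induction n) (simp_all add: T_add)
    with add show ?case by simp
  next
    case (scale v c)
    have "(T ^^ n) (\<lambda>y. c * v y) = (\<lambda>y. c * (T ^^ n) v y)" for n
      by (induction n) (simp_all add: T_scale)
    with scale show ?case by simp
  next
    case (apply_op v)
    then show ?case by (metis comp_apply funpow_Suc_right)
  qed (use none in auto)
  from this[OF assms(2)] have "\<exists>u\<in>S. \<exists>n. (T ^^ n) (unit u) x \<noteq> 0"
    by (metis funpow_0 unit_def zero_neq_one)
  then show ?thesis using that by blast
qed

text \<open>Quantified over \<open>T'\<close> and \<open>e\<close> because \<open>c\<close> must be
  known before the weights of the new cycle are set. The annihilator of the enlarged system is part
  of the claim, so that attachments can be iterated.\<close>

definition extends_control ::
  "(('v \<Rightarrow> real) \<Rightarrow> 'v \<Rightarrow> real) \<Rightarrow> 'v set \<Rightarrow> 'v set \<Rightarrow> 'v \<Rightarrow> nat \<Rightarrow> real poly \<Rightarrow> real \<Rightarrow> bool" where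
  "extends_control T X S x n f c \<longleftrightarrow> (\<forall>T' e. linear_endo T' \<longrightarrow>
       (\<forall>v. (\<forall>y. y \<notin> X \<longrightarrow> v y = 0) \<longrightarrow> T' v = (\<lambda>y. T v y + v x * e y)) \<longrightarrow>
       (T' ^^ n) e = (\<lambda>y. c * e y) \<longrightarrow>
       e \<in> invspan T' (unit ` S) \<and>
       (\<forall>y\<in>X. unit y \<in> invspan T' (unit ` S) \<and> pact T' ((monom 1 n - [:c:]) * f) (unit y) = (\<lambda>_. 0)))"

text \<open>
  With f annihilating X, the vector p(T') e is reachable for the nonzero coupling p of f. All but
  finitely many c make p coprime to the annihilator of e, and then e itself is reachable.
\<close>

lemma attach_cycle:
  fixes T :: "('v \<Rightarrow> real) \<Rightarrow> 'v \<Rightarrow> real"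
  assumes lin: "linear_endo T"
    and closed: "\<And>v. \<forall>y. y \<notin> X \<longrightarrow> v y = 0 \<Longrightarrow> \<forall>y. y \<notin> X \<longrightarrow> T v y = 0"
    and "x \<in> X" "S \<subseteq> X" "0 < n"
    and reach: "\<forall>y\<in>X. unit y \<in> invspan T (unit ` S)"
    and ann: "f \<noteq> 0" "\<forall>y\<in>X. pact T f (unit y) = (\<lambda>_. 0)"
  shows "\<exists>c. c \<noteq> 0 \<and> extends_control T X S x n f c"
proof -
  interpret T: linear_endo T by fact
  obtain u i where u: "u \<in> S" "(T ^^ i) (unit u) x \<noteq> 0"
    using invspan_observable[OF lin bspec[OF reach \<open>x \<in> X\<close>]] .
  \<comment> \<open>The first time at which a signal from \<open>u\<close> arrives at
    \<open>x\<close>, as \<open>coupling_nonzero\<close> asks for.\<close>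
  define i0 where "i0 = (LEAST i. (T ^^ i) (unit u) x \<noteq> 0)"
  have i0: "(T ^^ i0) (unit u) x \<noteq> 0" "\<forall>i<i0. (T ^^ i) (unit u) x = 0"
    using LeastI[of "\<lambda>i. (T ^^ i) (unit u) x \<noteq> 0", OF u(2)] not_less_Least
    unfolding i0_def by blast+
  define g where "g = monom 1 (Suc i0) * f"
  define p where "p = coupling T x (unit u) g"
  have "p \<noteq> 0" unfolding p_def g_def using T.coupling_nonzero[OF i0(2,1) ann(1)] .
  then have "finite ({0} \<union> {c. \<not> coprime p (monom 1 n - [:c:])})"
    using finite_not_coprime_monom_diff \<open>0 < n\<close> by blast
  then obtain c where c: "c \<notin> {0} \<union> {c. \<not> coprime p (monom 1 n - [:c:])}"
    using ex_new_if_finite infinite_UNIV_char_0 by blast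
  \<comment> \<open>Since \<open>monom 1 n - [:c:]\<close> will annihilate \<open>e\<close>, this
    identity recovers \<open>e\<close> from \<open>p(T') e\<close> by applying
    \<open>a(T')\<close>.\<close>
  obtain a b where ab: "a * p + b * (monom 1 n - [:c:]) = 1"
    using c bezout_poly by blast
  show ?thesis
    unfolding extends_control_def
  proof (intro exI[of _ c] conjI[of "c \<noteq> 0"] allI impI)
    show "c \<noteq> 0" using c by blast
  next
    fix T' and e :: "'v \<Rightarrow> real"
    assume "linear_endo T'"
      and T'_all: "\<forall>v. (\<forall>y. y \<notin> X \<longrightarrow> v y = 0) \<longrightarrow> T' v = (\<lambda>y. T v y + v x * e y)"
      and cyc: "(T' ^^ n) e = (\<lambda>y. c * e y)"
    interpret T': linear_endo T' by fact
    have T': "T' v = (\<lambda>y. T v y + v x * e y)" if "\<forall>y. y \<notin> X \<longrightarrow> v y = 0" for v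
      using T'_all that by blast
    let ?R = "invspan T' (unit ` S)"
    have supp: "\<forall>y. y \<notin> X \<longrightarrow> pact T h v y = 0" if "\<forall>y. y \<notin> X \<longrightarrow> v y = 0" for h v
      using that by (induction h) (auto simp: closed)
    have couple: "pact T' h v = (\<lambda>y. pact T h v y + pact T' (coupling T x v h) e y)"
      if v: "\<forall>y. y \<notin> X \<longrightarrow> v y = 0" for h v
    proof (induction h)
      case (pCons a h)
      then show ?case
        by (simp add: T.coupling_pCons T'.T_add T'[OF supp[OF v]] algebra_simps)
    qed simp
    have supp_unit: "\<forall>y. y \<notin> X \<longrightarrow> unit z y = 0" if "z \<in> X" for z
      using that by (auto simp: unit_def)
    have kill_e: "pact T' (monom 1 n - [:c:]) e = (\<lambda>_. 0)"
      by (simp add: T'.pact_monom_diff cyc)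
    have ann_g: "pact T g (unit u) = (\<lambda>_. 0)"
      using ann(2) u(1) \<open>S \<subseteq> X\<close> unfolding g_def by (auto simp: T.pact_mult)
    have "pact T' g (unit u) = pact T' p e"
      using couple[OF supp_unit, of u g] u(1) \<open>S \<subseteq> X\<close> ann_g unfolding p_def by auto
    then have "pact T' p e \<in> ?R"
      using T'.pact_invspan[of "unit u" "unit ` S" g] u(1) by (auto intro: invspan.gen)
    then have "pact T' (a * p) e \<in> ?R" by (simp add: T'.pact_mult T'.pact_invspan)
    moreover have "pact T' (a * p + b * (monom 1 n - [:c:])) e = pact T' (a * p) e"
      by (simp only: T'.pact_add T'.pact_mult[of b] kill_e T'.pact_zero_vec add_0_right)
    ultimately have eR: "e \<in> ?R" by (simp add: ab)
    \<comment> \<open>Once \<open>e\<close> is reachable, the feed term can be subtracted, so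
      whatever \<open>T\<close> generates is generated by \<open>T'\<close> too.\<close>
    have "v \<in> ?R \<and> (\<forall>y. y \<notin> X \<longrightarrow> v y = 0)" if "v \<in> invspan T (unit ` S)" for v
      using that
    proof induction
      case (gen v)
      then show ?case using supp_unit \<open>S \<subseteq> X\<close> by (auto intro: invspan.gen)
    next
      case (apply_op v)
      then have "T v = (\<lambda>y. T' v y - v x * e y)" using T' by simp
      moreover have "(\<lambda>y. T' v y - v x * e y) \<in> ?R"
        using apply_op eR by (auto intro!: invspan_diff invspan.apply_op invspan.scale)
      moreover have "\<forall>y. y \<notin> X \<longrightarrow> T v y = 0" using closed apply_op by blast
      ultimately show ?case by (simp only: simp_thms)
    qed (auto intro: invspan.zero invspan.add invspan.scale)
    \<comment> \<open>As \<open>f(T)\<close> kills \<open>unit y\<close>, the vector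
      \<open>f(T') (unit y)\<close> is a polynomial in \<open>T'\<close> applied to
      \<open>e\<close>, and the remaining factor kills \<open>e\<close>.\<close>
    moreover have "pact T' ((monom 1 n - [:c:]) * f) (unit y) = (\<lambda>_. 0)" if "y \<in> X" for y
    proof -
      have "pact T' f (unit y) = pact T' (coupling T x (unit y) f) e"
        using couple[OF supp_unit[OF that], of f] ann(2) that by simp
      then have "pact T' ((monom 1 n - [:c:]) * f) (unit y) =
          pact T' ((monom 1 n - [:c:]) * coupling T x (unit y) f) e"
        by (simp add: T'.pact_mult)
      also have "\<dots> = pact T' (coupling T x (unit y) f * (monom 1 n - [:c:])) e"
        by (simp only: mult.commute)
      also have "\<dots> = (\<lambda>_. 0)" by (simp only: T'.pact_mult kill_e T'.pact_zero_vec)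
      finally show ?thesis .
    qed
    ultimately show "e \<in> ?R \<and> (\<forall>y\<in>X. unit y \<in> ?R \<and>
        pact T' ((monom 1 n - [:c:]) * f) (unit y) = (\<lambda>_. 0))"
      using eR reach by blast
  qed
qed


section \<open>Weighted digraphs: stems, and cycles attached to them\<close>

definition graph_op :: "'v set \<Rightarrow> ('v \<Rightarrow> 'v \<Rightarrow> real) \<Rightarrow> ('v \<Rightarrow> real) \<Rightarrow> 'v \<Rightarrow> real" where
  "graph_op V W v = (\<lambda>y. \<Sum>x\<in>V. W x y * v x)"

lemma linear_endo_graph_op: "linear_endo (graph_op V W)"
  by unfold_locales
    (simp_all add: graph_op_def fun_eq_iff sum.distrib sum_distrib_left algebra_simps)

lemma graph_op_unit: "finite V \<Longrightarrow> x \<in> V \<Longrightarrow> graph_op V W (unit x) = W x"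
  by (simp add: graph_op_def unit_def fun_eq_iff sum.delta if_distrib cong: if_cong)

inductive stem :: "'v set \<Rightarrow> 'v set \<Rightarrow> ('v \<Rightarrow> 'v) \<Rightarrow> nat \<Rightarrow> 'v \<Rightarrow> bool" for V S \<pi> where
  root: "u \<in> S \<Longrightarrow> stem V S \<pi> 0 u"
| grow: "y \<in> V - S \<Longrightarrow> stem V S \<pi> n (\<pi> y) \<Longrightarrow> stem V S \<pi> (Suc n) y"

lemma stem_unique: "stem V S \<pi> n y \<Longrightarrow> stem V S \<pi> n' y \<Longrightarrow> n = n'"
proof (induction arbitrary: n' rule: stem.induct)
  case (root u)
  then show ?case by (auto elim: stem.cases)
next
  case (grow y n)
  from grow.prems grow.hyps(1) obtain k where "n' = Suc k" "stem V S \<pi> k (\<pi> y)"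
    by (auto elim: stem.cases)
  then show ?case using grow.IH by blast
qed

text \<open>The invariant of the construction. \<open>\<pi> y\<close> is the matched predecessor of
  \<open>y\<close>. The complement of \<open>X\<close> is closed under \<open>\<pi>\<close>, hence
  by injectivity and finiteness a union of whole cycles. The annihilator \<open>f\<close> is kept
  for the next application of \<open>attach_cycle\<close>.\<close>

definition controlled_part ::
  "'v set \<Rightarrow> ('v \<times> 'v) set \<Rightarrow> 'v set \<Rightarrow> ('v \<Rightarrow> 'v) \<Rightarrow> 'v set \<Rightarrow> bool" where
  "controlled_part V E S \<pi> X \<longleftrightarrow> S \<subseteq> X \<and> X \<subseteq> V \<and> (\<forall>y\<in>V - X. \<pi> y \<notin> X) \<and>
    (\<exists>W f. (\<forall>x y. W x y \<noteq> 0 \<longrightarrow> (x, y) \<in> E \<and> x \<in> X \<and> y \<in> X) \<and> f \<noteq> 0 \<and>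
       (\<forall>y\<in>X. unit y \<in> invspan (graph_op V W) (unit ` S) \<and> pact (graph_op V W) f (unit y) = (\<lambda>_. 0)))"

text \<open>With weight 1 on the arcs of the stems, the operator moves each unit vector one step
  along its stem or to 0. It is nilpotent on \<open>X\<close>, so a power of the variable serves as
  annihilator.\<close>

lemma controlled_stems:
  assumes V: "finite V" "S \<subseteq> V"
    and \<pi>: "\<And>y. y \<in> V - S \<Longrightarrow> (\<pi> y, y) \<in> E" "inj_on \<pi> (V - S)"
  shows "\<exists>X. controlled_part V E S \<pi> X"
proof -
  define X where "X = {y. \<exists>n. stem V S \<pi> n y}"
  define W :: "'a \<Rightarrow> 'a \<Rightarrow> real" where "W x y = (if y \<in> X - S \<and> x = \<pi> y then 1 else 0)" for x y
  let ?T = "graph_op V W"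
  interpret linear_endo ?T by (rule linear_endo_graph_op)
  have XV: "X \<subseteq> V" using V by (auto simp: X_def elim: stem.cases)
  have SX: "S \<subseteq> X" by (auto simp: X_def intro: stem.root)
  have piX: "\<pi> y \<in> X" if "y \<in> X - S" for y
    using that by (auto simp: X_def elim: stem.cases)
  have inj: "inj_on \<pi> (X - S)" using \<pi>(2) XV by (meson Diff_mono inj_on_subset order_refl)
  \<comment> \<open>By injectivity of \<open>\<pi>\<close>, no other vertex of \<open>X\<close> is
    fed by \<open>\<pi> y\<close>.\<close>
  have T_step: "?T (unit (\<pi> y)) = unit y" if "y \<in> X - S" for y
  proof -
    have "\<pi> y \<in> V" using piX[OF that] XV by blast
    then have "?T (unit (\<pi> y)) = W (\<pi> y)" using graph_op_unit V by metis
    also have "\<dots> = unit y" using that inj_on_eq_iff[OF inj] by (auto simp: W_def unit_def fun_eq_iff)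
    finally show ?thesis .
  qed
  have T_end: "?T (unit x) = (\<lambda>_. 0)" if "x \<in> X" "x \<notin> \<pi> ` (X - S)" for x
  proof -
    have "?T (unit x) = W x" using graph_op_unit V XV that(1) by (metis subsetD)
    also have "\<dots> = (\<lambda>_. 0)" using that(2) by (auto simp: W_def fun_eq_iff)
    finally show ?thesis .
  qed
  have reach: "unit y \<in> invspan ?T (unit ` S)" if "stem V S \<pi> n y" for n y
    using that
  proof induction
    case (grow y n)
    then have "y \<in> X - S" by (auto simp: X_def intro: stem.grow)
    then show ?case using T_step invspan.apply_op[OF grow.IH] by simp
  qed (auto intro: invspan.gen)
  have level: "(?T ^^ k) (unit y) = (\<lambda>_. 0) \<or> (\<exists>z. stem V S \<pi> (n + k) z \<and> (?T ^^ k) (unit y) = unit z)"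
    if "stem V S \<pi> n y" for n y k
  proof (induction k)
    case (Suc k)
    then show ?case
    proof
      assume "\<exists>z. stem V S \<pi> (n + k) z \<and> (?T ^^ k) (unit y) = unit z"
      then obtain z where z: "stem V S \<pi> (n + k) z" "(?T ^^ k) (unit y) = unit z" by blast
      show ?thesis
      proof (cases "z \<in> \<pi> ` (X - S)")
        case True
        then obtain z' where z': "z' \<in> X - S" "z = \<pi> z'" by blast
        then have "stem V S \<pi> (Suc (n + k)) z'" using z(1) XV by (auto intro: stem.grow)
        then show ?thesis using z(2) z' T_step by auto
      next
        case False
        then show ?thesis using z T_end[of z] by (auto simp: X_def)
      qed
    qed simp
  qed (use that in auto)
  have "finite X" using V XV finite_subset by blast
  \<comment> \<open>A strict bound on the depths; it exists because \<open>X\<close> is finite and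
    each vertex has a unique depth.\<close>
  then obtain N where N: "\<And>n y. stem V S \<pi> n y \<Longrightarrow> n < N"
  proof -
    define dep where "dep y = (THE n. stem V S \<pi> n y)" for y
    have dep: "dep y = n" if "stem V S \<pi> n y" for n y
      unfolding dep_def using that by (rule the_equality) (rule stem_unique[OF _ that])
    then have "n < Suc (Max (dep ` X))" if "stem V S \<pi> n y" for n y
    proof -
      have "n \<in> dep ` X" using dep[OF that] that unfolding X_def by blast
      then show ?thesis using \<open>finite X\<close> by (simp add: less_Suc_eq_le)
    qed
    then show ?thesis using that by blast
  qed
  have "pact ?T (monom 1 N) (unit y) = (\<lambda>_. 0)" if "y \<in> X" for y
  proof -
    obtain n where "stem V S \<pi> n y" using \<open>y \<in> X\<close> by (auto simp: X_def)
    from level[OF this, of N] N show ?thesis by (fastforce simp: pact_monom)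
  qed
  moreover have "\<forall>x y. W x y \<noteq> 0 \<longrightarrow> (x, y) \<in> E \<and> x \<in> X \<and> y \<in> X"
    using \<pi>(1) piX XV by (auto simp: W_def)
  moreover have "\<forall>y\<in>V - X. \<pi> y \<notin> X"
    using SX by (auto simp: X_def intro: stem.grow)
  moreover have "monom (1::real) N \<noteq> 0" by simp
  moreover have "\<forall>y\<in>X. unit y \<in> invspan ?T (unit ` S)" using reach by (auto simp: X_def)
  ultimately have "controlled_part V E S \<pi> X"
    using SX XV unfolding controlled_part_def by blast
  then show ?thesis by blast
qed

lemma controlled_extend:
  assumes V: "finite V" "S \<subseteq> V" "E \<subseteq> V \<times> V"
    and \<pi>: "\<And>y. y \<in> V - S \<Longrightarrow> (\<pi> y, y) \<in> E" "inj_on \<pi> (V - S)"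
    and access: "\<And>y. y \<in> V \<Longrightarrow> \<exists>u\<in>S. (u, y) \<in> E\<^sup>*"
    and X: "controlled_part V E S \<pi> X" "X \<noteq> V"
  shows "\<exists>X'. controlled_part V E S \<pi> X' \<and> X \<subset> X'"
proof -
  obtain W f where SX: "S \<subseteq> X" "X \<subseteq> V" "\<forall>y\<in>V - X. \<pi> y \<notin> X"
    and W: "\<And>x y. W x y \<noteq> 0 \<Longrightarrow> (x, y) \<in> E \<and> x \<in> X \<and> y \<in> X" and "f \<noteq> 0"
    and reach: "\<forall>y\<in>X. unit y \<in> invspan (graph_op V W) (unit ` S)"
    and ann: "\<forall>y\<in>X. pact (graph_op V W) f (unit y) = (\<lambda>_. 0)"
    using X unfolding controlled_part_def by blast
  have piV: "\<pi> y \<in> V - X" if "y \<in> V - X" for y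
    using that SX V(3) \<pi>(1) by blast
  have inj: "inj_on \<pi> (V - X)" using \<pi>(2) SX(1) by (meson Diff_mono inj_on_subset order_refl)
  \<comment> \<open>A path from \<open>S\<close>, which lies in \<open>X\<close>, to a vertex
    outside \<open>X\<close> has an arc that leaves \<open>X\<close>. The next cycle is hung on this
    arc.\<close>
  obtain x a where xa: "(x, a) \<in> E" "x \<in> X" "a \<in> V - X"
  proof -
    obtain y where y: "y \<in> V - X" using X(2) SX(2) by blast
    then obtain u where u: "u \<in> S" "(u, y) \<in> E\<^sup>*" using access by blast
    have "\<exists>x a. (x, a) \<in> E \<and> x \<in> X \<and> a \<notin> X"
      if "z \<in> X" "(z, y) \<in> E\<^sup>*" for z
      using that(2,1)
    proof (induction rule: converse_rtrancl_induct)
      case base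
      then show ?case using y by blast
    qed blast
    from this[OF _ u(2)] show ?thesis using that V(3) u(1) SX(1) by blast
  qed
  \<comment> \<open>The orbit of \<open>a\<close> under \<open>\<pi>\<close> repeats by finiteness,
    and injectivity pulls the repetition back to \<open>a\<close> itself. The least period is taken
    so that the cycle passes through \<open>a\<close> only once.\<close>
  obtain n where n: "0 < n" "(\<pi> ^^ n) a = a" "\<And>k. 0 < k \<Longrightarrow> k < n \<Longrightarrow> (\<pi> ^^ k) a \<noteq> a"
  proof -
    have pow: "(\<pi> ^^ k) a \<in> V - X" for k using xa(3) piV by (induction k) auto
    have "\<not> inj_on (\<lambda>k. (\<pi> ^^ k) a) UNIV"
      using pow V(1) by (metis (no_types, lifting) finite_Diff finite_imageD finite_subset image_subsetI infinite_UNIV_nat)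
    then obtain i j where ij: "i < j" "(\<pi> ^^ i) a = (\<pi> ^^ j) a"
      by (metis (mono_tags, lifting) inj_onI linorder_neqE_nat)
    have "(\<pi> ^^ (j - i)) a = a"
      using ij
    proof (induction i arbitrary: j)
      case (Suc i)
      then obtain j' where j: "j = Suc j'" by (cases j) auto
      have "\<pi> ((\<pi> ^^ i) a) = \<pi> ((\<pi> ^^ j') a)" using Suc.prems j by simp
      then have "(\<pi> ^^ i) a = (\<pi> ^^ j') a" using inj_onD[OF inj _ pow pow] by blast
      then show ?case using Suc j by simp
    qed auto
    then have ex: "\<exists>k. 0 < k \<and> (\<pi> ^^ k) a = a" using ij(1) by (meson zero_less_diff)
    show ?thesis
      using LeastI_ex[OF ex] not_less_Least by (intro that[of "LEAST k. 0 < k \<and> (\<pi> ^^ k) a = a"]) blast+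
  qed
  define C where "C = {(\<pi> ^^ k) a |k. k < n}"
  have pow: "(\<pi> ^^ k) a \<in> V - X" for k using xa(3) piV by (induction k) auto
  have CV: "C \<subseteq> V - X" using pow by (auto simp: C_def)
  have aC: "a \<in> C" unfolding C_def using n(1) by (metis (mono_tags, lifting) funpow_0 mem_Collect_eq)
  have piC: "\<pi> y \<in> C" if "y \<in> C" for y
  proof -
    obtain k where "k < n" "y = (\<pi> ^^ k) a" using \<open>y \<in> C\<close> unfolding C_def by blast
    then have "\<pi> y = (\<pi> ^^ Suc k) a" "Suc k = n \<or> Suc k < n" by auto
    then show ?thesis using aC n(2) unfolding C_def by (metis (mono_tags, lifting) mem_Collect_eq)
  qed
  \<comment> \<open>This keeps the complement of the enlarged part closed under
    \<open>\<pi>\<close>.\<close>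
  have C_back: "y \<in> C" if "y \<in> V - X" "\<pi> y \<in> C" for y
  proof -
    obtain k where k: "k < n" "\<pi> y = (\<pi> ^^ k) a" using \<open>\<pi> y \<in> C\<close> unfolding C_def by blast
    obtain k' where "k' < n" "\<pi> y = \<pi> ((\<pi> ^^ k') a)"
    proof (cases k)
      case 0
      obtain n' where "n = Suc n'" using n(1) gr0_implies_Suc by blast
      then show ?thesis using that[of n'] k(2) n(2) 0 by simp
    next
      case (Suc k')
      then show ?thesis using that[of k'] k by simp
    qed
    then have "y = (\<pi> ^^ k') a" using inj_onD[OF inj _ that(1) pow] by blast
    then show ?thesis using \<open>k' < n\<close> by (auto simp: C_def)
  qed
  let ?T = "graph_op V W"
  have closed: "\<forall>y. y \<notin> X \<longrightarrow> ?T v y = 0" for v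
    using W by (force simp: graph_op_def intro!: sum.neutral)
  obtain c where "c \<noteq> 0" and c: "extends_control ?T X S x n f c"
    using attach_cycle[OF linear_endo_graph_op closed xa(2) SX(1) n(1) reach \<open>f \<noteq> 0\<close> ann] by blast
  \<comment> \<open>The old weights, the connecting arc from \<open>x\<close> to \<open>a\<close>,
    and the cycle arcs from \<open>\<pi> y\<close> to \<open>y\<close>. Only the cycle arc into
    \<open>a\<close> has a weight other than 1, so the weight product of the cycle is
    \<open>c\<close>.\<close>
  define W' where "W' z y = W z y + (if z = x \<and> y = a then 1 else 0) +
    (if y \<in> C \<and> z = \<pi> y then (if y = a then c else 1) else 0)" for z y
  let ?T' = "graph_op V W'"
  interpret T': linear_endo ?T' by (rule linear_endo_graph_op)
  have T'_X: "?T' v = (\<lambda>y. ?T v y + v x * unit a y)" if v: "\<forall>y. y \<notin> X \<longrightarrow> v y = 0" for v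
  proof
    fix y
    have v_pi: "y \<in> C \<Longrightarrow> v (\<pi> y) = 0" using v piC CV by blast
    have "?T' v y = (\<Sum>z\<in>V. W z y * v z + (if z = x then (if y = a then v x else 0) else 0))"
      unfolding graph_op_def
    proof (rule sum.cong[OF refl])
      fix z
      have "(if y \<in> C \<and> z = \<pi> y then (if y = a then c else 1) else 0) * v z = 0"
        using v_pi by (cases "y \<in> C \<and> z = \<pi> y") auto
      moreover have "(if z = x \<and> y = a then 1 else 0) * v z = (if z = x then (if y = a then v x else 0) else 0)"
        by simp
      ultimately show "W' z y * v z = W z y * v z + (if z = x then (if y = a then v x else 0) else 0)"
        by (simp only: W'_def distrib_right add_0_right)
    qed
    also have "\<dots> = ?T v y + v x * unit a y"
      using V(1) xa(2) SX(2) by (auto simp: sum.distrib sum.delta graph_op_def unit_def)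
    finally show "?T' v y = ?T v y + v x * unit a y" .
  qed
  have T'_C: "?T' (unit (\<pi> y)) = (\<lambda>z. (if y = a then c else 1) * unit y z)" if "y \<in> C" for y
  proof -
    have "\<pi> y \<in> V" "\<pi> y \<notin> X" using piC[OF that] CV by auto
    then have "?T' (unit (\<pi> y)) = W' (\<pi> y)" using graph_op_unit V(1) by metis
    also have "\<dots> = (\<lambda>z. (if y = a then c else 1) * unit y z)"
    proof
      fix z
      have "W (\<pi> y) z = 0" using W \<open>\<pi> y \<notin> X\<close> by blast
      moreover have "z \<in> C \<and> \<pi> y = \<pi> z \<longleftrightarrow> z = y" using that CV inj by (auto dest: inj_onD)
      ultimately show "W' (\<pi> y) z = (if y = a then c else 1) * unit y z"
        using \<open>\<pi> y \<notin> X\<close> xa(2) by (auto simp: W'_def unit_def)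
    qed
    finally show ?thesis .
  qed
  \<comment> \<open>The operator runs through the cycle against \<open>\<pi>\<close>; hence
    \<open>k\<close> steps of it amount to \<open>n - k\<close> applications of
    \<open>\<pi>\<close>.\<close>
  have orbit: "(?T' ^^ k) (unit a) = unit ((\<pi> ^^ (n - k)) a)" if "k < n" for k
    using that
  proof (induction k)
    case 0
    then show ?case using n(2) by simp
  next
    case (Suc k)
    let ?y = "(\<pi> ^^ (n - Suc k)) a"
    have "?y \<in> C" using Suc.prems by (auto simp: C_def)
    moreover have "?y \<noteq> a" using n(3)[of "n - Suc k"] Suc.prems by simp
    moreover have "n - k = Suc (n - Suc k)" using Suc.prems by simp
    then have "(\<pi> ^^ (n - k)) a = \<pi> ?y" by simp
    ultimately show ?case using Suc T'_C[of ?y] by simp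
  qed
  have cyc: "(?T' ^^ n) (unit a) = (\<lambda>y. c * unit a y)"
  proof -
    obtain k where k: "n = Suc k" using n(1) gr0_implies_Suc by blast
    then have "(?T' ^^ n) (unit a) = ?T' (unit (\<pi> a))" using orbit[of k] by simp
    then show ?thesis using T'_C[OF aC] by simp
  qed
  have "\<forall>v. (\<forall>y. y \<notin> X \<longrightarrow> v y = 0) \<longrightarrow> ?T' v = (\<lambda>y. ?T v y + v x * unit a y)"
    using T'_X by blast
  note res = c[unfolded extends_control_def, THEN spec, THEN spec, THEN mp, THEN mp, THEN mp, OF linear_endo_graph_op this cyc]
  let ?f = "(monom 1 n - [:c:]) * f"
  \<comment> \<open>Every cycle vertex arises from \<open>unit a\<close> by a power of the operator,
    so it inherits reachability and annihilator from \<open>a\<close>.\<close>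
  have C_reach: "unit y \<in> invspan ?T' (unit ` S) \<and> pact ?T' ?f (unit y) = (\<lambda>_. 0)" if "y \<in> C" for y
  proof -
    obtain k where k: "k < n" "unit y = (?T' ^^ k) (unit a)"
    proof -
      obtain j where j: "j < n" "y = (\<pi> ^^ j) a" using \<open>y \<in> C\<close> by (auto simp: C_def)
      show ?thesis
      proof (cases j)
        case 0
        then show ?thesis using that[of 0] j n(1) by simp
      next
        case (Suc j')
        then have "n - (n - j) = j" "n - j < n" using j by auto
        then show ?thesis using that[of "n - j"] orbit[of "n - j"] j by simp
      qed
    qed
    have "pact ?T' (f * (monom 1 n - [:c:])) (unit a) = (\<lambda>_. 0)"
      by (simp add: T'.pact_mult T'.pact_monom_diff cyc del: mult_pCons_right)
    then have "pact ?T' ?f (unit a) = (\<lambda>_. 0)" by (simp only: mult.commute)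
    then show ?thesis
      using k res by (simp add: T'.pact_funpow T'.funpow_invspan)
  qed
  have "?f \<noteq> 0"
  proof -
    have "coeff (monom 1 n - [:c:]) n = 1" using n(1) by (simp add: coeff_pCons split: nat.split)
    then have "monom 1 n - [:c:] \<noteq> 0" by (metis coeff_0 zero_neq_one)
    then show ?thesis using \<open>f \<noteq> 0\<close> by simp
  qed
  moreover have "(z, y) \<in> E \<and> z \<in> X \<union> C \<and> y \<in> X \<union> C" if "W' z y \<noteq> 0" for z y
    using that W xa aC piC CV SX(1) \<pi>(1)[of y] unfolding W'_def by (fastforce split: if_splits)
  moreover have "\<forall>y\<in>X \<union> C. unit y \<in> invspan ?T' (unit ` S) \<and> pact ?T' ?f (unit y) = (\<lambda>_. 0)"
    using C_reach res by blast
  moreover have "\<forall>y\<in>V - (X \<union> C). \<pi> y \<notin> X \<union> C" using SX(3) C_back by blast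
  ultimately have "controlled_part V E S \<pi> (X \<union> C)"
    using SX CV unfolding controlled_part_def by blast
  then show ?thesis using aC CV by blast
qed

lemma cactus:
  assumes V: "finite V" "S \<subseteq> V" "E \<subseteq> V \<times> V"
    and \<pi>: "\<And>y. y \<in> V - S \<Longrightarrow> (\<pi> y, y) \<in> E" "inj_on \<pi> (V - S)"
    and access: "\<And>y. y \<in> V \<Longrightarrow> \<exists>u\<in>S. (u, y) \<in> E\<^sup>*"
  obtains W where "\<And>x y. W x y \<noteq> 0 \<Longrightarrow> (x, y) \<in> E"
    "\<And>y. y \<in> V \<Longrightarrow> unit y \<in> invspan (graph_op V W) (unit ` S)"
proof -
  have "controlled_part V E S \<pi> V"
  proof (rule ccontr)
    assume not_V: "\<not> controlled_part V E S \<pi> V"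
    have "\<not> controlled_part V E S \<pi> X" for X
    proof (induction "card V - card X" arbitrary: X rule: less_induct)
      case less
      show ?case
      proof
        assume X: "controlled_part V E S \<pi> X"
        then have "X \<noteq> V" using not_V by blast
        then obtain X' where X': "controlled_part V E S \<pi> X'" "X \<subset> X'"
          using controlled_extend[OF V \<pi> access X] by blast
        have "X' \<subseteq> V" using X'(1) by (simp add: controlled_part_def)
        then have "card X < card X'" "card X' \<le> card V"
          using X'(2) V(1) by (auto intro: psubset_card_mono card_mono dest: finite_subset)
        then show False using less X' by (meson diff_less_mono2 order_less_le_trans)
      qed
    qed
    then show False using controlled_stems[OF V(1,2) \<pi>] by blast
  qed
  then show ?thesis using that unfolding controlled_part_def by blast
qed


section \<open>Steering by polynomial trajectories\<close>

definition states :: "nat \<Rightarrow> left_vertex set" where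
  "states d = V1 ` {..<d}"

definition inputs :: "nat \<Rightarrow> left_vertex set" where
  "inputs m = U ` {..<m}"

text \<open>The polynomial \<open>t (t - 1)\<close>; divisibility by its powers expresses flatness
  at both ends of \<open>[0, 1]\<close>.\<close>

abbreviation endpoints :: "real poly" where
  "endpoints \<equiv> [:0, 1:] * [:-1, 1:]"

lemma smult_sum_right: "smult c (\<Sum>i\<in>S. f i) = (\<Sum>i\<in>S. smult c (f i))"
  by (induction S rule: infinite_finite_induct) (simp_all add: smult_add_right)

lemma pcompose_power: "pcompose (p ^ n) (r :: 'a::comm_semiring_1 poly) = pcompose p r ^ n"
  by (induction n) (simp_all add: pcompose_mult pcompose_1)

lemma monom_sum: "monom (\<Sum>i\<in>S. f i) n = (\<Sum>i\<in>S. monom (f i) n)"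
  by (induction S rule: infinite_finite_induct) (simp_all flip: add_monom)

lemma power_dvd_pderiv:
  fixes q :: "real poly"
  assumes "q ^ Suc n dvd e"
  shows "q ^ n dvd pderiv e"
proof -
  obtain h where h: "e = q ^ Suc n * h" using assms by (elim dvdE)
  have "pderiv e = q ^ n * (q * pderiv h + smult (of_nat (Suc n)) (pderiv q * h))"
    unfolding h pderiv_mult pderiv_power_Suc by (simp add: algebra_simps del: of_nat_Suc)
  then show ?thesis by simp
qed

lemma graph_op_state:
  "graph_op (states d \<union> inputs m) W v y =
    (\<Sum>j<d. W (V1 j) y * v (V1 j)) + (\<Sum>k<m. W (U k) y * v (U k))"
proof -
  have "graph_op (states d \<union> inputs m) W v y =
      (\<Sum>x\<in>states d. W x y * v x) + (\<Sum>x\<in>inputs m. W x y * v x)"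
    unfolding graph_op_def by (rule sum.union_disjoint) (auto simp: states_def inputs_def)
  also have "(\<Sum>x\<in>states d. W x y * v x) = (\<Sum>j<d. W (V1 j) y * v (V1 j))"
    unfolding states_def by (subst sum.reindex) (auto intro: inj_onI)
  also have "(\<Sum>x\<in>inputs m. W x y * v x) = (\<Sum>k<m. W (U k) y * v (U k))"
    unfolding inputs_def by (subst sum.reindex) (auto intro: inj_onI)
  finally show ?thesis .
qed

text \<open>A trajectory from 0 to 0 under the additional forcing \<open>e\<close>. The state
  coordinates of \<open>v\<close> give the direction of the forcing.\<close>

definition rest_to_rest ::
  "nat \<Rightarrow> nat \<Rightarrow> (left_vertex \<Rightarrow> left_vertex \<Rightarrow> real) \<Rightarrow> (left_vertex \<Rightarrow> real) \<Rightarrow> real poly \<Rightarrow>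
   (nat \<Rightarrow> real poly) \<Rightarrow> (nat \<Rightarrow> real poly) \<Rightarrow> bool" where
  "rest_to_rest d m W v e x u \<longleftrightarrow> (\<forall>i<d. poly (x i) 0 = 0 \<and> poly (x i) 1 = 0 \<and>
    pderiv (x i) = (\<Sum>j<d. smult (W (V1 j) (V1 i)) (x j)) + (\<Sum>k<m. smult (W (U k) (V1 i)) (u k)) +
      smult (v (V1 i)) e)"

text \<open>
  A forcing e in the direction v can be compensated by an input. If x does this for the derivative
  of e and the direction v, then x - e v does it for e and the direction A v.
\<close>

lemma rest_to_rest_exists:
  assumes "v \<in> invspan (graph_op (states d \<union> inputs m) W) (unit ` inputs m)"
  shows "\<exists>n. \<forall>e. endpoints ^ n dvd e \<longrightarrow> (\<exists>x u. rest_to_rest d m W v e x u)"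
  using assms
proof induction
  case (gen v)
  \<comment> \<open>The unit vector of an input has no state coordinates, so there is no forcing to
    compensate.\<close>
  then have "v (V1 i) = 0" for i by (auto simp: inputs_def unit_def)
  then have "rest_to_rest d m W v e (\<lambda>_. 0) (\<lambda>_. 0)" for e by (simp add: rest_to_rest_def)
  then show ?case by blast
next
  case zero
  have "rest_to_rest d m W (\<lambda>_. 0) e (\<lambda>_. 0) (\<lambda>_. 0)" for e by (simp add: rest_to_rest_def)
  then show ?case by blast
next
  case (add v w)
  then obtain n n' where n: "\<And>e. endpoints ^ n dvd e \<Longrightarrow> \<exists>x u. rest_to_rest d m W v e x u"
    and n': "\<And>e. endpoints ^ n' dvd e \<Longrightarrow> \<exists>x u. rest_to_rest d m W w e x u"
    by (elim exE) blast
  show ?case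
  proof (intro exI[of _ "max n n'"] allI impI)
    fix e :: "real poly" assume e: "endpoints ^ max n n' dvd e"
    have "endpoints ^ n dvd e" "endpoints ^ n' dvd e"
      using e by (meson dvd_trans le_imp_power_dvd max.cobounded1 max.cobounded2)+
    then obtain x u y t where x: "rest_to_rest d m W v e x u" and y: "rest_to_rest d m W w e y t"
      using n[of e] n'[of e] by blast
    have "rest_to_rest d m W (\<lambda>y. v y + w y) e (\<lambda>i. x i + y i) (\<lambda>k. u k + t k)"
      unfolding rest_to_rest_def
    proof (intro allI impI)
      fix i assume "i < d"
      note xy = x[unfolded rest_to_rest_def, rule_format, OF this] y[unfolded rest_to_rest_def, rule_format, OF this]
      show "poly (x i + y i) 0 = 0 \<and> poly (x i + y i) 1 = 0 \<and> pderiv (x i + y i) =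
        (\<Sum>j<d. smult (W (V1 j) (V1 i)) (x j + y j)) + (\<Sum>k<m. smult (W (U k) (V1 i)) (u k + t k)) +
        smult (v (V1 i) + w (V1 i)) e"
        unfolding pderiv_add smult_add_right smult_add_left sum.distrib
        using xy by (simp only: poly_add add_ac add_0_left simp_thms)
    qed
    then show "\<exists>x u. rest_to_rest d m W (\<lambda>y. v y + w y) e x u" by blast
  qed
next
  case (scale v c)
  then obtain n where n: "\<And>e. endpoints ^ n dvd e \<Longrightarrow> \<exists>x u. rest_to_rest d m W v e x u"
    by blast
  show ?case
  proof (intro exI[of _ n] allI impI)
    fix e :: "real poly" assume "endpoints ^ n dvd e"
    then have "endpoints ^ n dvd smult c e" by (rule dvd_smult)
    from n[OF this] show "\<exists>x u. rest_to_rest d m W (\<lambda>y. c * v y) e x u"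
      by (simp add: rest_to_rest_def mult.commute)
  qed
next
  case (apply_op v)
  let ?T = "graph_op (states d \<union> inputs m) W"
  from apply_op obtain n where n: "\<And>e. endpoints ^ n dvd e \<Longrightarrow> \<exists>x u. rest_to_rest d m W v e x u"
    by blast
  show ?case
  proof (intro exI[of _ "Suc n"] allI impI)
    fix e :: "real poly" assume e: "endpoints ^ Suc n dvd e"
    have "endpoints dvd e" using e by (metis dvd_mult_left power_Suc)
    then have e01: "poly e 0 = 0" "poly e 1 = 0" by (auto elim!: dvdE)
    obtain x u where x: "rest_to_rest d m W v (pderiv e) x u"
      using n[OF power_dvd_pderiv[OF e]] by blast
    \<comment> \<open>The inputs are corrected by the input coordinates of \<open>v\<close>, so the
      new forcing has the direction \<open>?T v\<close> including the contribution of the inputs.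
      The ends stay at 0 because \<open>e\<close> vanishes there.\<close>
    have "rest_to_rest d m W (?T v) e (\<lambda>i. x i - smult (v (V1 i)) e) (\<lambda>k. u k - smult (v (U k)) e)"
      unfolding rest_to_rest_def
    proof (intro allI impI)
      fix i assume "i < d"
      note xi = x[unfolded rest_to_rest_def, rule_format, OF this]
      have s1: "smult (\<Sum>j<d. W (V1 j) (V1 i) * v (V1 j)) e = (\<Sum>j<d. smult (W (V1 j) (V1 i)) (smult (v (V1 j)) e))"
        by (simp add: smult_sum)
      have s2: "smult (\<Sum>k<m. W (U k) (V1 i) * v (U k)) e = (\<Sum>k<m. smult (W (U k) (V1 i)) (smult (v (U k)) e))"
        by (simp add: smult_sum)
      show "poly (x i - smult (v (V1 i)) e) 0 = 0 \<and> poly (x i - smult (v (V1 i)) e) 1 = 0 \<and>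
        pderiv (x i - smult (v (V1 i)) e) = (\<Sum>j<d. smult (W (V1 j) (V1 i)) (x j - smult (v (V1 j)) e)) +
        (\<Sum>k<m. smult (W (U k) (V1 i)) (u k - smult (v (U k)) e)) + smult (?T v (V1 i)) e"
        unfolding graph_op_state smult_add_left s1 s2 smult_diff_right sum_subtractf
        using xi e01 by (simp only: pderiv_diff pderiv_smult poly_diff poly_smult) (simp add: algebra_simps)
    qed
    then show "\<exists>x u. rest_to_rest d m W (?T v) e x u" by blast
  qed
qed

section \<open>Curves with prescribed ends that nearly solve the homogeneous system\<close>

lemma coprime_endpoints: "coprime ([:0, 1:] ^ k) ([:-1, 1::real:] ^ n)"
proof -
  have "coprime [:0, 1:] [:-1, 1::real:]"
  proof (rule coprimeI)
    fix c :: "real poly" assume "c dvd [:0, 1:]" "c dvd [:-1, 1:]"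
    then have "c dvd [:0, 1:] - [:-1, 1:]" by (rule dvd_diff)
    then show "is_unit c" by (simp add: one_pCons)
  qed
  then show ?thesis by simp
qed

text \<open>The exponential series truncated after degree \<open>n\<close>. Its derivative lacks
  only the last term of the right-hand side, and this term is a multiple of the \<open>n\<close>-th
  power of the variable.\<close>

lemma approximate_solution_0:
  fixes a :: "nat \<Rightarrow> nat \<Rightarrow> real"
  shows "\<exists>p. \<forall>i<d. poly (p i) 0 = z i \<and> [:0, 1:] ^ n dvd pderiv (p i) - (\<Sum>j<d. smult (a i j) (p j))"
proof -
  define A where "A v = (\<lambda>i. \<Sum>j<d. a i j * v j)" for v :: "nat \<Rightarrow> real"
  define p where "p i = (\<Sum>k\<le>n. monom ((A ^^ k) z i / fact k) k)" for i
  have "poly (p i) 0 = z i" for i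
  proof -
    have "poly (p i) 0 = (\<Sum>k\<le>n. if k = 0 then z i else 0)"
      unfolding p_def poly_sum by (rule sum.cong) (auto simp: poly_monom)
    then show ?thesis by simp
  qed
  moreover have "pderiv (p i) - (\<Sum>j<d. smult (a i j) (p j)) = - monom ((A ^^ Suc n) z i / fact n) n" for i
  proof -
    have "pderiv (p i) = (\<Sum>k\<le>n. pderiv (monom ((A ^^ k) z i / fact k) k))"
      unfolding p_def by (induction n) (simp_all add: pderiv_add)
    also have "\<dots> = (\<Sum>k<n. monom ((A ^^ Suc k) z i / fact k) k)"
      by (subst sum.atMost_shift) (simp add: pderiv_monom fact_Suc del: of_nat_Suc)
    finally have dp: "pderiv (p i) = (\<Sum>k<n. monom ((A ^^ Suc k) z i / fact k) k)" .
    have Ap: "(\<Sum>j<d. smult (a i j) (p j)) = (\<Sum>k\<le>n. monom ((A ^^ Suc k) z i / fact k) k)"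
    proof -
      have "(\<Sum>j<d. smult (a i j) (p j)) = (\<Sum>k\<le>n. \<Sum>j<d. monom (a i j * ((A ^^ k) z j / fact k)) k)"
        unfolding p_def by (subst sum.swap) (simp add: smult_sum_right smult_monom)
      also have "\<dots> = (\<Sum>k\<le>n. monom ((A ^^ Suc k) z i / fact k) k)"
        by (intro sum.cong refl, unfold monom_sum[symmetric]) (simp add: A_def sum_divide_distrib)
      finally show ?thesis .
    qed
    show ?thesis unfolding dp Ap by (simp add: lessThan_Suc_atMost[symmetric])
  qed
  moreover have "[:0, 1::real:] ^ n dvd - monom c n" for c
    by (simp add: monom_altdef dvd_smult)
  ultimately show ?thesis by (intro exI[of _ p]) simp
qed


definition defect :: "nat \<Rightarrow> (nat \<Rightarrow> nat \<Rightarrow> real) \<Rightarrow> (nat \<Rightarrow> real poly) \<Rightarrow> nat \<Rightarrow> real poly" where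
  "defect d a p i = pderiv (p i) - (\<Sum>j<d. smult (a i j) (p j))"

lemma defect_add: "defect d a (\<lambda>i. p i + q i) i = defect d a p i + defect d a q i"
  by (simp only: defect_def pderiv_add smult_add_right sum.distrib add_diff_add)

lemma power_dvd_defect:
  fixes q :: "real poly"
  assumes "\<And>i. i < d \<Longrightarrow> q ^ Suc n dvd p i" "i < d"
  shows "q ^ n dvd defect d a p i"
proof -
  have "q ^ n dvd p j" if "j < d" for j
    using assms(1)[OF that] by (metis dvd_mult_right power_Suc)
  then show ?thesis
    unfolding defect_def
    by (intro dvd_diff power_dvd_pderiv assms dvd_sum dvd_smult) auto
qed

text \<open>The system is autonomous, so a shift of time moves the base point from 0 to
  \<open>s\<close>.\<close>

lemma approximate_solution:
  fixes a :: "nat \<Rightarrow> nat \<Rightarrow> real"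
  shows "\<exists>p. \<forall>i<d. poly (p i) s = z i \<and> [:-s, 1:] ^ n dvd defect d a p i"
proof -
  obtain p where p: "\<And>i. i < d \<Longrightarrow> poly (p i) 0 = z i"
    "\<And>i. i < d \<Longrightarrow> [:0, 1:] ^ n dvd pderiv (p i) - (\<Sum>j<d. smult (a i j) (p j))"
    using approximate_solution_0[of d z n a] by blast
  let ?p = "\<lambda>i. pcompose (p i) [:-s, 1:]"
  have "poly (?p i) s = z i" if "i < d" for i
    using p(1)[OF that] by (simp add: poly_pcompose)
  moreover have "[:-s, 1:] ^ n dvd defect d a ?p i" if i: "i < d" for i
  proof -
    obtain h where h: "pderiv (p i) - (\<Sum>j<d. smult (a i j) (p j)) = [:0, 1:] ^ n * h"
      using p(2)[OF i] by (elim dvdE)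
    have "defect d a ?p i = pcompose (pderiv (p i) - (\<Sum>j<d. smult (a i j) (p j))) [:-s, 1:]"
      by (simp add: defect_def pderiv_pcompose pcompose_diff pcompose_sum pcompose_smult pderiv_pCons)
    also have "\<dots> = [:-s, 1:] ^ n * pcompose h [:-s, 1:]"
      unfolding h pcompose_mult by (simp add: pcompose_power pcompose_pCons)
    finally show ?thesis by simp
  qed
  ultimately show ?thesis by (intro exI[of _ ?p] allI impI conjI)
qed

text \<open>Two approximate solutions, one through the prescribed point at time 0 and one at time 1,
  are blended by a polynomial partition of unity that is flat enough to leave each of them intact
  near its own end.\<close>

lemma interpolating_curve:
  fixes a :: "nat \<Rightarrow> nat \<Rightarrow> real"
  shows "\<exists>p. \<forall>i<d. poly (p i) 0 = z0 i \<and> poly (p i) 1 = z1 i \<and> endpoints ^ n dvd defect d a p i"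
proof -
  obtain p0 where p0: "\<And>i. i < d \<Longrightarrow> poly (p0 i) 0 = z0 i" "\<And>i. i < d \<Longrightarrow> [:0, 1:] ^ n dvd defect d a p0 i"
    using approximate_solution[of d 0 z0 n a] by auto
  obtain p1 where p1: "\<And>i. i < d \<Longrightarrow> poly (p1 i) 1 = z1 i" "\<And>i. i < d \<Longrightarrow> [:-1, 1:] ^ n dvd defect d a p1 i"
    using approximate_solution[of d 1 z1 n a] by auto
  \<comment> \<open>The exponent is \<open>Suc n\<close> because the defect contains a derivative
    and loses one order of flatness.\<close>
  obtain \<alpha> \<beta> where bez: "\<alpha> * [:0, 1:] ^ Suc n + \<beta> * [:-1, 1::real:] ^ Suc n = 1"
    using bezout_poly[OF coprime_endpoints] by blast
  define g where "g = \<alpha> * [:0, 1:] ^ Suc n"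
  define h where "h = \<beta> * [:-1, 1::real:] ^ Suc n"
  have gh: "g + h = 1" using bez by (simp only: g_def h_def)
  have h_eq: "h = 1 - g" and g_eq: "g = 1 - h" using gh by (simp_all add: algebra_simps)
  have dvd_g: "[:0, 1:] ^ Suc n dvd g" unfolding g_def by (rule dvd_triv_right)
  have dvd_h: "[:-1, 1:] ^ Suc n dvd h" unfolding h_def by (rule dvd_triv_right)
  have g0: "poly g 0 = 0" "poly h 1 = 0" by (simp_all add: g_def h_def)
  have g1: "poly h 0 = 1" "poly g 1 = 1" using g0 arg_cong[OF gh, of "\<lambda>p. poly p 0"] arg_cong[OF gh, of "\<lambda>p. poly p 1"] by simp_all
  let ?p = "\<lambda>i. p0 i * h + p1 i * g"
  have dvd0: "[:0, 1:] ^ n dvd defect d a ?p i" if i: "i < d" for i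
  proof -
    have "?p = (\<lambda>i. p0 i + (p1 i - p0 i) * g)"
      unfolding h_eq by (simp add: algebra_simps)
    moreover have "[:0, 1:] ^ n dvd defect d a (\<lambda>i. (p1 i - p0 i) * g) i"
      by (rule power_dvd_defect[OF _ i]) (rule dvd_mult[OF dvd_g])
    ultimately show ?thesis using p0(2)[OF i] by (simp only: defect_add dvd_add)
  qed
  have dvd1: "[:-1, 1:] ^ n dvd defect d a ?p i" if i: "i < d" for i
  proof -
    have "?p = (\<lambda>i. p1 i + (p0 i - p1 i) * h)"
      unfolding g_eq by (simp add: algebra_simps)
    moreover have "[:-1, 1:] ^ n dvd defect d a (\<lambda>i. (p0 i - p1 i) * h) i"
      by (rule power_dvd_defect[OF _ i]) (rule dvd_mult[OF dvd_h])
    ultimately show ?thesis using p1(2)[OF i] by (simp only: defect_add dvd_add)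
  qed
  have "endpoints ^ n dvd defect d a ?p i" if "i < d" for i
    using divides_mult[OF dvd0[OF that] dvd1[OF that] coprime_endpoints] by (simp only: power_mult_distrib)
  moreover have "poly (?p i) 0 = z0 i" "poly (?p i) 1 = z1 i" if "i < d" for i
    using p0(1) p1(1) g0 g1 that by simp_all
  ultimately show ?thesis by (intro exI[of _ ?p] allI impI conjI)
qed

text \<open>The interpolating curve has the right ends but a defect. Its negative is split into
  coordinates, each a forcing along one unit vector, and the compensating rest-to-rest trajectories
  are added.\<close>

lemma steering:
  fixes W :: "left_vertex \<Rightarrow> left_vertex \<Rightarrow> real"
  defines "a i j \<equiv> W (V1 j) (V1 i)" and "b i k \<equiv> W (U k) (V1 i)"
  assumes reach: "\<And>i. i < d \<Longrightarrow> unit (V1 i) \<in> invspan (graph_op (states d \<union> inputs m) W) (unit ` inputs m)"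
  shows "\<exists>x u. \<forall>i<d. poly (x i) 0 = z0 i \<and> poly (x i) 1 = z1 i \<and>
    pderiv (x i) = (\<Sum>j<d. smult (a i j) (x j)) + (\<Sum>k<m. smult (b i k) (u k))"
proof -
  let ?sol = "\<lambda>l. rest_to_rest d m W (unit (V1 l))"
  have "\<forall>l\<in>{..<d}. \<exists>n. \<forall>e. endpoints ^ n dvd e \<longrightarrow> (\<exists>x u. ?sol l e x u)"
    using rest_to_rest_exists[OF reach] by blast
  from bchoice[OF this] obtain n where n: "\<forall>l\<in>{..<d}. \<forall>e. endpoints ^ n l dvd e \<longrightarrow> (\<exists>x u. ?sol l e x u)"
    by blast
  \<comment> \<open>The sum of the orders dominates each of them, so a single curve is flat enough
    for all coordinates.\<close>
  obtain p where p: "\<And>i. i < d \<Longrightarrow> poly (p i) 0 = z0 i \<and> poly (p i) 1 = z1 i \<and>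
      endpoints ^ (\<Sum>l<d. n l) dvd defect d a p i"
    using interpolating_curve[of d z0 z1 "\<Sum>l<d. n l" a] by blast
  have "\<forall>l\<in>{..<d}. \<exists>xu. ?sol l (- defect d a p l) (fst xu) (snd xu)"
  proof
    fix l assume l: "l \<in> {..<d}"
    have "n l \<le> (\<Sum>l<d. n l)" using l by (intro member_le_sum) auto
    then have "endpoints ^ n l dvd - defect d a p l"
      using p[of l] l by (meson dvd_minus_iff dvd_trans le_imp_power_dvd lessThan_iff)
    then obtain x u where "?sol l (- defect d a p l) x u" using bspec[OF n l] by blast
    then show "\<exists>xu. ?sol l (- defect d a p l) (fst xu) (snd xu)" by (intro exI[of _ "(x, u)"]) simp
  qed
  from bchoice[OF this] obtain xu where
    xu: "\<forall>l\<in>{..<d}. ?sol l (- defect d a p l) (fst (xu l)) (snd (xu l))" by blast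
  define y where "y l = fst (xu l)" for l
  define u where "u l = snd (xu l)" for l
  have y: "poly (y l i) 0 = 0" "poly (y l i) 1 = 0" "pderiv (y l i) = (\<Sum>j<d. smult (a i j) (y l j)) +
      (\<Sum>k<m. smult (b i k) (u l k)) + smult (unit (V1 l) (V1 i)) (- defect d a p l)"
    if "l < d" "i < d" for l i
    using xu that unfolding rest_to_rest_def y_def u_def a_def b_def by blast+
  have pderiv_sum: "pderiv (\<Sum>l\<in>S. f l) = (\<Sum>l\<in>S. pderiv (f l))" for S :: "nat set" and f :: "nat \<Rightarrow> real poly"
    by (induction S rule: infinite_finite_induct) (simp_all add: pderiv_add)
  show ?thesis
  proof (rule exI[of _ "\<lambda>i. p i + (\<Sum>l<d. y l i)"], rule exI[of _ "\<lambda>k. \<Sum>l<d. u l k"], intro allI impI conjI)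
    fix i assume i: "i < d"
    show "poly (p i + (\<Sum>l<d. y l i)) 0 = z0 i" "poly (p i + (\<Sum>l<d. y l i)) 1 = z1 i"
      using p[OF i] y[OF _ i] by (simp_all add: poly_sum)
    have "(\<Sum>l<d. smult (unit (V1 l) (V1 i)) (- defect d a p l)) = (\<Sum>l<d. if i = l then - defect d a p l else 0)"
      by (rule sum.cong) (auto simp: unit_def)
    also have "\<dots> = - defect d a p i" using i by simp
    finally have "pderiv (p i + (\<Sum>l<d. y l i)) = pderiv (p i) + (\<Sum>l<d. \<Sum>j<d. smult (a i j) (y l j)) +
        (\<Sum>l<d. \<Sum>k<m. smult (b i k) (u l k)) - defect d a p i"
      using y(3)[OF _ i] by (simp add: pderiv_add pderiv_sum sum.distrib sum_subtractf sum_negf)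
    also have "\<dots> = (\<Sum>j<d. smult (a i j) (p j)) + (\<Sum>j<d. \<Sum>l<d. smult (a i j) (y l j)) +
        (\<Sum>k<m. \<Sum>l<d. smult (b i k) (u l k))"
      by (subst (1 3) sum.swap) (simp add: defect_def)
    also have "\<dots> = (\<Sum>j<d. smult (a i j) (p j + (\<Sum>l<d. y l j))) + (\<Sum>k<m. smult (b i k) (\<Sum>l<d. u l k))"
      by (simp add: smult_add_right sum.distrib smult_sum_right)
    finally show "pderiv (p i + (\<Sum>l<d. y l i)) =
        (\<Sum>j<d. smult (a i j) (p j + (\<Sum>l<d. y l j))) + (\<Sum>k<m. smult (b i k) (\<Sum>l<d. u l k))" .
  qed
qed

lemma controllable_if_reach:
  assumes reach: "\<And>i. i < d \<Longrightarrow> unit (V1 i) \<in> invspan (graph_op (states d \<union> inputs m) W) (unit ` inputs m)"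
  shows "controllable (mat d d (\<lambda>(i, j). W (V1 j) (V1 i))) (mat d m (\<lambda>(i, k). W (U k) (V1 i)))"
  unfolding controllable_def
proof (intro ballI)
  let ?A = "mat d d (\<lambda>(i, j). W (V1 j) (V1 i))" and ?B = "mat d m (\<lambda>(i, k). W (U k) (V1 i))"
  fix x0 x1 :: "real vec" assume x01: "x0 \<in> carrier_vec (dim_row ?A)" "x1 \<in> carrier_vec (dim_row ?A)"
  have "\<exists>x u. \<forall>i<d. poly (x i) 0 = x0 $ i \<and> poly (x i) 1 = x1 $ i \<and>
      pderiv (x i) = (\<Sum>j<d. smult (W (V1 j) (V1 i)) (x j)) + (\<Sum>k<m. smult (W (U k) (V1 i)) (u k))"
    by (rule steering[OF reach])
  then obtain x u where xu: "\<And>i. i < d \<Longrightarrow> poly (x i) 0 = x0 $ i" "\<And>i. i < d \<Longrightarrow> poly (x i) 1 = x1 $ i"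
    "\<And>i. i < d \<Longrightarrow> pderiv (x i) = (\<Sum>j<d. smult (W (V1 j) (V1 i)) (x j)) + (\<Sum>k<m. smult (W (U k) (V1 i)) (u k))"
    by (elim exE) blast
  let ?x = "\<lambda>t. vec d (\<lambda>i. poly (x i) t)" and ?u = "\<lambda>t. vec m (\<lambda>k. poly (u k) t)"
  have dyn: "(?A *\<^sub>v ?x t + ?B *\<^sub>v ?u t) $ i = poly (pderiv (x i)) t" if "i < d" for i t
    using that by (simp add: xu(3) poly_sum scalar_prod_def lessThan_atLeast0)
  show "\<exists>T>0. \<exists>u x. (\<forall>t. u t \<in> carrier_vec (dim_col ?B)) \<and> (\<forall>j<dim_col ?B. continuous_on {0..T} (\<lambda>t. u t $ j)) \<and>
      (\<forall>t. x t \<in> carrier_vec (dim_row ?A)) \<and>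
      (\<forall>t\<in>{0..T}. \<forall>i<dim_row ?A. ((\<lambda>s. x s $ i) has_real_derivative (?A *\<^sub>v x t + ?B *\<^sub>v u t) $ i) (at t within {0..T})) \<and>
      x 0 = x0 \<and> x T = x1"
  proof (rule exI[of _ "1::real"], rule conjI, simp, rule exI[of _ ?u], rule exI[of _ ?x], intro conjI allI ballI impI)
    fix t :: real and i assume "i < dim_row ?A"
    then have i: "i < d" by simp
    show "((\<lambda>s. ?x s $ i) has_real_derivative (?A *\<^sub>v ?x t + ?B *\<^sub>v ?u t) $ i) (at t within {0..1})"
      unfolding dyn[OF i] using i poly_DERIV[of "x i" t] by (simp add: has_field_derivative_at_within)
  qed (use x01 xu in \<open>auto intro!: continuous_intros\<close>)
qed


section \<open>Structural controllability\<close>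

definition arcs_of :: "entry mat \<Rightarrow> (nat \<times> nat) set" where
  "arcs_of A = parcs (state_digraph A)"

lemma in_arcs_of: "(j, i) \<in> arcs_of A \<longleftrightarrow> i < dim_row A \<and> j < dim_row A \<and> A $$ (i, j) \<noteq> Zero"
  by (simp add: arcs_of_def state_digraph_def)

text \<open>Sufficiency in Lin's theorem. The two copies of a state in the matching graph are
  identified: a matching edge becomes an arc into its row, and \<open>\<sigma>\<close> becomes the
  predecessor map of a cactus.\<close>

lemma struct_controllable_if_matching_and_access:
  assumes A: "A \<in> carrier_mat d d" and B: "B \<in> carrier_mat d m"
    and \<sigma>: "inj_on \<sigma> {..<d}" "\<And>i. i < d \<Longrightarrow> (\<sigma> i, i) \<in> state_edges A \<union> input_edges B"
    and access: "\<And>i. i < d \<Longrightarrow> \<exists>l<d. \<exists>k<m. B $$ (l, k) \<noteq> Zero \<and> (l, i) \<in> (arcs_of A)\<^sup>*"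
  shows "struct_controllable A B"
proof -
  define E where "E = {(x, V1 i) |x i. (x, i) \<in> state_edges A \<union> input_edges B}"
  define \<pi> where "\<pi> y = \<sigma> (case y of V1 i \<Rightarrow> i | U k \<Rightarrow> k)" for y
  let ?V = "states d \<union> inputs m"
  have E_V: "E \<subseteq> ?V \<times> ?V"
    using A B by (auto simp: E_def state_edges_def input_edges_def states_def inputs_def)
  have diff: "?V - inputs m = states d" by (auto simp: states_def inputs_def)
  have pi_E: "(\<pi> y, y) \<in> E" if "y \<in> ?V - inputs m" for y
    using that \<sigma>(2) unfolding diff by (auto simp: E_def \<pi>_def states_def)
  have pi_inj: "inj_on \<pi> (?V - inputs m)"
    using \<sigma>(1) unfolding diff by (auto simp: inj_on_def \<pi>_def states_def)
  have lift: "(V1 l, V1 i) \<in> E\<^sup>*" if "(l, i) \<in> (arcs_of A)\<^sup>*" for l i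
    using that
  proof induction
    case (step j i)
    then have "(V1 j, V1 i) \<in> E" using A by (auto simp: in_arcs_of E_def state_edges_def)
    with step.IH show ?case by simp
  qed simp
  have acc: "\<exists>u\<in>inputs m. (u, y) \<in> E\<^sup>*" if y: "y \<in> ?V" for y
  proof (cases "y \<in> inputs m")
    case False
    then obtain i where i: "y = V1 i" "i < d" using y by (auto simp: states_def)
    then obtain l k where l: "l < d" "k < m" "B $$ (l, k) \<noteq> Zero" "(l, i) \<in> (arcs_of A)\<^sup>*"
      using access by blast
    then have "(U k, V1 l) \<in> E" using B by (auto simp: E_def input_edges_def)
    with lift[OF l(4)] i(1) have "(U k, y) \<in> E\<^sup>*" by simp
    then show ?thesis using l(2) by (auto simp: inputs_def)
  qed blast
  obtain W where W: "\<And>x y. W x y \<noteq> 0 \<Longrightarrow> (x, y) \<in> E"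
    "\<And>y. y \<in> ?V \<Longrightarrow> unit y \<in> invspan (graph_op ?V W) (unit ` inputs m)"
    using cactus[OF _ _ E_V pi_E pi_inj acc] by (auto simp: states_def inputs_def)
  let ?A = "mat d d (\<lambda>(i, j). W (V1 j) (V1 i))" and ?B = "mat d m (\<lambda>(i, k). W (U k) (V1 i))"
  have "controllable ?A ?B"
    by (rule controllable_if_reach) (use W(2) in \<open>auto simp: states_def\<close>)
  moreover have "W (V1 j) (V1 i) = 0" if "(i, j) \<in> zeros A" for i j
  proof -
    have "(V1 j, V1 i) \<notin> E" using that by (auto simp: zeros_def E_def state_edges_def input_edges_def)
    then show ?thesis using W(1) by blast
  qed
  then have "realization A ?A" using A unfolding realization_def by (auto simp: zeros_def)
  moreover have "W (U k) (V1 i) = 0" if "(i, k) \<in> zeros B" for i k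
  proof -
    have "(U k, V1 i) \<notin> E" using that by (auto simp: zeros_def E_def state_edges_def input_edges_def)
    then show ?thesis using W(1) by blast
  qed
  then have "realization B ?B" using B unfolding realization_def by (auto simp: zeros_def)
  ultimately show ?thesis unfolding struct_controllable_def by blast
qed

section \<open>Necessary conditions for controllability\<close>

lemma controllable_trajectory:
  assumes con: "controllable A B" and A: "A \<in> carrier_mat d d" and B: "B \<in> carrier_mat d m"
    and ends: "x0 \<in> carrier_vec d" "x1 \<in> carrier_vec d"
  obtains T u x where "T > 0" "\<And>t. u t \<in> carrier_vec m" "\<And>t. x t \<in> carrier_vec d"
    "\<And>t i. t \<in> {0..T} \<Longrightarrow> i < d \<Longrightarrow>
      ((\<lambda>s. x s $ i) has_real_derivative (A *\<^sub>v x t + B *\<^sub>v u t) $ i) (at t within {0..T})"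
    "x 0 = x0" "x T = x1"
proof -
  have dims: "dim_row A = d" "dim_col B = m" using A B by auto
  from con[unfolded controllable_def dims, THEN bspec, OF ends(1), THEN bspec, OF ends(2)]
  show ?thesis
  proof (elim exE conjE)
    fix T u x
    assume "0 < T" "\<forall>t. u t \<in> carrier_vec m" "\<forall>t. x t \<in> carrier_vec d"
      "\<forall>t\<in>{0..T}. \<forall>i<d. ((\<lambda>s. x s $ i) has_real_derivative (A *\<^sub>v x t + B *\<^sub>v u t) $ i) (at t within {0..T})"
      "x 0 = x0" "x T = x1"
    then show ?thesis by (intro that[of T u x]) auto
  qed
qed

text \<open>A functional that annihilates \<open>A\<close> and \<open>B\<close> is constant along
  trajectories. Steering from 0 to the vector \<open>q\<close> itself forces the squared length of
  \<open>q\<close> to be 0.\<close>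

lemma controllable_left_kernel:
  assumes con: "controllable A B" and A: "A \<in> carrier_mat d d" and B: "B \<in> carrier_mat d m"
    and qA: "\<And>j. j < d \<Longrightarrow> (\<Sum>i<d. q i * A $$ (i, j)) = 0"
    and qB: "\<And>k. k < m \<Longrightarrow> (\<Sum>i<d. q i * B $$ (i, k)) = 0"
    and l: "l < d"
  shows "q l = 0"
proof -
  obtain T u x where T: "T > 0" and u: "\<And>t. u t \<in> carrier_vec m" and x: "\<And>t. x t \<in> carrier_vec d"
    and dx: "\<And>t i. t \<in> {0..T} \<Longrightarrow> i < d \<Longrightarrow>
      ((\<lambda>s. x s $ i) has_real_derivative (A *\<^sub>v x t + B *\<^sub>v u t) $ i) (at t within {0..T})"
    and ends: "x 0 = 0\<^sub>v d" "x T = vec d q"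
    by (rule controllable_trajectory[OF con A B zero_carrier_vec vec_carrier]) (rule that)
  have dx0: "((\<lambda>s. \<Sum>i<d. q i * x s $ i) has_real_derivative 0) (at t within {0..T})" if t: "t \<in> {0..T}" for t
  proof -
    have "((\<lambda>s. \<Sum>i<d. q i * x s $ i) has_real_derivative (\<Sum>i<d. q i * (A *\<^sub>v x t + B *\<^sub>v u t) $ i)) (at t within {0..T})"
      using dx[OF t] A by (intro DERIV_sum DERIV_cmult) auto
    moreover have "(\<Sum>i<d. q i * (A *\<^sub>v x t + B *\<^sub>v u t) $ i) =
        (\<Sum>i<d. \<Sum>j<d. q i * A $$ (i, j) * x t $ j) + (\<Sum>i<d. \<Sum>k<m. q i * B $$ (i, k) * u t $ k)"
    proof -
      have "q i * (A *\<^sub>v x t + B *\<^sub>v u t) $ i =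
          (\<Sum>j<d. q i * A $$ (i, j) * x t $ j) + (\<Sum>k<m. q i * B $$ (i, k) * u t $ k)" if "i < d" for i
        using that A B x[of t] u[of t]
        by (simp add: scalar_prod_def lessThan_atLeast0 sum_distrib_left distrib_left mult.assoc)
      then show ?thesis by (simp add: sum.distrib)
    qed
    moreover have "\<dots> = (\<Sum>j<d. (\<Sum>i<d. q i * A $$ (i, j)) * x t $ j) + (\<Sum>k<m. (\<Sum>i<d. q i * B $$ (i, k)) * u t $ k)"
      unfolding sum_distrib_right by (subst sum.swap, subst (2) sum.swap) simp
    ultimately show ?thesis using qA qB by simp
  qed
  have "(\<Sum>i<d. q i * x T $ i) = (\<Sum>i<d. q i * x 0 $ i)"
  proof (rule DERIV_isconst2[OF T])
    show "continuous_on {0..T} (\<lambda>s. \<Sum>i<d. q i * x s $ i)" using dx0 by (rule DERIV_continuous_on)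
    show "((\<lambda>s. \<Sum>i<d. q i * x s $ i) has_real_derivative 0) (at t)" if "0 < t" "t < T" for t
      using dx0[of t] that by (simp add: at_within_Icc_at)
  qed (use T in auto)
  then have "(\<Sum>i<d. q i * q i) = 0" unfolding ends by simp
  then have "\<forall>i\<in>{..<d}. q i * q i = 0" by (subst (asm) sum_nonneg_eq_0_iff) auto
  then show ?thesis using l by simp
qed

text \<open>
  The Gram matrix of the rows of N is nonsingular. Expanding its determinant over the choices of
  one summand in each row gives the term of an injective choice f.
\<close>

lemma transversal_if_left_kernel_trivial:
  fixes N :: "nat \<Rightarrow> nat \<Rightarrow> real"
  assumes ker: "\<And>q. (\<And>k. k < n \<Longrightarrow> (\<Sum>i<d. q i * N i k) = 0) \<Longrightarrow> (\<forall>i<d. q i = 0)"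
  shows "\<exists>f. inj_on f {..<d} \<and> (\<forall>i<d. f i < n \<and> N i (f i) \<noteq> 0)"
proof -
  define c where "c k = vec d (\<lambda>i. N i k)" for k
  define G where "G = mat\<^sub>r d d (\<lambda>i. finsum_vec TYPE(real) d (\<lambda>k. N i k \<cdot>\<^sub>v c k) {..<n})"
  have G: "G \<in> carrier_mat d d" unfolding G_def by simp
  have G_ij: "G $$ (i, j) = (\<Sum>k<n. N i k * N j k)" if "i < d" "j < d" for i j
    using that by (simp add: G_def index_finsum_vec c_def)
  have det_G: "det G \<noteq> 0"
  proof
    assume "det G = 0"
    then obtain v where v: "v \<in> carrier_vec d" "v \<noteq> 0\<^sub>v d" "G *\<^sub>v v = 0\<^sub>v d"
      using det_0_iff_vec_prod_zero[OF G] by blast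
    have "(\<Sum>j<d. G $$ (i, j) * v $ j) = 0" if "i < d" for i
      using arg_cong[OF v(3), of "\<lambda>w. w $ i"] that G v(1) by (simp add: scalar_prod_def lessThan_atLeast0)
    \<comment> \<open>The quadratic form of the Gram matrix is a sum of squares, so its null vectors
      lie in the left kernel of \<open>N\<close>.\<close>
    then have "0 = (\<Sum>i<d. v $ i * (\<Sum>j<d. G $$ (i, j) * v $ j))" by simp
    also have "\<dots> = (\<Sum>i<d. \<Sum>j<d. \<Sum>k<n. (v $ i * N i k) * (v $ j * N j k))"
      by (intro sum.cong refl) (simp add: G_ij sum_distrib_left sum_distrib_right ac_simps)
    also have "\<dots> = (\<Sum>i<d. \<Sum>k<n. \<Sum>j<d. (v $ i * N i k) * (v $ j * N j k))"
      by (intro sum.cong refl sum.swap)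
    also have "\<dots> = (\<Sum>k<n. (\<Sum>i<d. v $ i * N i k) * (\<Sum>j<d. v $ j * N j k))"
      by (subst sum.swap) (simp add: sum_product)
    finally have "\<forall>k\<in>{..<n}. (\<Sum>i<d. v $ i * N i k) * (\<Sum>j<d. v $ j * N j k) = 0"
      by (subst (asm) eq_commute, subst (asm) sum_nonneg_eq_0_iff) auto
    then have "\<forall>i<d. v $ i = 0" by (intro ker[of "($) v"]) auto
    then have "v = 0\<^sub>v d" using v(1) by (intro eq_vecI) auto
    then show False using v(2) by blast
  qed
  define D where "D f = det (mat\<^sub>r d d (\<lambda>i. N i (f i) \<cdot>\<^sub>v c (f i)))" for f
  have "det G = sum D {f. (\<forall>i\<in>{0..<d}. f i \<in> {..<n}) \<and> (\<forall>i. i \<notin> {0..<d} \<longrightarrow> f i = i)}"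
    unfolding G_def D_def by (rule det_linear_rows_sum[OF finite_lessThan]) (simp add: c_def)
  with det_G have "sum D {f. (\<forall>i\<in>{0..<d}. f i \<in> {..<n}) \<and> (\<forall>i. i \<notin> {0..<d} \<longrightarrow> f i = i)} \<noteq> 0"
    by simp
  then obtain f where "f \<in> {f. (\<forall>i\<in>{0..<d}. f i \<in> {..<n}) \<and> (\<forall>i. i \<notin> {0..<d} \<longrightarrow> f i = i)}" "D f \<noteq> 0"
    by (rule sum.not_neutral_contains_not_neutral)
  then have f: "\<forall>i\<in>{0..<d}. f i \<in> {..<n}" and det: "det (mat\<^sub>r d d (\<lambda>i. N i (f i) \<cdot>\<^sub>v c (f i))) \<noteq> 0"
    by (simp_all add: D_def)
  have "det (mat\<^sub>r d d (\<lambda>i. N i (f i) \<cdot>\<^sub>v c (f i))) = (\<Prod>i = 0..<d. N i (f i)) * det (mat\<^sub>r d d (\<lambda>i. c (f i)))"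
    by (rule det_rows_mul) (auto simp: c_def)
  \<comment> \<open>The first factor shows that the chosen entries are nonzero; the second one
    excludes that a column is chosen twice.\<close>
  with det have pr: "(\<Prod>i = 0..<d. N i (f i)) \<noteq> 0" and det_c: "det (mat\<^sub>r d d (\<lambda>i. c (f i))) \<noteq> 0" by auto
  have "inj_on f {..<d}"
  proof (rule inj_onI, rule ccontr)
    fix i j assume ij: "i \<in> {..<d}" "j \<in> {..<d}" "f i = f j" "i \<noteq> j"
    have "det (mat\<^sub>r d d (\<lambda>i. c (f i))) = 0"
      by (rule det_identical_rows[of _ d i j]) (use ij in \<open>auto simp: c_def\<close>)
    then show False using det_c by blast
  qed
  moreover have "N i (f i) \<noteq> 0" if "i < d" for i using pr that by auto
  ultimately show ?thesis using f by auto
qed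

text \<open>The transversal lemma is applied to \<open>A'\<close> and \<open>B'\<close> side by
  side: column indices below \<open>d\<close> are states, the others are inputs shifted by
  \<open>d\<close>.\<close>

lemma struct_controllable_matching:
  assumes sc: "struct_controllable A B" and A: "A \<in> carrier_mat d d" and B: "B \<in> carrier_mat d m"
  shows "\<exists>\<sigma>. inj_on \<sigma> {..<d} \<and> (\<forall>i<d. (\<sigma> i, i) \<in> state_edges A \<union> input_edges B)"
proof -
  obtain A' B' where A': "realization A A'" and B': "realization B B'" and con: "controllable A' B'"
    using sc unfolding struct_controllable_def by blast
  have A'c: "A' \<in> carrier_mat d d" and B'c: "B' \<in> carrier_mat d m"
    using A' B' A B unfolding realization_def by auto
  define N where "N i k = (if k < d then A' $$ (i, k) else B' $$ (i, k - d))" for i k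
  have "\<exists>f. inj_on f {..<d} \<and> (\<forall>i<d. f i < d + m \<and> N i (f i) \<noteq> 0)"
  proof (rule transversal_if_left_kernel_trivial, intro allI impI)
    fix q i assume q: "\<And>k. k < d + m \<Longrightarrow> (\<Sum>i<d. q i * N i k) = 0" and i: "i < d"
    show "q i = 0"
    proof (rule controllable_left_kernel[OF con A'c B'c _ _ i])
      show "(\<Sum>i<d. q i * A' $$ (i, j)) = 0" if "j < d" for j using q[of j] that by (simp add: N_def)
      show "(\<Sum>i<d. q i * B' $$ (i, k)) = 0" if "k < m" for k using q[of "d + k"] that by (simp add: N_def)
    qed
  qed
  then obtain f where f: "inj_on f {..<d}" "\<And>i. i < d \<Longrightarrow> f i < d + m \<and> N i (f i) \<noteq> 0" by blast
  let ?\<sigma> = "\<lambda>i. if f i < d then V1 (f i) else U (f i - d)"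
  have "inj_on ?\<sigma> {..<d}"
  proof (rule inj_onI)
    fix i j assume ij: "i \<in> {..<d}" "j \<in> {..<d}" "?\<sigma> i = ?\<sigma> j"
    then have "f i = f j" by (auto split: if_splits)
    then show "i = j" using f(1) ij by (auto dest: inj_onD)
  qed
  moreover have "(?\<sigma> i, i) \<in> state_edges A \<union> input_edges B" if i: "i < d" for i
  proof (cases "f i < d")
    case True
    then have "(i, f i) \<notin> zeros A" using f(2)[OF i] A' unfolding realization_def by (auto simp: N_def)
    then show ?thesis using True i A by (auto simp: zeros_def state_edges_def)
  next
    case False
    then have "(i, f i - d) \<notin> zeros B" using f(2)[OF i] B' unfolding realization_def by (auto simp: N_def)
    then show ?thesis using False i B f(2)[OF i] by (auto simp: zeros_def input_edges_def)
  qed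
  ultimately show ?thesis by blast
qed

text \<open>This gives \<open>E' \<le> K * E\<close> for the squared norm \<open>E\<close> along a
  linear system. Any constant will do, so each mixed product is bounded by the whole sum of
  squares.\<close>

lemma quadratic_form_bound:
  fixes x :: "'a \<Rightarrow> real"
  assumes "finite S"
  shows "(\<Sum>i\<in>S. 2 * x i * (\<Sum>j\<in>S. a i j * x j)) \<le> (\<Sum>i\<in>S. \<Sum>j\<in>S. 2 * \<bar>a i j\<bar>) * (\<Sum>i\<in>S. (x i)\<^sup>2)"
proof -
  have "2 * x i * (a i j * x j) \<le> 2 * \<bar>a i j\<bar> * (\<Sum>i\<in>S. (x i)\<^sup>2)" if "i \<in> S" "j \<in> S" for i j
  proof -
    have sq: "(x i)\<^sup>2 \<le> (\<Sum>i\<in>S. (x i)\<^sup>2)" "(x j)\<^sup>2 \<le> (\<Sum>i\<in>S. (x i)\<^sup>2)"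
      using assms that by (auto intro: member_le_sum)
    have "2 * \<bar>x i\<bar> * \<bar>x j\<bar> \<le> \<bar>x i\<bar>\<^sup>2 + \<bar>x j\<bar>\<^sup>2" by (rule sum_squares_bound)
    then have "\<bar>x i * x j\<bar> \<le> (\<Sum>i\<in>S. (x i)\<^sup>2)" using sq by (simp add: abs_mult)
    then have "2 * \<bar>a i j\<bar> * \<bar>x i * x j\<bar> \<le> 2 * \<bar>a i j\<bar> * (\<Sum>i\<in>S. (x i)\<^sup>2)" by (intro mult_left_mono) auto
    moreover have "2 * x i * (a i j * x j) \<le> 2 * \<bar>a i j\<bar> * \<bar>x i * x j\<bar>"
      using abs_ge_self[of "2 * x i * (a i j * x j)"] by (simp add: abs_mult ac_simps)
    ultimately show ?thesis by linarith
  qed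
  then have "(\<Sum>i\<in>S. \<Sum>j\<in>S. 2 * x i * (a i j * x j)) \<le> (\<Sum>i\<in>S. \<Sum>j\<in>S. 2 * \<bar>a i j\<bar> * (\<Sum>i\<in>S. (x i)\<^sup>2))"
    by (intro sum_mono)
  moreover have "(\<Sum>i\<in>S. 2 * x i * (\<Sum>j\<in>S. a i j * x j)) = (\<Sum>i\<in>S. \<Sum>j\<in>S. 2 * x i * (a i j * x j))"
    by (simp only: sum_distrib_left)
  moreover have "(\<Sum>i\<in>S. \<Sum>j\<in>S. 2 * \<bar>a i j\<bar>) * (\<Sum>i\<in>S. (x i)\<^sup>2) = (\<Sum>i\<in>S. \<Sum>j\<in>S. 2 * \<bar>a i j\<bar> * (\<Sum>i\<in>S. (x i)\<^sup>2))"
    by (simp only: sum_distrib_right)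
  ultimately show ?thesis by simp
qed

text \<open>
  Otherwise the states in S follow an autonomous linear system, and by Gronwall's inequality they
  stay at 0.
\<close>

lemma struct_controllable_closed_set:
  assumes sc: "struct_controllable A B" and A: "A \<in> carrier_mat d d" and B: "B \<in> carrier_mat d m"
    and S: "S \<subseteq> {..<d}" "S \<noteq> {}"
    and closed: "\<And>i j. i \<in> S \<Longrightarrow> (j, i) \<in> arcs_of A \<Longrightarrow> j \<in> S"
  shows "\<exists>i\<in>S. \<exists>k<m. B $$ (i, k) \<noteq> Zero"
proof (rule ccontr)
  assume no: "\<not> ?thesis"
  obtain A' B' where A': "realization A A'" and B': "realization B B'" and con: "controllable A' B'"
    using sc unfolding struct_controllable_def by blast
  have A'c: "A' \<in> carrier_mat d d" and B'c: "B' \<in> carrier_mat d m"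
    using A' B' A B unfolding realization_def by auto
  have fin: "finite S" using S finite_subset by blast
  obtain T u x where T: "T > 0" and u: "\<And>t. u t \<in> carrier_vec m" and x: "\<And>t. x t \<in> carrier_vec d"
    and dx: "\<And>t i. t \<in> {0..T} \<Longrightarrow> i < d \<Longrightarrow>
      ((\<lambda>s. x s $ i) has_real_derivative (A' *\<^sub>v x t + B' *\<^sub>v u t) $ i) (at t within {0..T})"
    and ends: "x 0 = 0\<^sub>v d" "x T = vec d (\<lambda>_. 1)"
    by (rule controllable_trajectory[OF con A'c B'c zero_carrier_vec vec_carrier]) (rule that)
  \<comment> \<open>All predecessors of \<open>S\<close> lie in \<open>S\<close> and its rows
    contain no input entry, so the equations for \<open>S\<close> are self-contained.\<close>
  have rhs: "(A' *\<^sub>v x t + B' *\<^sub>v u t) $ i = (\<Sum>j\<in>S. A' $$ (i, j) * x t $ j)" if i: "i \<in> S" for i t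
  proof -
    have "i < d" using i S by blast
    have "A' $$ (i, j) = 0" if "j < d" "j \<notin> S" for j
    proof -
      have "(j, i) \<notin> arcs_of A" using closed[OF i] that by blast
      then have "(i, j) \<in> zeros A" using A that \<open>i < d\<close> by (auto simp: in_arcs_of zeros_def)
      then show ?thesis using A' unfolding realization_def by blast
    qed
    then have "(\<Sum>j<d. A' $$ (i, j) * x t $ j) = (\<Sum>j\<in>S. A' $$ (i, j) * x t $ j)"
      using S by (intro sum.mono_neutral_right) auto
    moreover have "B' $$ (i, k) = 0" if "k < m" for k
    proof -
      have "(i, k) \<in> zeros B" using no i that B \<open>i < d\<close> by (auto simp: zeros_def)
      then show ?thesis using B' unfolding realization_def by blast
    qed
    ultimately show ?thesis using \<open>i < d\<close> A'c B'c x[of t] u[of t]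
      by (simp add: scalar_prod_def lessThan_atLeast0)
  qed
  define K where "K = (\<Sum>i\<in>S. \<Sum>j\<in>S. 2 * \<bar>A' $$ (i, j)\<bar>)"
  define E where "E t = (\<Sum>i\<in>S. (x t $ i)\<^sup>2)" for t
  define E' where "E' t = (\<Sum>i\<in>S. 2 * x t $ i * (\<Sum>j\<in>S. A' $$ (i, j) * x t $ j))" for t
  have dE: "(E has_real_derivative E' t) (at t within {0..T})" if t: "t \<in> {0..T}" for t
  proof -
    have "((\<lambda>s. x s $ i) has_real_derivative (\<Sum>j\<in>S. A' $$ (i, j) * x t $ j)) (at t within {0..T})" if "i \<in> S" for i
      using dx[OF t, of i] rhs[OF that] that S A'c by auto
    then show ?thesis unfolding E_def[abs_def] E'_def
      by (auto intro!: derivative_eq_intros sum.cong simp: numeral_2_eq_2)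
  qed
  have E'_le: "E' t \<le> K * E t" for t
    unfolding E_def E'_def K_def using quadratic_form_bound[OF fin] .
  \<comment> \<open>The integrating factor turns \<open>E' \<le> K * E\<close> into monotonicity:
    \<open>F\<close> starts at 0 and cannot become positive.\<close>
  define F where "F t = exp (- K * t) * E t" for t
  have dF: "(F has_real_derivative exp (- K * t) * (E' t - K * E t)) (at t within {0..T})" if "t \<in> {0..T}" for t
    unfolding F_def[abs_def] by (rule derivative_eq_intros dE[OF that] refl | simp add: algebra_simps)+
  have "F T \<le> F 0"
  proof (rule DERIV_nonpos_imp_decreasing_open[of 0 T F])
    show "continuous_on {0..T} F" using dF by (rule DERIV_continuous_on)
    fix t assume t: "0 < t" "t < T"
    then have "(F has_real_derivative exp (- K * t) * (E' t - K * E t)) (at t)"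
      using dF[of t] by (simp add: at_within_Icc_at)
    then show "\<exists>y. (F has_real_derivative y) (at t) \<and> y \<le> 0"
      using E'_le[of t] by (intro exI conjI) (auto intro!: mult_nonneg_nonpos)
  qed (use T in simp)
  moreover have "F 0 = 0" using ends(1) S by (auto simp: F_def E_def intro!: sum.neutral)
  moreover have "E T = card S" using ends(2) S by (simp add: E_def subset_iff)
  then have "F T > 0" using fin S(2) by (simp add: F_def card_gt_0_iff)
  ultimately show False by simp
qed


section \<open>Running time\<close>

lemma result_bind [simp]: "result (bind_timed p f) = result (f (result p))"
  by (simp add: bind_timed_def)

lemma steps_bind: "steps (bind_timed p f) = steps p + steps (f (result p))"
  by (simp add: bind_timed_def)

lemma result_op [simp]: "result (op x) = x"
  by (simp add: op_def)

lemma result_return [simp]: "result (return x) = x"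
  by (simp add: return_def)

lemma result_new_array [simp]: "result (new_array n x) = (\<lambda>_. x)"
  by (simp add: new_array_def)

lemma result_output [simp]: "result (output_alg d m X) = mat d m X"
  by (simp add: output_alg_def)

lemma loop_invariant:
  assumes "I 0 s" "\<And>k s. k < n \<Longrightarrow> I k s \<Longrightarrow> I (Suc k) (result (f k s))"
  shows "I n (result (loop n f s))"
  using assms by (induction n) simp_all

lemma result_repeat_Suc:
  "result (repeat (Suc n) f s) =
     (if fst (result (f s)) then snd (result (f s)) else result (repeat n f (snd (result (f s)))))"
  by (simp split: prod.split)

text \<open>All bounds have the shape \<open>c * N ^ k\<close>. Constants add at equal exponents,
  primitive commands fit every exponent, and a loop raises the exponent by one, so the rules compute
  the constant from the program text.\<close>

lemma time_bind:
  assumes "steps p \<le> a * N ^ k" "\<And>x. steps (f x) \<le> b * N ^ k"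
  shows "steps (bind_timed p f) \<le> (a + b) * N ^ k"
  using add_mono[OF assms(1) assms(2)[of "result p"]] by (simp add: steps_bind add_mult_distrib)

lemma time_op: "1 \<le> N \<Longrightarrow> steps (op x) \<le> 1 * N ^ k"
  by (simp add: op_def)

lemma time_return: "steps (return x) \<le> 0 * N ^ k"
  by (simp add: return_def)

lemma time_loop:
  assumes "1 \<le> N" "n \<le> N" "\<And>i s. steps (f i s) \<le> c * N ^ k"
  shows "steps (loop n f s) \<le> (c + 1) * N ^ Suc k"
proof -
  have "steps (loop n f s) \<le> n * ((c + 1) * N ^ k)"
  proof (induction n)
    case (Suc n)
    have "1 \<le> N ^ k" using assms(1) by simp
    then show ?case
      using Suc assms(3)[of n "result (loop n f s)"] by (simp add: steps_bind op_def)
  qed (simp add: return_def)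
  also have "\<dots> \<le> N * ((c + 1) * N ^ k)" using assms(2) by (rule mult_right_mono) simp
  finally show ?thesis by (simp add: algebra_simps)
qed

lemma time_repeat:
  assumes "1 \<le> N" "n \<le> N" "\<And>s. steps (f s) \<le> c * N ^ k"
  shows "steps (repeat n f s) \<le> (c + 1) * N ^ Suc k"
proof -
  have "steps (repeat n f s) \<le> n * ((c + 1) * N ^ k)"
  proof (induction n arbitrary: s)
    case (Suc n)
    have "1 \<le> N ^ k" using assms(1) by simp
    moreover have "steps (repeat n f (snd (result (f s)))) \<le> n * ((c + 1) * N ^ k)" by (rule Suc)
    ultimately show ?case
      using assms(3)[of s] by (cases "result (f s)") (auto simp: steps_bind op_def return_def algebra_simps)
  qed (simp add: return_def)
  also have "\<dots> \<le> N * ((c + 1) * N ^ k)" using assms(2) by (rule mult_right_mono) simp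
  finally show ?thesis by (simp add: algebra_simps)
qed

lemma time_if:
  assumes "steps p \<le> a * N ^ k" "steps q \<le> b * N ^ k"
  shows "steps (if P then p else q) \<le> (a + b) * N ^ k"
  using assms by (simp add: add_mult_distrib)

lemma time_case_prod:
  assumes "\<And>a b. steps (f a b) \<le> c * N ^ k"
  shows "steps (case x of (a, b) \<Rightarrow> f a b) \<le> c * N ^ k"
  using assms by (simp split: prod.split)

text \<open>Nested patterns such as \<open>((u, v), slack)\<close> unfold to a case distinction that
  yields a function, which is then applied.\<close>

lemma time_case_prod_fun:
  assumes "\<And>a b. steps (f a b y) \<le> c * N ^ k"
  shows "steps ((case x of (a, b) \<Rightarrow> f a b) y) \<le> c * N ^ k"
  using assms by (simp split: prod.split)

lemma time_case_option:
  assumes "steps p \<le> a * N ^ k" "\<And>x. steps (f x) \<le> b * N ^ k"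
  shows "steps (case y of None \<Rightarrow> p | Some x \<Rightarrow> f x) \<le> (a + b) * N ^ k"
  using assms by (cases y) (simp_all add: add_mult_distrib trans_le_add1 trans_le_add2)

lemma time_new_array1:
  assumes "1 \<le> N" "n \<le> N"
  shows "steps (new_array n x) \<le> 1 * N ^ Suc k"
  using mult_le_mono[OF assms(2), of 1 "N ^ k"] assms(1) by (simp add: new_array_def)

lemma time_new_array2:
  assumes "1 \<le> N" "n \<le> N" "n' \<le> N"
  shows "steps (new_array (n * n') x) \<le> 1 * N ^ Suc (Suc k)"
  using mult_le_mono[OF mult_le_mono[OF assms(2,3)], of 1 "N ^ k"] assms(1)
  by (simp add: new_array_def mult.assoc)

lemma time_output:
  assumes "1 \<le> N" "d \<le> N" "m \<le> N"
  shows "steps (output_alg d m X) \<le> 1 * N ^ Suc (Suc k)"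
  using mult_le_mono[OF mult_le_mono[OF assms(2,3)], of 1 "N ^ k"] assms(1)
  by (simp add: output_alg_def mult.assoc)

text \<open>Applied first, it leaves \<open>c\<close> open for the structural rules to instantiate;
  the computed sum is compared with \<open>c'\<close> at the end. The numerals stated below are
  generous round values.\<close>

lemma time_weaken:
  assumes "steps p \<le> c * N ^ k" "c \<le> c'"
  shows "steps p \<le> c' * N ^ k"
  using assms by (meson le_trans mult_le_mono1)

lemmas time_rules = time_bind time_op time_return time_loop time_repeat time_if time_case_prod time_case_prod_fun
  time_case_option time_new_array1 time_new_array2 time_output

context
  fixes N d m :: nat
  assumes N: "1 \<le> N" and d: "d \<le> N" and m: "m \<le> N"
begin

lemma time_reach: "steps (reach_alg d A) \<le> 30 * N ^ Suc (Suc (Suc k))"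
  unfolding reach_alg_def
  by (rule time_weaken, (rule time_rules N d m)+, simp)

lemma time_heads: "steps (heads_alg d R) \<le> 30 * N ^ Suc (Suc k)"
  unfolding heads_alg_def
  by (rule time_weaken, (rule time_rules N d m)+, simp)

lemma time_same_scc: "steps (same_scc_alg R i j) \<le> 3 * N ^ k"
  unfolding same_scc_alg_def
  by (rule time_weaken, (rule time_rules N d m)+, simp)

lemma time_max_cost: "steps (max_cost_alg d m B w) \<le> 30 * N ^ Suc (Suc k)"
  unfolding max_cost_alg_def
  by (rule time_weaken, (rule time_rules N d m)+, simp)

lemma time_cost_array: "steps (cost_array_alg d m B w x) \<le> 30 * N ^ Suc (Suc k)"
  unfolding cost_array_alg_def
  by (rule time_weaken, (rule time_rules N d m)+, simp)

lemma time_cheapest_input: "steps (cheapest_input_alg m W i) \<le> 30 * N ^ Suc k"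
  unfolding cheapest_input_alg_def
  by (rule time_weaken, (rule time_rules N d m)+, simp)

lemma time_selection: "steps (sscc_selection_alg d m R hds B w) \<le> 200 * N ^ Suc (Suc (Suc k))"
  unfolding sscc_selection_alg_def
  by (rule time_weaken, (rule time_max_cost time_cost_array time_cheapest_input time_same_scc time_rules N d m)+, simp)

lemma time_least_slack: "n \<le> N \<Longrightarrow> steps (least_slack_alg n used slack) \<le> 30 * N ^ Suc k"
  unfolding least_slack_alg_def
  by (rule time_weaken, (rule time_rules N d m | assumption)+, simp)

lemma time_shift: "n \<le> N \<Longrightarrow> steps (shift_alg n p used delta i uv slack) \<le> 30 * N ^ Suc k"
  unfolding shift_alg_def
  by (rule time_weaken, (rule time_rules N d m | assumption)+, simp)

lemma time_relax: "n \<le> N \<Longrightarrow> steps (relax_alg n c uv used r from sw) \<le> 30 * N ^ Suc k"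
  unfolding relax_alg_def
  by (rule time_weaken, (rule time_rules N d m | assumption)+, simp)

text \<open>Maintaining the slacks keeps a round linear in the number of columns, which is what
  makes the whole algorithm cubic.\<close>

lemma time_search_round: "n \<le> N \<Longrightarrow> steps (search_round_alg n c p i st) \<le> 100 * N ^ Suc k"
  unfolding search_round_alg_def
  by (rule time_weaken, (rule time_least_slack time_shift time_relax time_rules N d m | assumption)+, simp)

lemma time_augment: "n \<le> N \<Longrightarrow> steps (augment_alg n way i j p) \<le> 30 * N ^ Suc k"
  unfolding augment_alg_def
  by (rule time_weaken, (rule time_rules N d m | assumption)+, simp)

lemma time_assign_row: "n \<le> N \<Longrightarrow> steps (assign_row_alg n c i st) \<le> 200 * N ^ Suc (Suc k)"
  unfolding assign_row_alg_def
  by (rule time_weaken, (rule time_search_round time_augment time_rules N d m | assumption)+, simp)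

lemma time_hungarian: "n \<le> N \<Longrightarrow> steps (hungarian_alg d n c) \<le> 300 * N ^ Suc (Suc (Suc k))"
  unfolding hungarian_alg_def
  by (rule time_weaken, (rule time_assign_row time_rules N d m | assumption)+, simp)

lemma time_assignment_costs:
  "d + m \<le> N \<Longrightarrow> steps (assignment_costs_alg d m A B w) \<le> 200 * N ^ Suc (Suc k)"
  unfolding assignment_costs_alg_def
  by (rule time_weaken, (rule time_max_cost time_rules N d m | assumption)+, simp)

lemma time_clear_hit: "steps (clear_hit_alg d m R hds Bt X) \<le> 100 * N ^ Suc (Suc (Suc k))"
  unfolding clear_hit_alg_def
  by (rule time_weaken, (rule time_same_scc time_rules N d m)+, simp)

lemma time_join: "steps (join_alg d m Bt X) \<le> 30 * N ^ Suc (Suc k)"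
  unfolding join_alg_def
  by (rule time_weaken, (rule time_rules N d m)+, simp)

end

text \<open>For a bound on the continuation that holds only at the value actually computed, here the
  number of columns \<open>d + m\<close>.\<close>

lemma time_bind_value:
  assumes "steps p \<le> a * N ^ k" "steps (f (result p)) \<le> b * N ^ k"
  shows "steps (bind_timed p f) \<le> (a + b) * N ^ k"
  using add_mono[OF assms] by (simp add: steps_bind add_mult_distrib)

lemma time_matching:
  assumes "1 \<le> d"
  shows "steps (matching_alg d m A B w) \<le> 600 * (d + m) ^ Suc (Suc (Suc k))"
proof -
  have N: "1 \<le> d + m" "d \<le> d + m" "m \<le> d + m" "d + m \<le> d + m" using assms by auto
  have h: "steps (hungarian_alg d (result (op (d + m))) c) \<le> 300 * (d + m) ^ Suc (Suc (Suc k))" for c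
    using time_hungarian[OF N] by simp
  show ?thesis
    unfolding matching_alg_def
    by (rule time_weaken, rule time_bind, rule time_assignment_costs[OF N], rule time_bind_value,
        rule time_op[OF N(1)], rule time_bind, rule h, (rule time_rules N)+, simp)
qed

text \<open>\<open>1 \<le> d\<close> keeps \<open>d + m\<close> positive: without states and inputs
  a few fixed charges remain while the right-hand side is 0.\<close>

lemma time_combined:
  assumes "1 \<le> d"
  shows "steps (combined_alg d m A B w) \<le> 1500 * (d + m) ^ 3"
proof -
  have N: "1 \<le> d + m" "d \<le> d + m" "m \<le> d + m" using assms by auto
  have "steps (combined_alg d m A B w) \<le> 1500 * (d + m) ^ Suc (Suc (Suc 0))"
    unfolding combined_alg_def
    by (rule time_weaken, (rule time_reach[OF N] time_heads[OF N] time_selection[OF N] time_matching[OF assms]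
        time_clear_hit[OF N] time_join[OF N] time_rules N)+, simp)
  then show ?thesis by (simp add: numeral_3_eq_3)
qed


section \<open>The Hungarian algorithm\<close>

lemma result_least_slack:
  "case result (least_slack_alg N used slack) of
     None \<Rightarrow> \<forall>j<N. used j
   | Some j \<Rightarrow> j < N \<and> \<not> used j \<and> (\<forall>j'<N. \<not> used j' \<longrightarrow> slack j \<le> slack j')"
  unfolding least_slack_alg_def
  by (rule loop_invariant[where I = "\<lambda>k best. case best of
     None \<Rightarrow> \<forall>j<k. used j
   | Some j \<Rightarrow> j < k \<and> \<not> used j \<and> (\<forall>j'<k. \<not> used j' \<longrightarrow> slack j \<le> slack j')"])
    (auto simp: less_Suc_eq split: option.splits if_splits)

text \<open>The potentials are updated in place. Since tree columns hold pairwise distinct rows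
  different from \<open>i\<close>, each tree row is raised exactly once.\<close>

lemma result_shift:
  assumes inj: "\<And>j j'. j < N \<Longrightarrow> j' < N \<Longrightarrow> used j \<Longrightarrow> used j' \<Longrightarrow> p j = p j' \<Longrightarrow> j = j'"
    and assigned: "\<And>j. j < N \<Longrightarrow> used j \<Longrightarrow> p j \<noteq> None \<and> p j \<noteq> Some i"
  shows "result (shift_alg N p used delta i (u, v) slack) =
    (((\<lambda>r. if r = i \<or> (\<exists>j<N. used j \<and> p j = Some r) then u r + delta else u r),
      (\<lambda>j. if j < N \<and> used j then v j - delta else v j)),
     (\<lambda>j. if j < N \<and> \<not> used j then slack j - delta else slack j))"
proof -
  let ?st = "\<lambda>k. (((\<lambda>r. if r = i \<or> (\<exists>j<k. used j \<and> p j = Some r) then u r + delta else u r),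
      (\<lambda>j. if j < k \<and> used j then v j - delta else v j)),
     (\<lambda>j. if j < k \<and> \<not> used j then slack j - delta else slack j))"
  have "result (shift_alg N p used delta i (u, v) slack) = ?st N \<and> N \<le> N"
    unfolding shift_alg_def prod.case result_bind result_op
  proof (rule loop_invariant[where I = "\<lambda>k st. st = ?st k \<and> k \<le> N"], goal_cases)
    case 1
    show ?case by (auto simp: fun_eq_iff)
  next
    case (2 k st)
    then have k: "k < N" and st: "st = ?st k" by blast+
    show ?case
    proof (cases "used k")
      case True
      then obtain r where r: "p k = Some r" "r \<noteq> i" using assigned k by blast
      have "\<not> (\<exists>j<k. used j \<and> p j = Some r)" using inj[of _ k] r(1) k True by (metis less_imp_neq less_trans)
      then show ?thesis using True r k by (auto simp: st fun_eq_iff less_Suc_eq)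
    next
      case False
      then show ?thesis using k by (auto simp: st fun_eq_iff less_Suc_eq)
    qed
  qed
  then show ?thesis by blast
qed

lemma result_relax:
  "result (relax_alg N c (u, v) used r from (slack, way)) =
    ((\<lambda>j. if j < N \<and> \<not> used j \<and> c (r, j) - u r - v j < slack j then c (r, j) - u r - v j else slack j),
     (\<lambda>j. if j < N \<and> \<not> used j \<and> c (r, j) - u r - v j < slack j then from else way j))"
  unfolding relax_alg_def prod.case result_bind result_op
  by (rule loop_invariant[where I = "\<lambda>k st. st =
    ((\<lambda>j. if j < k \<and> \<not> used j \<and> c (r, j) - u r - v j < slack j then c (r, j) - u r - v j else slack j),
     (\<lambda>j. if j < k \<and> \<not> used j \<and> c (r, j) - u r - v j < slack j then from else way j))"])
    (auto simp: fun_eq_iff less_Suc_eq)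

section \<open>Primal-dual invariants of the assignment problem\<close>

definition reduced :: "(nat \<times> nat \<Rightarrow> real) \<Rightarrow> potentials \<Rightarrow> nat \<Rightarrow> nat \<Rightarrow> real" where
  "reduced c uv r j = c (r, j) - fst uv r - snd uv j"

text \<open>Dual feasibility and complementary slackness for the first \<open>k\<close> rows.
  Columns may stay uncovered, so their potentials are multipliers of inequalities: never positive,
  and 0 on unassigned columns.\<close>

definition optimal_partial ::
  "nat \<Rightarrow> nat \<Rightarrow> (nat \<times> nat \<Rightarrow> real) \<Rightarrow> nat \<Rightarrow> potentials \<Rightarrow> (nat \<Rightarrow> nat option) \<Rightarrow> bool" where
  "optimal_partial n N c k uv p \<longleftrightarrow>
    (\<forall>r<n. \<forall>j<N. 0 \<le> reduced c uv r j) \<and>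
    (\<forall>j<N. \<forall>r. p j = Some r \<longrightarrow> r < k \<and> reduced c uv r j = 0) \<and>
    (\<forall>j<N. \<forall>j'<N. p j = p j' \<longrightarrow> p j \<noteq> None \<longrightarrow> j = j') \<and>
    (\<forall>r<k. \<exists>j<N. p j = Some r) \<and>
    (\<forall>j<N. snd uv j \<le> 0 \<and> (p j = None \<longrightarrow> snd uv j = 0))"

lemma optimal_partialD:
  assumes "optimal_partial n N c k uv p"
  shows "\<And>r j. r < n \<Longrightarrow> j < N \<Longrightarrow> 0 \<le> reduced c uv r j"
    "\<And>j r. j < N \<Longrightarrow> p j = Some r \<Longrightarrow> r < k \<and> reduced c uv r j = 0"
    "\<And>j j' r. j < N \<Longrightarrow> j' < N \<Longrightarrow> p j = Some r \<Longrightarrow> p j' = Some r \<Longrightarrow> j = j'"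
    "\<And>r. r < k \<Longrightarrow> \<exists>j<N. p j = Some r"
    "\<And>j. j < N \<Longrightarrow> snd uv j \<le> 0"
    "\<And>j. j < N \<Longrightarrow> p j = None \<Longrightarrow> snd uv j = 0"
  using assms unfolding optimal_partial_def by (blast, blast, fastforce, blast, blast, blast)

definition row_of :: "(nat \<Rightarrow> nat option) \<Rightarrow> nat \<Rightarrow> nat option \<Rightarrow> nat" where
  "row_of p i w = (case w of None \<Rightarrow> i | Some j \<Rightarrow> the (p j))"

definition tree_row :: "nat \<Rightarrow> (nat \<Rightarrow> nat option) \<Rightarrow> nat \<Rightarrow> (nat \<Rightarrow> bool) \<Rightarrow> nat \<Rightarrow> bool" where
  "tree_row N p i used r \<longleftrightarrow> r = i \<or> (\<exists>j<N. used j \<and> p j = Some r)"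

text \<open>The rank h decreases along way, so the augmenting path ends at the root.\<close>

definition tree ::
  "nat \<Rightarrow> (nat \<times> nat \<Rightarrow> real) \<Rightarrow> (nat \<Rightarrow> nat option) \<Rightarrow> nat \<Rightarrow> potentials \<Rightarrow> (nat \<Rightarrow> bool) \<Rightarrow>
   (nat \<Rightarrow> nat option) \<Rightarrow> (nat \<Rightarrow> nat) \<Rightarrow> nat \<Rightarrow> bool" where
  "tree N c p i uv used way h t \<longleftrightarrow>
    (\<forall>j<N. used j \<longrightarrow> h j < t \<and> reduced c uv (row_of p i (way j)) j = 0 \<and>
      (\<forall>j'. way j = Some j' \<longrightarrow> j' < N \<and> used j' \<and> p j' \<noteq> None \<and> h j' < h j))"

lemma tree_mono: "tree N c p i uv used way h t \<Longrightarrow> t \<le> t' \<Longrightarrow> tree N c p i uv used way h t'"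
  unfolding tree_def by (meson less_le_trans)

lemma tree_cong:
  assumes "tree N c p i uv used way h t" "\<And>j. j < N \<Longrightarrow> used j \<Longrightarrow> way' j = way j"
  shows "tree N c p i uv used way' h t"
  unfolding tree_def
proof (intro allI impI)
  fix j assume j: "j < N" "used j"
  show "h j < t \<and> reduced c uv (row_of p i (way' j)) j = 0 \<and>
      (\<forall>j'. way' j = Some j' \<longrightarrow> j' < N \<and> used j' \<and> p j' \<noteq> None \<and> h j' < h j)"
    unfolding assms(2)[OF j] using assms(1) j unfolding tree_def by blast
qed

text \<open>\<open>t\<close> is the size of the tree and the rank of the column inserted next.
  Outside the tree, the equation says that the slack is attained at \<open>way\<close>, and the
  inequality that it is the minimum over the tree rows.\<close>

definition search_inv ::
  "nat \<Rightarrow> nat \<Rightarrow> (nat \<times> nat \<Rightarrow> real) \<Rightarrow> (nat \<Rightarrow> nat option) \<Rightarrow> nat \<Rightarrow> search_state \<Rightarrow> nat \<Rightarrow> bool" where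
  "search_inv n N c p i st t \<longleftrightarrow> (case st of (uv, used, slack, way, fin) \<Rightarrow>
    optimal_partial n N c i uv p \<and> (\<forall>j<N. used j \<longrightarrow> p j \<noteq> None) \<and>
    card {j. j < N \<and> used j} = t \<and> (\<exists>h. tree N c p i uv used way h t) \<and>
    (\<forall>j<N. \<not> used j \<longrightarrow> slack j = reduced c uv (row_of p i (way j)) j \<and>
      (\<forall>j'. way j = Some j' \<longrightarrow> j' < N \<and> used j') \<and>
      (\<forall>r. tree_row N p i used r \<longrightarrow> slack j \<le> reduced c uv r j)))"

definition search_done ::
  "nat \<Rightarrow> nat \<Rightarrow> (nat \<times> nat \<Rightarrow> real) \<Rightarrow> (nat \<Rightarrow> nat option) \<Rightarrow> nat \<Rightarrow> search_state \<Rightarrow> bool" where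
  "search_done n N c p i st \<longleftrightarrow> (case st of (uv, used, slack, way, fin) \<Rightarrow>
    optimal_partial n N c i uv p \<and>
    (\<exists>j h. fin = Some j \<and> j < N \<and> used j \<and> p j = None \<and> tree N c p i uv used way h N))"

text \<open>The tree columns hold distinct rows below \<open>k\<close>. This bounds the number of
  search rounds and guarantees that a column outside the tree exists.\<close>

lemma card_assigned_le:
  assumes "optimal_partial n N c k uv p" "\<forall>j<N. used j \<longrightarrow> p j \<noteq> None"
  shows "card {j. j < N \<and> used j} \<le> k"
proof -
  have "card {j. j < N \<and> used j} = card ((\<lambda>j. the (p j)) ` {j. j < N \<and> used j})"
    using assms(2) optimal_partialD(3)[OF assms(1)]
    by (intro card_image[symmetric] inj_onI) (metis (mono_tags, lifting) mem_Collect_eq option.collapse)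
  also have "\<dots> \<le> card {..<k}"
    using assms(2) optimal_partialD(2)[OF assms(1)] by (intro card_mono) auto
  finally show ?thesis by simp
qed

text \<open>Shifting by the least slack \<open>\<delta>\<close> preserves the reduced costs within
  the tree and outside it, raises those of outer rows in tree columns, and lowers those of tree rows
  in outer columns, which were at least \<open>\<delta>\<close>. The column of least slack becomes
  tight.\<close>

lemma search_round:
  assumes inv: "search_inv n N c p i st t" and i: "i < n" "n \<le> N"
  defines "out \<equiv> result (search_round_alg N c p i st)"
  shows "if fst out then search_done n N c p i (snd out) else search_inv n N c p i (snd out) (Suc t)"
proof -
  obtain u v used slack way fin where st: "st = ((u, v), used, slack, way, fin)" by (metis prod.exhaust)
  note inv' = inv[unfolded search_inv_def st prod.case]
  have opt: "optimal_partial n N c i (u, v) p" using inv' by (elim conjE)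
  have used_p: "\<forall>j<N. used j \<longrightarrow> p j \<noteq> None" using inv' by (elim conjE)
  have card: "card {j. j < N \<and> used j} = t" using inv' by (elim conjE)
  obtain h where h: "tree N c p i (u, v) used way h t" using inv' by (elim conjE exE)
  have h1: "\<And>j. j < N \<Longrightarrow> used j \<Longrightarrow> h j < t"
    and h2: "\<And>j. j < N \<Longrightarrow> used j \<Longrightarrow> reduced c (u, v) (row_of p i (way j)) j = 0"
    using h unfolding tree_def by blast+
  have "\<forall>j<N. \<not> used j \<longrightarrow> slack j = reduced c (u, v) (row_of p i (way j)) j \<and>
      (\<forall>j'. way j = Some j' \<longrightarrow> j' < N \<and> used j') \<and>
      (\<forall>r. tree_row N p i used r \<longrightarrow> slack j \<le> reduced c (u, v) r j)"
    using inv' by (elim conjE)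
  then have slack: "\<And>j. j < N \<Longrightarrow> \<not> used j \<Longrightarrow> slack j = reduced c (u, v) (row_of p i (way j)) j"
      "\<And>j j'. j < N \<Longrightarrow> \<not> used j \<Longrightarrow> way j = Some j' \<Longrightarrow> j' < N \<and> used j'"
      "\<And>j r. j < N \<Longrightarrow> \<not> used j \<Longrightarrow> tree_row N p i used r \<Longrightarrow> slack j \<le> reduced c (u, v) r j"
    by blast+
  have t: "t \<le> i" using card_assigned_le[OF opt used_p] card by simp
  have tree_lt: "r < n" if "tree_row N p i used r" for r
    using that i optimal_partialD(2)[OF opt] by (auto simp: tree_row_def dest: less_trans)
  have row_tree: "tree_row N p i used (row_of p i (way j))" if "j < N" for j
  proof (cases "way j")
    case None
    then show ?thesis by (simp add: row_of_def tree_row_def)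
  next
    case (Some j')
    have "j' < N \<and> used j' \<and> p j' \<noteq> None"
    proof (cases "used j")
      case True
      then show ?thesis using h that Some unfolding tree_def by blast
    next
      case False
      then show ?thesis using slack(2)[OF that _ Some] used_p by blast
    qed
    then show ?thesis using Some by (auto simp: row_of_def tree_row_def)
  qed
  \<comment> \<open>The tree has \<open>t \<le> i\<close> columns, and \<open>i < N\<close>.\<close>
  have "\<exists>j<N. \<not> used j"
  proof (rule ccontr)
    assume "\<not> ?thesis"
    then have "{j. j < N \<and> used j} = {..<N}" by auto
    then show False using card t i by simp
  qed
  with result_least_slack[of N used slack] obtain j where best: "result (least_slack_alg N used slack) = Some j"
    and j: "j < N" "\<not> used j" and min: "\<And>j'. j' < N \<Longrightarrow> \<not> used j' \<Longrightarrow> slack j \<le> slack j'"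
    by (auto split: option.splits)
  define \<delta> where "\<delta> = slack j"
  have \<delta>: "0 \<le> \<delta>"
    using slack(1)[OF j] optimal_partialD(1)[OF opt tree_lt[OF row_tree[OF j(1)]] j(1)] by (simp add: \<delta>_def)
  define u' where "u' = (\<lambda>r. if tree_row N p i used r then u r + \<delta> else u r)"
  define v' where "v' = (\<lambda>j. if j < N \<and> used j then v j - \<delta> else v j)"
  define slack' where "slack' = (\<lambda>j. if j < N \<and> \<not> used j then slack j - \<delta> else slack j)"
  have shift: "result (shift_alg N p used \<delta> i (u, v) slack) = ((u', v'), slack')"
    unfolding u'_def v'_def slack'_def tree_row_def
  proof (rule result_shift)
    show "j = j'" if "j < N" "j' < N" "used j" "used j'" "p j = p j'" for j j'
      using that used_p optimal_partialD(3)[OF opt] by (metis option.exhaust)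
    show "p j \<noteq> None \<and> p j \<noteq> Some i" if "j < N" "used j" for j
      using that used_p optimal_partialD(2)[OF opt] by blast
  qed
  have red: "reduced c (u', v') r j' = reduced c (u, v) r j' -
      (if tree_row N p i used r then \<delta> else 0) + (if j' < N \<and> used j' then \<delta> else 0)" for r j'
    by (simp add: reduced_def u'_def v'_def)
  have opt': "optimal_partial n N c i (u', v') p"
    unfolding optimal_partial_def
  proof (intro conjI allI impI)
    fix r j' assume r: "r < n" and j': "j' < N"
    show "0 \<le> reduced c (u', v') r j'"
    proof (cases "tree_row N p i used r \<and> \<not> used j'")
      case True
      then have "slack j \<le> reduced c (u, v) r j'" using min slack(3) j' by (meson order_trans)
      then show ?thesis using True by (simp add: red \<delta>_def)
    next
      case False
      then show ?thesis using optimal_partialD(1)[OF opt r j'] \<delta> j' by (auto simp: red)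
    qed
  next
    fix j' r assume j': "j' < N" and p: "p j' = Some r"
    show "r < i" using optimal_partialD(2)[OF opt j' p] by blast
    then have "r \<noteq> i" by simp
    have "l = j'" if "l < N" "p l = Some r" for l
      using optimal_partialD(3)[OF opt that(1) j' that(2) p] .
    then have "tree_row N p i used r \<longleftrightarrow> used j'"
      unfolding tree_row_def using \<open>r \<noteq> i\<close> j' p by blast
    then show "reduced c (u', v') r j' = 0" using optimal_partialD(2)[OF opt j' p] j' by (simp add: red)
  next
    fix j' assume "j' < N"
    then show "snd (u', v') j' \<le> 0" using optimal_partialD(5)[OF opt, of j'] \<delta> by (simp add: v'_def)
    assume "p j' = None"
    then show "snd (u', v') j' = 0"
      using optimal_partialD(6)[OF opt, of j'] used_p \<open>j' < N\<close> by (auto simp: v'_def)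
  next
    fix l l' assume "l < N" "l' < N" "p l = p l'" "p l \<noteq> None"
    then show "l = l'" using optimal_partialD(3)[OF opt, of l l'] by auto
  next
    fix r assume "r < i"
    then show "\<exists>j<N. p j = Some r" using optimal_partialD(4)[OF opt] by blast
  qed
  define used' where "used' = used(j := True)"
  \<comment> \<open>The rank is the time of insertion, so parent columns have smaller rank.\<close>
  define h' where "h' = h(j := t)"
  have card': "card {j. j < N \<and> used' j} = Suc t"
  proof -
    have "{j. j < N \<and> used' j} = insert j {j. j < N \<and> used j}" using j by (auto simp: used'_def)
    then show ?thesis using card j by simp
  qed
  have tree': "tree N c p i (u', v') used' way h' (Suc t)"
    unfolding tree_def
  proof (intro allI impI)
    fix j' assume j': "j' < N" "used' j'"
    have other: "j'' < N \<and> used' j'' \<and> p j'' \<noteq> None \<and> h' j'' < h' j'" if w: "way j' = Some j''" for j''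
    proof (cases "j' = j")
      case True
      then have jj: "j'' < N" "used j''" using slack(2)[OF j] w by auto
      then have "h j'' < t" using h unfolding tree_def by blast
      then show ?thesis using jj True j(2) used_p by (auto simp: used'_def h'_def)
    next
      case False
      then have "used j'" using j' by (simp add: used'_def)
      then have "j'' < N \<and> used j'' \<and> p j'' \<noteq> None \<and> h j'' < h j'"
        using h j'(1) w unfolding tree_def by blast
      then show ?thesis using False j(2) by (auto simp: used'_def h'_def)
    qed
    have "h' j' < Suc t"
      using h1[OF j'(1)] j'(2) by (cases "j' = j") (auto simp: h'_def used'_def less_Suc_eq)
    moreover have "reduced c (u', v') (row_of p i (way j')) j' = 0"
    proof (cases "j' = j")
      case True
      then show ?thesis using row_tree[OF j(1)] slack(1)[OF j] j(2) by (simp add: red \<delta>_def)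
    next
      case False
      then have "used j'" using j' by (simp add: used'_def)
      then show ?thesis using h2[OF j'(1)] row_tree[OF j'(1)] j'(1) by (simp add: red)
    qed
    ultimately show "h' j' < Suc t \<and> reduced c (u', v') (row_of p i (way j')) j' = 0 \<and>
        (\<forall>j''. way j' = Some j'' \<longrightarrow> j'' < N \<and> used' j'' \<and> p j'' \<noteq> None \<and> h' j'' < h' j')"
      using other by blast
  qed
  show ?thesis
  proof (cases "p j")
    case None
    have "out = (True, ((u', v'), used', slack', way, Some j))"
      using best shift None by (simp add: out_def st search_round_alg_def used'_def \<delta>_def)
    moreover have "tree N c p i (u', v') used' way h' N"
      by (rule tree_mono[OF tree']) (use t i in simp)
    ultimately show ?thesis using opt' j None by (auto simp: search_done_def used'_def)
  next
    case (Some r)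
    \<comment> \<open>Only the row \<open>r\<close> is new in the tree, so each minimum changes by
      one comparison.\<close>
    define slack'' where "slack'' = (\<lambda>j'. if j' < N \<and> \<not> used' j' \<and> c (r, j') - u' r - v' j' < slack' j' then c (r, j') - u' r - v' j' else slack' j')"
    define way' where "way' = (\<lambda>j'. if j' < N \<and> \<not> used' j' \<and> c (r, j') - u' r - v' j' < slack' j' then Some j else way j')"
    have out: "out = (False, ((u', v'), used', slack'', way', None))"
      using best shift Some result_relax[of N c u' v' used' r "Some j" slack' way]
      by (simp add: out_def st search_round_alg_def used'_def \<delta>_def slack''_def way'_def)
    have "tree N c p i (u', v') used' way' h' (Suc t)"
      by (rule tree_cong[OF tree']) (simp add: way'_def)
    moreover have "\<forall>j<N. used' j \<longrightarrow> p j \<noteq> None" using used_p Some by (simp add: used'_def)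
    moreover have "slack'' j' = reduced c (u', v') (row_of p i (way' j')) j' \<and>
        (\<forall>j''. way' j' = Some j'' \<longrightarrow> j'' < N \<and> used' j'') \<and>
        (\<forall>r. tree_row N p i used' r \<longrightarrow> slack'' j' \<le> reduced c (u', v') r j')"
      if j': "j' < N" "\<not> used' j'" for j'
    proof -
      have un: "\<not> used j'" "j' \<noteq> j" using j' by (auto simp: used'_def split: if_splits)
      have s': "slack' j' = reduced c (u', v') (row_of p i (way j')) j'"
        using slack(1)[OF j'(1) un(1)] row_tree[OF j'(1)] un j' by (simp add: red slack'_def)
      have le': "slack' j' \<le> reduced c (u', v') q j'" if "tree_row N p i used q" for q
        using slack(3)[OF j'(1) un(1) that] that un j' by (simp add: red slack'_def)
      have rj: "c (r, j') - u' r - v' j' = reduced c (u', v') r j'" by (simp add: reduced_def)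
      have rows: "tree_row N p i used' q \<longleftrightarrow> tree_row N p i used q \<or> q = r" for q
        using j Some by (auto simp: tree_row_def used'_def)
      have "slack'' j' = min (reduced c (u', v') r j') (slack' j')"
        using j' by (simp add: slack''_def rj)
      then have "slack'' j' \<le> reduced c (u', v') q j'" if "tree_row N p i used' q" for q
        using that le' unfolding rows by (auto simp: min_le_iff_disj)
      moreover have "slack'' j' = reduced c (u', v') (row_of p i (way' j')) j'"
        using s' j' Some by (simp add: slack''_def way'_def rj row_of_def)
      moreover have "j'' < N \<and> used' j''" if "way' j' = Some j''" for j''
        using that j' j(1) slack(2)[OF j'(1) un(1)] by (auto simp: way'_def used'_def split: if_splits)
      ultimately show ?thesis by blast
    qed
    ultimately have "search_inv n N c p i ((u', v'), used', slack'', way', None) (Suc t)"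
      unfolding search_inv_def using opt' card' by blast
    then show ?thesis using out by simp
  qed
qed

lemma search_inv_le:
  assumes "search_inv n N c p i st t"
  shows "t \<le> i"
proof -
  obtain uv used slack way fin where st: "st = (uv, used, slack, way, fin)" by (metis prod.exhaust)
  note inv = assms[unfolded search_inv_def st prod.case]
  have "optimal_partial n N c i uv p" using inv by (elim conjE)
  moreover have "\<forall>j<N. used j \<longrightarrow> p j \<noteq> None" using inv by (elim conjE)
  moreover have "card {j. j < N \<and> used j} = t" using inv by (elim conjE)
  ultimately show ?thesis using card_assigned_le by blast
qed

text \<open>A round that does not finish increases \<open>t\<close>, which never exceeds
  \<open>i\<close>; so \<open>N\<close> rounds suffice from the empty tree.\<close>

lemma search_repeat:
  assumes "i < n" "n \<le> N" "search_inv n N c p i st t" "i < t + q"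
  shows "search_done n N c p i (result (repeat q (search_round_alg N c p i) st))"
  using assms(3,4)
proof (induction q arbitrary: st t)
  case 0
  then show ?case using search_inv_le[OF 0(1)] by simp
next
  case (Suc q)
  let ?out = "result (search_round_alg N c p i st)"
  have inv: "if fst ?out then search_done n N c p i (snd ?out) else search_inv n N c p i (snd ?out) (Suc t)"
    by (rule search_round[OF Suc.prems(1) assms(1,2)])
  show ?case
  proof (cases "fst ?out")
    case True
    then show ?thesis using inv by (simp only: result_repeat_Suc if_True)
  next
    case False
    then have "search_inv n N c p i (snd ?out) (Suc t)" using inv by (simp only: if_False)
    then have "search_done n N c p i (result (repeat q (search_round_alg N c p i) (snd ?out)))"
      by (rule Suc.IH) (use Suc.prems(2) in simp)
    then show ?thesis using False by (simp only: result_repeat_Suc if_False)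
  qed
qed

text \<open>
  The state p' while the path is flipped: column j is about to be reassigned, the other columns
  cover the rows below i, and columns closer to the root still have their old assignment p.
\<close>

definition open_path ::
  "nat \<Rightarrow> (nat \<times> nat \<Rightarrow> real) \<Rightarrow> (nat \<Rightarrow> nat option) \<Rightarrow> nat \<Rightarrow> potentials \<Rightarrow> (nat \<Rightarrow> bool) \<Rightarrow>
   (nat \<Rightarrow> nat) \<Rightarrow> (nat \<Rightarrow> nat option) \<Rightarrow> nat \<Rightarrow> bool" where
  "open_path N c p i uv used h p' j \<longleftrightarrow> j < N \<and> used j \<and>
    (\<forall>r<i. \<exists>l<N. l \<noteq> j \<and> p' l = Some r) \<and>
    (\<forall>l<N. \<forall>l'<N. l \<noteq> j \<longrightarrow> l' \<noteq> j \<longrightarrow> p' l = p' l' \<longrightarrow> p' l \<noteq> None \<longrightarrow> l = l') \<and>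
    (\<forall>l<N. \<forall>r. l \<noteq> j \<longrightarrow> p' l = Some r \<longrightarrow> r < i \<and> reduced c uv r l = 0) \<and>
    (\<forall>l<N. h l < h j \<longrightarrow> p' l = p l) \<and>
    (\<forall>l<N. l \<noteq> j \<longrightarrow> p' l = None \<longrightarrow> snd uv l = 0)"

text \<open>The hole at \<open>j\<close> takes over the row of its parent column and thereby moves
  to the parent; at the root it receives the new row \<open>i\<close>. All new pairs are tight
  because the tree records tight pairs, and the potentials stay fixed.\<close>

lemma augment:
  assumes opt: "optimal_partial n N c i uv p" and i: "i < n"
    and j: "j < N" "used j" "p j = None" and tree: "tree N c p i uv used way h N"
  shows "optimal_partial n N c (Suc i) uv (result (augment_alg N way i j p))"
proof -
  define f where "f = (\<lambda>(p, j). do {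
       wj \<leftarrow> op (way j);
       case wj of
         None \<Rightarrow> do {
           p \<leftarrow> op (p(j := Some i));
           return (True, (p, j)) }
       | Some j' \<Rightarrow> do {
           r \<leftarrow> op (p j');
           p \<leftarrow> op (p(j := r));
           return (False, (p, j')) } })"
  have f: "result (f (p', j)) = (case way j of None \<Rightarrow> (True, (p'(j := Some i), j))
      | Some j' \<Rightarrow> (False, (p'(j := p' j'), j')))" for p' j
    by (simp add: f_def split: option.split)
  have "optimal_partial n N c (Suc i) uv (fst (result (repeat q f (p', j))))"
    if "open_path N c p i uv used h p' j" "h j < q" for q p' j
    using that
  proof (induction q arbitrary: p' j)
    case (Suc q)
    from Suc.prems(1) have j: "j < N" "used j"
      and cover: "\<And>r. r < i \<Longrightarrow> \<exists>l<N. l \<noteq> j \<and> p' l = Some r"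
      and inj: "\<And>l l' r. l < N \<Longrightarrow> l' < N \<Longrightarrow> l \<noteq> j \<Longrightarrow> l' \<noteq> j \<Longrightarrow> p' l = Some r \<Longrightarrow> p' l' = Some r \<Longrightarrow> l = l'"
      and tight: "\<And>l r. l < N \<Longrightarrow> l \<noteq> j \<Longrightarrow> p' l = Some r \<Longrightarrow> r < i \<and> reduced c uv r l = 0"
      and old: "\<And>l. l < N \<Longrightarrow> h l < h j \<Longrightarrow> p' l = p l"
      and free: "\<And>l. l < N \<Longrightarrow> l \<noteq> j \<Longrightarrow> p' l = None \<Longrightarrow> snd uv l = 0"
      unfolding open_path_def by (blast, blast, blast, fastforce, blast, blast, blast)
    have w: "reduced c uv (row_of p i (way j)) j = 0"
      "\<And>j'. way j = Some j' \<Longrightarrow> j' < N \<and> used j' \<and> p j' \<noteq> None \<and> h j' < h j"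
      using tree j unfolding tree_def by blast+
    show ?case
    proof (cases "way j")
      case None
      let ?q = "p'(j := Some i)"
      have "optimal_partial n N c (Suc i) uv ?q"
        unfolding optimal_partial_def
      proof (intro conjI allI impI)
        fix l r assume "l < N" "?q l = Some r"
        then show "r < Suc i" "reduced c uv r l = 0"
          using tight[of l r] w(1) None by (auto simp: row_of_def split: if_splits)
      next
        fix l l' assume l: "l < N" "l' < N" "?q l = ?q l'" "?q l \<noteq> None"
        then obtain r where "?q l = Some r" "?q l' = Some r" by auto
        then show "l = l'" using l(1,2) inj[of l l' r] tight[of l r] tight[of l' r] by (auto split: if_splits)
      next
        fix r assume "r < Suc i"
        then show "\<exists>l<N. ?q l = Some r" using cover[of r] j(1) by (cases "r = i") auto
      next
        fix l assume "l < N" "?q l = None"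
        then show "snd uv l = 0" using free[of l] by (auto split: if_splits)
      qed (use optimal_partialD(1,5)[OF opt] in auto)
      then show ?thesis using f[of p' j] None by (simp add: result_repeat_Suc del: fun_upd_apply)
    next
      case (Some j')
      have j': "j' < N" "used j'" "h j' < h j" using w(2)[OF Some] by auto
      then have ne: "j' \<noteq> j" by auto
      \<comment> \<open>The parent has smaller rank and therefore still holds its row under
        \<open>p\<close>, the one for which the tree records a tight pair with
        \<open>j\<close>.\<close>
      obtain r0 where r0: "p j' = Some r0" "p' j' = Some r0" using w(2)[OF Some] old[OF j'(1,3)] by auto
      have tight0: "r0 < i" "reduced c uv r0 j = 0"
        using tight[OF j'(1) ne r0(2)] w(1) Some r0(1) by (auto simp: row_of_def)
      let ?q = "p'(j := p' j')"
      have "open_path N c p i uv used h ?q j'"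
        unfolding open_path_def
      proof (intro conjI allI impI)
        fix r assume "r < i"
        then obtain l where "l < N" "l \<noteq> j" "p' l = Some r" using cover by blast
        then show "\<exists>l<N. l \<noteq> j' \<and> ?q l = Some r"
          using ne j(1) by (cases "l = j'") auto
      next
        fix l l' assume l: "l < N" "l' < N" "l \<noteq> j'" "l' \<noteq> j'" "?q l = ?q l'"
          "?q l \<noteq> None"
        then obtain r where "?q l = Some r" "?q l' = Some r" by auto
        then show "l = l'" using l(1-4) inj[of l l' r] inj[of l j' r] inj[of l' j' r] j'(1) ne
          by (auto split: if_splits)
      next
        fix l r assume "l < N" "l \<noteq> j'" "?q l = Some r"
        then show "r < i" "reduced c uv r l = 0" using tight[of l r] tight0 r0(2) by (auto split: if_splits)
      next
        fix l assume "l < N" "h l < h j'"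
        then show "?q l = p l" using old[of l] j'(3) by auto
      next
        fix l assume "l < N" "l \<noteq> j'" "?q l = None"
        then show "snd uv l = 0" using free[of l] r0(2) by (auto split: if_splits)
      qed (use j' in auto)
      moreover have "h j' < q" using j'(3) Suc.prems(2) by simp
      ultimately have "optimal_partial n N c (Suc i) uv (fst (result (repeat q f (?q, j'))))"
        by (rule Suc.IH)
      then show ?thesis using f[of p' j] Some by (simp add: result_repeat_Suc del: fun_upd_apply)
    qed
  qed simp
  moreover have "open_path N c p i uv used h p j"
    unfolding open_path_def
  proof (intro conjI allI impI)
    fix r assume "r < i"
    then show "\<exists>l<N. l \<noteq> j \<and> p l = Some r" using optimal_partialD(4)[OF opt] j(3) by force
  next
    fix l l' assume "l < N" "l' < N" "p l = p l'" "p l \<noteq> None"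
    then show "l = l'" using optimal_partialD(3)[OF opt, of l l'] by auto
  qed (use j optimal_partialD(2,6)[OF opt] in auto)
  moreover have "h j < N" using tree j unfolding tree_def by blast
  ultimately show ?thesis
    unfolding augment_alg_def f_def[symmetric] by (simp split: prod.split) (metis fst_conv)
qed

lemma assign_row:
  assumes opt: "optimal_partial n N c i uv p" and i: "i < n" "n \<le> N"
  defines "out \<equiv> result (assign_row_alg N c i (uv, p))"
  shows "optimal_partial n N c (Suc i) (fst out) (snd out)"
proof -
  define slack where "slack = result (loop N (\<lambda>j slack. do {
       x \<leftarrow> op (c (i, j));
       ui \<leftarrow> op (fst uv i);
       x \<leftarrow> op (x - ui);
       vj \<leftarrow> op (snd uv j);
       x \<leftarrow> op (x - vj);
       op (slack(j := x)) }) (\<lambda>_. 0))"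
  have "\<forall>j<N. slack j = reduced c uv i j"
    unfolding slack_def
    by (rule loop_invariant[where I = "\<lambda>k s. \<forall>j<k. s j = reduced c uv i j"])
      (auto simp: reduced_def less_Suc_eq)
  \<comment> \<open>At first the tree is the root row alone: the slacks are its reduced costs, and
    any rank function will do.\<close>
  then have "search_inv n N c p i (uv, (\<lambda>_. False), slack, (\<lambda>_. None), None) 0"
    using opt by (auto simp: search_inv_def tree_def row_of_def tree_row_def)
  then have done_inv: "search_done n N c p i (result (repeat N (search_round_alg N c p i) (uv, (\<lambda>_. False), slack, (\<lambda>_. None), None)))"
    by (rule search_repeat[OF i]) (use i in simp)
  obtain uv' used slack' way fin where
    st: "result (repeat N (search_round_alg N c p i) (uv, (\<lambda>_. False), slack, (\<lambda>_. None), None)) = (uv', used, slack', way, fin)"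
    by (metis prod.exhaust)
  obtain j h where opt': "optimal_partial n N c i uv' p" and fin: "fin = Some j"
    and j: "j < N" "used j" "p j = None" and tree: "tree N c p i uv' used way h N"
    using done_inv unfolding st search_done_def prod.case by (elim conjE exE)
  have "out = (uv', result (augment_alg N way i j p))"
    unfolding out_def assign_row_alg_def using st fin by (simp flip: slack_def)
  then show ?thesis using augment[OF opt' i(1) j tree] by simp
qed

lemma hungarian_optimal_partial:
  assumes "n \<le> N" "\<And>i j. i < n \<Longrightarrow> j < N \<Longrightarrow> 0 \<le> c (i, j)"
  shows "\<exists>uv. optimal_partial n N c n uv (result (hungarian_alg n N c))"
proof -
  define st where "st = result (loop n (assign_row_alg N c) (((\<lambda>_. 0), (\<lambda>_. 0)), (\<lambda>_. None)))"
  have "n \<le> n \<and> optimal_partial n N c n (fst st) (snd st)"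
    unfolding st_def
  proof (rule loop_invariant[where I = "\<lambda>k st. k \<le> n \<and> optimal_partial n N c k (fst st) (snd st)"])
    fix k s assume "k < n" "k \<le> n \<and> optimal_partial n N c k (fst s) (snd s)"
    then show "Suc k \<le> n \<and> optimal_partial n N c (Suc k) (fst (result (assign_row_alg N c k s))) (snd (result (assign_row_alg N c k s)))"
      using assign_row[of n N c k "fst s" "snd s"] assms(1) by simp
  qed (use assms(2) in \<open>simp add: optimal_partial_def reduced_def\<close>)
  moreover have "result (hungarian_alg n N c) = snd st"
    by (simp add: hungarian_alg_def st_def split: prod.split)
  ultimately show ?thesis by (intro exI[of _ "fst st"]) simp
qed

text \<open>Weak duality. The sum of all potentials equals the cost of \<open>\<sigma>\<close>,
  since assigned pairs are tight and other columns have potential 0. It bounds the cost of any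
  \<open>f\<close> from below, since the columns omitted by \<open>f\<close> have potentials at most
  0.\<close>

lemma hungarian:
  assumes n: "n \<le> N" and c: "\<And>i j. i < n \<Longrightarrow> j < N \<Longrightarrow> 0 \<le> c (i, j)"
  obtains \<sigma> where "inj_on \<sigma> {..<n}" "\<And>i. i < n \<Longrightarrow> \<sigma> i < N"
    "\<And>j r. j < N \<Longrightarrow> result (hungarian_alg n N c) j = Some r \<longleftrightarrow> r < n \<and> j = \<sigma> r"
    "\<forall>f. inj_on f {..<n} \<longrightarrow> (\<forall>i<n. f i < N) \<longrightarrow> (\<Sum>i<n. c (i, \<sigma> i)) \<le> (\<Sum>i<n. c (i, f i))"
proof -
  define p where "p = result (hungarian_alg n N c)"
  obtain uv where opt: "optimal_partial n N c n uv p"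
    using hungarian_optimal_partial[of n N c] n c unfolding p_def by blast
  have "\<forall>r\<in>{..<n}. \<exists>j. j < N \<and> p j = Some r" using optimal_partialD(4)[OF opt] by auto
  from bchoice[OF this] obtain \<sigma> where \<sigma>: "\<And>i. i < n \<Longrightarrow> \<sigma> i < N \<and> p (\<sigma> i) = Some i" by auto
  have inj: "inj_on \<sigma> {..<n}" by (rule inj_onI) (metis \<sigma> lessThan_iff option.inject)
  have iff: "p j = Some r \<longleftrightarrow> r < n \<and> j = \<sigma> r" if "j < N" for j r
    using \<sigma> optimal_partialD(2,3)[OF opt] that by blast
  show ?thesis
  proof (rule that[OF inj])
    show "\<sigma> i < N" if "i < n" for i using \<sigma> that by blast
    show "result (hungarian_alg n N c) j = Some r \<longleftrightarrow> r < n \<and> j = \<sigma> r" if "j < N" for j r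
      using iff[OF that] p_def by simp
    show "\<forall>f. inj_on f {..<n} \<longrightarrow> (\<forall>i<n. f i < N) \<longrightarrow> (\<Sum>i<n. c (i, \<sigma> i)) \<le> (\<Sum>i<n. c (i, f i))"
    proof (intro allI impI)
      fix f :: "nat \<Rightarrow> nat" assume f: "inj_on f {..<n}" "\<forall>i<n. f i < N"
      have "(\<Sum>i<n. c (i, \<sigma> i)) = (\<Sum>i<n. fst uv i + snd uv (\<sigma> i))"
      proof (rule sum.cong[OF refl])
        fix i assume "i \<in> {..<n}"
        then have "reduced c uv i (\<sigma> i) = 0" using \<sigma> optimal_partialD(2)[OF opt] by simp
        then show "c (i, \<sigma> i) = fst uv i + snd uv (\<sigma> i)" by (simp add: reduced_def)
      qed
      also have "\<dots> = (\<Sum>i<n. fst uv i) + sum (snd uv) (\<sigma> ` {..<n})"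
        by (simp add: sum.distrib sum.reindex[OF inj])
      also have "sum (snd uv) (\<sigma> ` {..<n}) = sum (snd uv) {..<N}"
      proof (rule sum.mono_neutral_left)
        show "\<forall>j\<in>{..<N} - \<sigma> ` {..<n}. snd uv j = 0"
        proof
          fix j assume j: "j \<in> {..<N} - \<sigma> ` {..<n}"
          then have "p j = None" using iff[of j] by (cases "p j") auto
          then show "snd uv j = 0" using optimal_partialD(6)[OF opt] j by auto
        qed
      qed (use \<sigma> in auto)
      also have "\<dots> \<le> sum (snd uv) (f ` {..<n})"
        using f(2) optimal_partialD(5)[OF opt]
        by (subst sum.subset_diff[of "f ` {..<n}"]) (auto intro!: sum_nonpos)
      also have "(\<Sum>i<n. fst uv i) + sum (snd uv) (f ` {..<n}) = (\<Sum>i<n. fst uv i + snd uv (f i))"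
        by (simp add: sum.distrib sum.reindex[OF f(1)])
      also have "\<dots> \<le> (\<Sum>i<n. c (i, f i))"
      proof (rule sum_mono)
        fix i assume "i \<in> {..<n}"
        then have "0 \<le> reduced c uv i (f i)" using f(2) optimal_partialD(1)[OF opt] by simp
        then show "fst uv i + snd uv (f i) \<le> c (i, f i)" by (simp add: reduced_def)
      qed
      finally show "(\<Sum>i<n. c (i, \<sigma> i)) \<le> (\<Sum>i<n. c (i, f i))" by simp
    qed
  qed
qed


section \<open>The matching algorithm\<close>

text \<open>A template for the double loops that conditionally overwrite each cell with a value
  independent of the array. The offset \<open>q\<close> serves the block of input columns, which
  starts at \<open>d\<close>.\<close>

lemma result_fill:
  assumes f: "\<And>i k R. i < n \<Longrightarrow> k < m \<Longrightarrow> result (f i k R) = (if P i k then R((i, q + k) := v i k) else R)"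
  shows "result (loop n (\<lambda>i. loop m (f i)) R) =
    (\<lambda>(i, j). if i < n \<and> q \<le> j \<and> j < q + m \<and> P i (j - q) then v i (j - q) else R (i, j))"
proof -
  have inner: "result (loop m (f i) R) =
      (\<lambda>(i', j). if i' = i \<and> q \<le> j \<and> j < q + m \<and> P i (j - q) then v i (j - q) else R (i', j))"
    if i: "i < n" for i R
  proof -
    have "m \<le> m \<and> result (loop m (f i) R) =
      (\<lambda>(i', j). if i' = i \<and> q \<le> j \<and> j < q + m \<and> P i (j - q) then v i (j - q) else R (i', j))"
      by (rule loop_invariant[where I = "\<lambda>k R'. k \<le> m \<and> R' =
        (\<lambda>(i', j). if i' = i \<and> q \<le> j \<and> j < q + k \<and> P i (j - q) then v i (j - q) else R (i', j))"])
        (auto simp: f[OF i] fun_eq_iff less_Suc_eq)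
    then show ?thesis by blast
  qed
  have "n \<le> n \<and> result (loop n (\<lambda>i. loop m (f i)) R) =
    (\<lambda>(i, j). if i < n \<and> q \<le> j \<and> j < q + m \<and> P i (j - q) then v i (j - q) else R (i, j))"
    by (rule loop_invariant[where I = "\<lambda>k R'. k \<le> n \<and> R' =
        (\<lambda>(i, j). if i < k \<and> q \<le> j \<and> j < q + m \<and> P i (j - q) then v i (j - q) else R (i, j))"])
      (auto simp: inner fun_eq_iff less_Suc_eq)
  then show ?thesis by blast
qed

lemma entry_eq_Star [simp]: "e \<noteq> Zero \<longleftrightarrow> e = Star" "e \<noteq> Star \<longleftrightarrow> e = Zero"
  by (cases e; simp)+

lemma result_max_cost:
  "0 \<le> result (max_cost_alg d m B w) \<and>
    (\<forall>i<d. \<forall>k<m. B $$ (i, k) = Star \<longrightarrow> w i k \<le> result (max_cost_alg d m B w))"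
  unfolding max_cost_alg_def
proof (rule loop_invariant[where I = "\<lambda>n x. 0 \<le> x \<and> (\<forall>i<n. \<forall>k<m. B $$ (i, k) = Star \<longrightarrow> w i k \<le> x)"])
  fix i and x :: real
  assume x: "0 \<le> x \<and> (\<forall>i'<i. \<forall>k<m. B $$ (i', k) = Star \<longrightarrow> w i' k \<le> x)"
  let ?f = "\<lambda>k x. do {
      e \<leftarrow> op (B $$ (i, k));
      star \<leftarrow> op (e = Star);
      if star then do {
        y \<leftarrow> op (w i k);
        b \<leftarrow> op (x < y);
        if b then return y else return x }
      else return x }"
  have "x \<le> result (loop m ?f x) \<and> (\<forall>k<m. B $$ (i, k) = Star \<longrightarrow> w i k \<le> result (loop m ?f x))"
    by (rule loop_invariant[where I = "\<lambda>n y. x \<le> y \<and> (\<forall>k<n. B $$ (i, k) = Star \<longrightarrow> w i k \<le> y)"])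
      (auto simp: less_Suc_eq split: if_splits)
  with x show "0 \<le> result (loop m ?f x) \<and>
      (\<forall>i'<Suc i. \<forall>k<m. B $$ (i', k) = Star \<longrightarrow> w i' k \<le> result (loop m ?f x))"
    by (auto simp: less_Suc_eq intro: order_trans)
qed simp

lemma result_cost_array:
  "result (cost_array_alg d m B w big) =
    (\<lambda>(i, k). if i < d \<and> k < m \<and> B $$ (i, k) = Star then w i k else big)"
proof -
  have "result (cost_array_alg d m B w big) =
    (\<lambda>(i, j). if i < d \<and> 0 \<le> j \<and> j < 0 + m \<and> B $$ (i, j - 0) = Star then w i (j - 0) else big)"
    unfolding cost_array_alg_def result_bind result_new_array by (rule result_fill) simp
  then show ?thesis by (simp add: fun_eq_iff)
qed

definition penalty :: "nat \<Rightarrow> nat \<Rightarrow> entry mat \<Rightarrow> (nat \<Rightarrow> nat \<Rightarrow> real) \<Rightarrow> real" where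
  "penalty d m B w = 1 + d * result (max_cost_alg d m B w)"

lemma result_assignment_costs:
  "result (assignment_costs_alg d m A B w) =
    (\<lambda>(i, j). if i < d \<and> j < d \<and> A $$ (i, j) = Star then 0
       else if i < d \<and> d \<le> j \<and> j < d + m \<and> B $$ (i, j - d) = Star then w i (j - d)
       else penalty d m B w)"
proof -
  have big: "result (loop n (\<lambda>_ x. op (x + y)) (1::real)) = 1 + n * y" for n y
    by (induction n) (simp_all add: algebra_simps)
  have A: "result (loop d (\<lambda>i. loop d (\<lambda>j c. do {
       e \<leftarrow> op (A $$ (i, j));
       star \<leftarrow> op (e = Star);
       if star then op (c((i, j) := (0::real))) else return c })) c) =
     (\<lambda>(i, j). if i < d \<and> 0 \<le> j \<and> j < 0 + d \<and> A $$ (i, j - 0) = Star then 0 else c (i, j))" for c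
    by (rule result_fill) simp
  have B: "result (loop d (\<lambda>i. loop m (\<lambda>k c. do {
       e \<leftarrow> op (B $$ (i, k));
       star \<leftarrow> op (e = Star);
       if star then do {
         y \<leftarrow> op (w i k);
         j \<leftarrow> op (d + k);
         op (c((i, j) := y)) }
       else return c })) c) =
     (\<lambda>(i, j). if i < d \<and> d \<le> j \<and> j < d + m \<and> B $$ (i, j - d) = Star then w i (j - d) else c (i, j))" for c
    by (rule result_fill) simp
  show ?thesis
    unfolding assignment_costs_alg_def result_bind result_new_array big A B penalty_def by (auto simp: fun_eq_iff)
qed

definition column_of :: "nat \<Rightarrow> left_vertex \<Rightarrow> nat" where
  "column_of d x = (case x of V1 j \<Rightarrow> j | U k \<Rightarrow> d + k)"

definition vertex_of :: "nat \<Rightarrow> nat \<Rightarrow> left_vertex" where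
  "vertex_of d j = (if j < d then V1 j else U (j - d))"

lemma inj_vertex_of: "inj (vertex_of d)"
  by (rule injI) (auto simp: vertex_of_def split: if_splits)

lemma edges_iff:
  assumes "A \<in> carrier_mat d d" "B \<in> carrier_mat d m"
  shows "(V1 j, i) \<in> state_edges A \<union> input_edges B \<longleftrightarrow> i < d \<and> j < d \<and> A $$ (i, j) = Star"
    "(U k, i) \<in> state_edges A \<union> input_edges B \<longleftrightarrow> i < d \<and> k < m \<and> B $$ (i, k) = Star"
  using assms by (auto simp: state_edges_def input_edges_def)

section \<open>Matchings that cover all rows\<close>

definition row_matching :: "nat \<Rightarrow> (nat \<Rightarrow> 'a) \<Rightarrow> ('a \<times> nat) set" where
  "row_matching d f = (\<lambda>i. (f i, i)) ` {..<d}"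

lemma card_row_matching: "card (row_matching d f) = d"
  unfolding row_matching_def by (subst card_image) (auto intro: inj_onI)

lemma sum_row_matching: "sum c (row_matching d f) = (\<Sum>i<d. c (f i, i))"
  unfolding row_matching_def by (subst sum.reindex) (auto intro: inj_onI)

lemma row_matching_maximum:
  assumes E: "E \<subseteq> UNIV \<times> {..<d}" and f: "inj_on f {..<d}" "\<And>i. i < d \<Longrightarrow> (f i, i) \<in> E"
  shows "is_maximum_matching E (row_matching d f)"
  unfolding is_maximum_matching_def
proof (intro conjI allI impI)
  show "is_matching E (row_matching d f)"
    unfolding is_matching_def
  proof (intro conjI ballI impI)
    show "row_matching d f \<subseteq> E" using f(2) by (auto simp: row_matching_def)
    fix e e' assume "e \<in> row_matching d f" "e' \<in> row_matching d f" "e \<noteq> e'"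
    then show "fst e \<noteq> fst e'" "snd e \<noteq> snd e'"
      using f(1) by (auto simp: row_matching_def dest: inj_onD)
  qed
  fix M' assume M': "is_matching E M'"
  then have "inj_on snd M'" unfolding is_matching_def inj_on_def by blast
  then have "card M' = card (snd ` M')" by (rule card_image[symmetric])
  also have "\<dots> \<le> card {..<d}"
    using M' E unfolding is_matching_def by (intro card_mono) auto
  finally show "card M' \<le> card (row_matching d f)" by (simp add: card_row_matching)
qed

text \<open>As some matching covers all rows, a maximum one has \<open>d\<close> edges and must do
  so, too; it is then given by an injective choice of left vertices.\<close>

lemma maximum_matching_rows:
  assumes E: "E \<subseteq> UNIV \<times> {..<d}" and f: "inj_on f {..<d}" "\<And>i. i < d \<Longrightarrow> (f i, i) \<in> E"
    and M: "is_maximum_matching E M"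
  obtains g where "inj_on g {..<d}" "\<And>i. i < d \<Longrightarrow> (g i, i) \<in> E" "M = row_matching d g"
proof -
  have match: "M \<subseteq> E" "\<And>e e'. e \<in> M \<Longrightarrow> e' \<in> M \<Longrightarrow> e \<noteq> e' \<Longrightarrow> fst e \<noteq> fst e' \<and> snd e \<noteq> snd e'"
    using M unfolding is_maximum_matching_def is_matching_def by blast+
  have "inj_on snd M" using match(2) unfolding inj_on_def by blast
  then have "card (snd ` M) = card M" by (rule card_image)
  moreover have "d \<le> card M"
    using M row_matching_maximum[OF E f] card_row_matching[of d f] unfolding is_maximum_matching_def by metis
  moreover have sub: "snd ` M \<subseteq> {..<d}" using match(1) E by auto
  then have "card (snd ` M) \<le> card {..<d}" by (intro card_mono) auto
  ultimately have "card (snd ` M) = card {..<d}" by simp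
  with sub have snd_M: "snd ` M = {..<d}" by (intro card_subset_eq) auto
  have "\<forall>i\<in>{..<d}. \<exists>x. (x, i) \<in> M"
  proof
    fix i assume "i \<in> {..<d}"
    then have "i \<in> snd ` M" by (simp only: snd_M)
    then show "\<exists>x. (x, i) \<in> M" by force
  qed
  from bchoice[OF this] obtain g where g: "\<And>i. i < d \<Longrightarrow> (g i, i) \<in> M" by auto
  have "M \<subseteq> row_matching d g"
  proof
    fix e assume e: "e \<in> M"
    then have lt: "snd e < d" using snd_M by blast
    then have "e = (g (snd e), snd e)" using match(2)[OF e g[OF lt]] by auto
    then show "e \<in> row_matching d g" using lt unfolding row_matching_def by blast
  qed
  then have "M = row_matching d g" using g by (auto simp: row_matching_def)
  moreover have "inj_on g {..<d}"
  proof (rule inj_onI)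
    fix i j assume "i \<in> {..<d}" "j \<in> {..<d}" "g i = g j"
    then show "i = j" using match(2)[OF g g, of i j] by auto
  qed
  ultimately show ?thesis using that g match(1) by blast
qed

lemma result_matching_array:
  assumes p: "\<And>k l. k < m \<Longrightarrow> p (d + k) = Some l \<Longrightarrow> l < d"
  shows "result (loop m (\<lambda>k X. do {
       j \<leftarrow> op (d + k);
       pj \<leftarrow> op (p j);
       case pj of
         None \<Rightarrow> return X
       | Some l \<Rightarrow> do {
           e \<leftarrow> op (B $$ (l, k));
           star \<leftarrow> op (e = Star);
           if star then op (X((l, k) := Star)) else return X } }) (\<lambda>_. Zero)) =
    (\<lambda>(l, k). if k < m \<and> p (d + k) = Some l \<and> B $$ (l, k) = Star then Star else Zero)"
  by (rule loop_invariant[where I = "\<lambda>n X. X =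
      (\<lambda>(l, k). if k < n \<and> p (d + k) = Some l \<and> B $$ (l, k) = Star then Star else Zero)"])
    (auto simp: fun_eq_iff less_Suc_eq split: option.split)

text \<open>The row-covering matching \<open>f0\<close> identifies maximum matchings with injective
  choices of edges, so they can be compared with assignments directly.\<close>

lemma matching_alg_correct:
  assumes A: "A \<in> carrier_mat d d" and B: "B \<in> carrier_mat d m"
    and w: "\<And>i k. i < d \<Longrightarrow> k < m \<Longrightarrow> B $$ (i, k) = Star \<Longrightarrow> 0 \<le> w i k"
    and f0: "inj_on f0 {..<d}" "\<And>i. i < d \<Longrightarrow> (f0 i, i) \<in> state_edges A \<union> input_edges B"
  shows "matching_output A B w (mat d m (result (matching_alg d m A B w)))"
proof -
  let ?E = "state_edges A \<union> input_edges B"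
  define c where "c = result (assignment_costs_alg d m A B w)"
  define wmax where "wmax = result (max_cost_alg d m B w)"
  have wmax: "0 \<le> wmax" "\<And>i k. i < d \<Longrightarrow> k < m \<Longrightarrow> B $$ (i, k) = Star \<Longrightarrow> w i k \<le> wmax"
    using result_max_cost[of d m B w] by (auto simp: wmax_def)
  have pen: "penalty d m B w = 1 + d * wmax" by (simp add: penalty_def wmax_def)
  have pen0: "0 \<le> penalty d m B w" using wmax(1) by (simp add: pen)
  have E: "?E \<subseteq> UNIV \<times> {..<d}" using A B by (auto simp: state_edges_def input_edges_def)
  have c_edge: "c (i, column_of d x) = edge_cost w (x, i)" "c (i, column_of d x) \<le> wmax" "column_of d x < d + m"
    if "(x, i) \<in> ?E" for x i
    using that wmax
    by (cases x; simp add: edges_iff[OF A B, simplified] c_def result_assignment_costs column_of_def)+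
  have c0: "0 \<le> c (i, j)" if "i < d" "j < d + m" for i j
    using w pen0 that unfolding c_def result_assignment_costs by (auto simp: not_less)
  \<comment> \<open>The column numbers of states and inputs are disjoint only within their ranges,
    hence the restriction to edges.\<close>
  have inj_col: "inj_on (\<lambda>i. column_of d (f i)) {..<d}"
    if f: "inj_on f {..<d}" "\<And>i. i < d \<Longrightarrow> (f i, i) \<in> ?E" for f
  proof (rule inj_onI)
    fix i j assume ij: "i \<in> {..<d}" "j \<in> {..<d}" "column_of d (f i) = column_of d (f j)"
    have "x = y" if "column_of d x = column_of d y" "(x, i) \<in> ?E" "(y, j) \<in> ?E" for x y
      using that by (cases x; cases y) (auto simp: edges_iff[OF A B, simplified] column_of_def)
    then have "f i = f j" using ij f(2) by simp
    then show "i = j" using f(1) ij by (auto dest: inj_onD)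
  qed
  obtain \<sigma> where \<sigma>: "inj_on \<sigma> {..<d}" "\<And>i. i < d \<Longrightarrow> \<sigma> i < d + m"
    and p: "\<And>j r. j < d + m \<Longrightarrow> result (hungarian_alg d (d + m) c) j = Some r \<longleftrightarrow> r < d \<and> j = \<sigma> r"
    and opt_all: "\<forall>f. inj_on f {..<d} \<longrightarrow> (\<forall>i<d. f i < d + m) \<longrightarrow> (\<Sum>i<d. c (i, \<sigma> i)) \<le> (\<Sum>i<d. c (i, f i))"
    by (rule hungarian[of d "d + m" c], simp, rule c0, assumption, assumption, rule that)
  have opt: "(\<Sum>i<d. c (i, \<sigma> i)) \<le> (\<Sum>i<d. c (i, f i))"
    if "inj_on f {..<d}" "\<And>i. i < d \<Longrightarrow> f i < d + m" for f
    using opt_all that by blast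
  have opt_f: "(\<Sum>i<d. c (i, \<sigma> i)) \<le> (\<Sum>i<d. edge_cost w (f i, i))"
    if f: "inj_on f {..<d}" "\<And>i. i < d \<Longrightarrow> (f i, i) \<in> ?E" for f
  proof -
    have "(\<Sum>i<d. c (i, \<sigma> i)) \<le> (\<Sum>i<d. c (i, column_of d (f i)))"
      using c_edge(3) f(2) by (intro opt inj_col f) auto
    also have "\<dots> = (\<Sum>i<d. edge_cost w (f i, i))" using c_edge(1) f(2) by (intro sum.cong) auto
    finally show ?thesis .
  qed
  \<comment> \<open>By optimality the total is at most that of \<open>f0\<close>, hence at most
    \<open>d * wmax\<close>, and the penalty exceeds this by 1. As costs are non-negative, no single
    entry can then be a non-edge.\<close>
  have small: "c (i, \<sigma> i) < penalty d m B w" if i: "i < d" for i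
  proof -
    have "c (i, \<sigma> i) \<le> (\<Sum>i<d. c (i, \<sigma> i))"
      using i c0 \<sigma>(2) by (intro member_le_sum) auto
    also have "\<dots> \<le> (\<Sum>i<d. c (i, column_of d (f0 i)))"
      using c_edge(3) f0(2) by (intro opt inj_col f0) auto
    also have "\<dots> \<le> (\<Sum>i<d. wmax)" using c_edge(2) f0(2) by (intro sum_mono) auto
    also have "\<dots> < penalty d m B w" by (simp add: pen)
    finally show ?thesis .
  qed
  let ?g = "\<lambda>i. vertex_of d (\<sigma> i)"
  have edge: "(?g i, i) \<in> ?E" if i: "i < d" for i
    using small[OF i] i \<sigma>(2)[OF i] unfolding c_def result_assignment_costs
    by (auto simp: vertex_of_def edges_iff[OF A B, simplified] split: if_splits)
  have g_inj: "inj_on ?g {..<d}"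
    using \<sigma>(1) inj_vertex_of by (auto simp: inj_on_def dest: injD)
  have col_g: "column_of d (?g i) = \<sigma> i" for i by (simp add: vertex_of_def column_of_def)
  have cost_g: "(\<Sum>i<d. c (i, \<sigma> i)) = (\<Sum>i<d. edge_cost w (?g i, i))"
  proof (rule sum.cong[OF refl])
    fix i assume "i \<in> {..<d}"
    then show "c (i, \<sigma> i) = edge_cost w (?g i, i)" using c_edge(1)[OF edge, of i] by (simp add: col_g)
  qed
  have "is_mcmm ?E (edge_cost w) (row_matching d ?g)"
    unfolding is_mcmm_def
  proof (intro conjI allI impI)
    show "is_maximum_matching ?E (row_matching d ?g)" by (rule row_matching_maximum[OF E g_inj edge])
    fix M' assume "is_maximum_matching ?E M'"
    then obtain g' where g': "inj_on g' {..<d}" "\<And>i. i < d \<Longrightarrow> (g' i, i) \<in> ?E" "M' = row_matching d g'"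
      using maximum_matching_rows[OF E f0] by blast
    then show "sum (edge_cost w) (row_matching d ?g) \<le> sum (edge_cost w) M'"
      using opt_f[OF g'(1,2)] by (simp add: sum_row_matching cost_g)
  qed
  moreover have "mat d m (result (matching_alg d m A B w)) =
      mat (dim_row B) (dim_col B) (\<lambda>(l, k). if (U k, l) \<in> row_matching d ?g \<inter> input_edges B then Star else Zero)"
  proof -
    let ?p = "result (hungarian_alg d (d + m) c)"
    have "l < d" if "k < m" "?p (d + k) = Some l" for k l using p[of "d + k" l] that by simp
    then have "result (matching_alg d m A B w) =
        (\<lambda>(l, k). if k < m \<and> ?p (d + k) = Some l \<and> B $$ (l, k) = Star then Star else Zero)"
      unfolding matching_alg_def result_bind result_op result_new_array c_def[symmetric]
      by (rule result_matching_array)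
    moreover have "?p (d + k) = Some l \<and> B $$ (l, k) = Star \<longleftrightarrow> (U k, l) \<in> row_matching d ?g \<inter> input_edges B"
      if "l < d" "k < m" for l k
    proof -
      have "(U k, l) \<in> row_matching d ?g \<longleftrightarrow> d + k = \<sigma> l"
        using that by (auto simp: row_matching_def vertex_of_def image_iff split: if_splits)
      moreover have "(U k, l) \<in> input_edges B \<longleftrightarrow> B $$ (l, k) = Star"
        using that B by (auto simp: input_edges_def)
      ultimately show ?thesis using p[of "d + k" l] that by simp
    qed
    ultimately show ?thesis using B by (intro eq_matI) auto
  qed
  ultimately show ?thesis unfolding matching_output_def by blast
qed


section \<open>Source components\<close>

text \<open>Reachability with inner vertices below \<open>k\<close>, as a specification that the
  in-place updates must at least achieve.\<close>

fun warshall :: "entry mat \<Rightarrow> nat \<Rightarrow> nat \<Rightarrow> nat \<Rightarrow> bool" where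
  "warshall A 0 i j \<longleftrightarrow> i = j \<or> A $$ (j, i) = Star"
| "warshall A (Suc k) i j \<longleftrightarrow> warshall A k i j \<or> warshall A k i k \<and> warshall A k k j"

text \<open>Walks may be joined at an admissible inner vertex without raising the level; at the
  final level a walk can thus be extended arc by arc.\<close>

lemma warshall_trans: "warshall A k i l \<Longrightarrow> l < k \<Longrightarrow> warshall A k l j \<Longrightarrow> warshall A k i j"
proof (induction k arbitrary: i l j)
  case (Suc k)
  show ?case
  proof (cases "l = k")
    case True
    then show ?thesis using Suc.prems by auto
  next
    case False
    then have "l < k" using Suc.prems(2) by simp
    then show ?thesis using Suc.IH[of _ l] Suc.prems(1,3) by (metis warshall.simps(2))
  qed
qed simp

lemma warshall_0: "warshall A 0 i j \<Longrightarrow> warshall A k i j"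
  by (induction k) auto

lemma warshall_complete:
  assumes "(i, j) \<in> (arcs_of A)\<^sup>*" "A \<in> carrier_mat d d"
  shows "warshall A d i j"
  using assms(1)
proof induction
  case base
  show ?case by (rule warshall_0) simp
next
  case (step l j)
  then have l: "l < d" "A $$ (j, l) = Star" using assms(2) by (auto simp: in_arcs_of)
  have "warshall A d l j" by (rule warshall_0) (simp add: l)
  then show ?case using warshall_trans[OF step.IH l(1)] by blast
qed

lemma result_reach:
  assumes A: "A \<in> carrier_mat d d" and ij: "i < d" "j < d"
  shows "result (reach_alg d A) (i, j) \<longleftrightarrow> (i, j) \<in> (arcs_of A)\<^sup>*"
proof -
  define R0 where "R0 = (\<lambda>(i, j). if i < d \<and> j < d then A $$ (j, i) = Star \<or> i = j else False)"
  let ?init = "loop d (\<lambda>i. loop d (\<lambda>j R. do {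
       a \<leftarrow> op (A $$ (j, i));
       b \<leftarrow> op (a = Star);
       e \<leftarrow> op (i = j);
       r \<leftarrow> op (b \<or> e);
       op (R((i, j) := r)) })) (\<lambda>_. False)"
  have "result ?init =
     (\<lambda>(i, j). if i < d \<and> 0 \<le> j \<and> j < 0 + d \<and> True then A $$ (j - 0, i) = Star \<or> i = j - 0 else False)"
    by (rule result_fill) (simp add: fun_eq_iff)
  then have init: "result ?init = R0"
    by (simp add: R0_def fun_eq_iff)
  define body where "body = (\<lambda>(k :: nat) (i :: nat) (j :: nat) R. do {
       ik \<leftarrow> op (R (i, k));
       kj \<leftarrow> op (R (k, j));
       b \<leftarrow> op (ik \<and> kj);
       if b then op (R((i, j) := True)) else return R })"
  have body: "result (body k i j R) = (if R (i, k) \<and> R (k, j) then R((i, j) := True) else R)" for k i j R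
    by (simp add: body_def)
  \<comment> \<open>The relation is updated in place, so R may contain more pairs than warshall prescribes.\<close>
  let ?sound = "\<lambda>R. \<forall>i j. R (i, j) \<longrightarrow> (i, j) \<in> (arcs_of A)\<^sup>*"
  let ?complete = "\<lambda>k R. \<forall>i<d. \<forall>j<d. warshall A k i j \<longrightarrow> R (i, j)"
  let ?R = "result (loop d (\<lambda>k. loop d (\<lambda>i. loop d (body k i))) R0)"
  have "d \<le> d \<and> ?sound ?R \<and> ?complete d ?R"
  proof (rule loop_invariant[where I = "\<lambda>k R. k \<le> d \<and> ?sound R \<and> ?complete k R"])
    show "0 \<le> d \<and> ?sound R0 \<and> ?complete 0 R0"
      using A by (auto simp: R0_def in_arcs_of split: if_splits)
  next
    fix k R assume k: "k < d" and R: "k \<le> d \<and> ?sound R \<and> ?complete k R"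
    let ?R' = "result (loop d (\<lambda>i. loop d (body k i)) R)"
    \<comment> \<open>It suffices to refer to the entries of \<open>R\<close> from before the pass,
      because entries only change from false to true.\<close>
    have "d \<le> d \<and> ?sound ?R' \<and> (\<forall>x. R x \<longrightarrow> ?R' x) \<and> (\<forall>i<d. \<forall>j<d. R (i, k) \<and> R (k, j) \<longrightarrow> ?R' (i, j))"
    proof (rule loop_invariant[where I = "\<lambda>n R'. n \<le> d \<and> ?sound R' \<and> (\<forall>x. R x \<longrightarrow> R' x) \<and>
        (\<forall>i<n. \<forall>j<d. R (i, k) \<and> R (k, j) \<longrightarrow> R' (i, j))"])
      fix i R1 assume i: "i < d" and R1: "i \<le> d \<and> ?sound R1 \<and> (\<forall>x. R x \<longrightarrow> R1 x) \<and>
        (\<forall>i'<i. \<forall>j<d. R (i', k) \<and> R (k, j) \<longrightarrow> R1 (i', j))"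
      let ?R2 = "result (loop d (body k i) R1)"
      have "d \<le> d \<and> ?sound ?R2 \<and> (\<forall>x. R1 x \<longrightarrow> ?R2 x) \<and> (\<forall>j<d. R (i, k) \<and> R (k, j) \<longrightarrow> ?R2 (i, j))"
      proof (rule loop_invariant[where I = "\<lambda>n R'. n \<le> d \<and> ?sound R' \<and> (\<forall>x. R1 x \<longrightarrow> R' x) \<and>
          (\<forall>j<n. R (i, k) \<and> R (k, j) \<longrightarrow> R' (i, j))"])
        fix j R' assume j: "j < d" and R': "j \<le> d \<and> ?sound R' \<and> (\<forall>x. R1 x \<longrightarrow> R' x) \<and>
          (\<forall>j'<j. R (i, k) \<and> R (k, j') \<longrightarrow> R' (i, j'))"
        show "Suc j \<le> d \<and> ?sound (result (body k i j R')) \<and> (\<forall>x. R1 x \<longrightarrow> result (body k i j R') x) \<and>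
          (\<forall>j'<Suc j. R (i, k) \<and> R (k, j') \<longrightarrow> result (body k i j R') (i, j'))"
        proof (intro conjI)
          show "?sound (result (body k i j R'))"
            using R' unfolding body by (auto intro: rtrancl_trans)
          have "R' (i, k) \<and> R' (k, j)" if "R (i, k) \<and> R (k, j)" using R1 R' that by blast
          then show "\<forall>j'<Suc j. R (i, k) \<and> R (k, j') \<longrightarrow> result (body k i j R') (i, j')"
            using R' unfolding body by (auto simp: less_Suc_eq)
        qed (use j R' in \<open>auto simp: body\<close>)
      qed (use R1 in auto)
      then show "Suc i \<le> d \<and> ?sound ?R2 \<and> (\<forall>x. R x \<longrightarrow> ?R2 x) \<and>
          (\<forall>i'<Suc i. \<forall>j<d. R (i', k) \<and> R (k, j) \<longrightarrow> ?R2 (i', j))"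
        using R1 i by (simp add: less_Suc_eq)
    qed (use R in auto)
    then show "Suc k \<le> d \<and> ?sound ?R' \<and> ?complete (Suc k) ?R'"
      using R k by simp
  qed
  moreover have "result (reach_alg d A) = ?R"
    unfolding reach_alg_def result_bind result_new_array init body_def by simp
  ultimately show ?thesis using warshall_complete[OF _ A] ij by auto
qed

section \<open>Source components as sets of ancestors\<close>

definition ancestors :: "entry mat \<Rightarrow> nat \<Rightarrow> nat set" where
  "ancestors A r = {i. (i, r) \<in> (arcs_of A)\<^sup>*}"

definition source_vertex :: "entry mat \<Rightarrow> nat \<Rightarrow> bool" where
  "source_vertex A r \<longleftrightarrow> r < dim_row A \<and> (\<forall>i. (i, r) \<in> (arcs_of A)\<^sup>* \<longrightarrow> (r, i) \<in> (arcs_of A)\<^sup>*)"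

lemma rtrancl_arcs_lt:
  assumes "(i, j) \<in> (arcs_of A)\<^sup>*" shows "i < dim_row A \<longleftrightarrow> j < dim_row A"
  using assms by induction (auto simp: in_arcs_of)

text \<open>A source component contains all ancestors of its members. Conversely, the ancestors of a
  source vertex are mutually reachable and closed under predecessors. Subgraphs are thereby replaced
  by the relation \<open>(arcs_of A)\<^sup>*\<close>.\<close>

lemma source_sccs_eq: "source_sccs A = ancestors A ` {r. source_vertex A r}"
proof -
  let ?G = "with_proj (state_digraph A)"
  interpret wf_digraph ?G
    by unfold_locales (auto simp: state_digraph_def)
  let ?R = "(arcs_of A)\<^sup>*"
  have arcs_ends: "arcs_ends ?G = arcs_of A"
    by (simp add: arcs_of_def)
  have verts: "verts ?G = {..<dim_row A}" by (simp add: state_digraph_def)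
  have reach: "u \<rightarrow>\<^sup>*\<^bsub>?G\<^esub> v \<longleftrightarrow> u < dim_row A \<and> (u, v) \<in> ?R" for u v
  proof
    assume uv: "u \<rightarrow>\<^sup>*\<^bsub>?G\<^esub> v"
    then have "u \<in> verts ?G" by (rule reachable_in_vertsE)
    moreover have "(u, v) \<in> ?R"
      using uv unfolding reachable_def arcs_ends by (rule rtrancl_on_rtranclI)
    ultimately show "u < dim_row A \<and> (u, v) \<in> ?R" unfolding verts by simp
  next
    assume uv: "u < dim_row A \<and> (u, v) \<in> ?R"
    then have "(u, v) \<in> ?R" "u < dim_row A" by auto
    then show "u \<rightarrow>\<^sup>*\<^bsub>?G\<^esub> v"
    proof induction
      case base
      then show ?case using verts by (intro reachable_refl) simp
    next
      case (step y z)
      have "u \<rightarrow>\<^sup>*\<^bsub>?G\<^esub> y" using step by blast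
      moreover have "y \<rightarrow>\<^bsub>?G\<^esub> z" using step arcs_ends by simp
      ultimately show ?case by (rule reachable_adj_trans)
    qed
  qed
  have sv: "S \<in> sccs_verts \<longleftrightarrow> S \<noteq> {} \<and> (\<forall>u\<in>S. \<forall>v\<in>S. u \<rightarrow>\<^sup>*\<^bsub>?G\<^esub> v) \<and>
      (\<forall>u\<in>S. \<forall>v. v \<notin> S \<longrightarrow> \<not> u \<rightarrow>\<^sup>*\<^bsub>?G\<^esub> v \<or> \<not> v \<rightarrow>\<^sup>*\<^bsub>?G\<^esub> u)" for S
    by (rule in_sccs_verts_conv_reachable)
  \<comment> \<open>A component is determined by its vertex set, so no other subgraph can witness
    the membership.\<close>
  have in_src: "verts S \<in> source_sccs A \<longleftrightarrow> \<not> (\<exists>S'\<in>sccs. S' \<noteq> S \<and> (\<exists>e\<in>arcs_of A. fst e \<in> verts S' \<and> snd e \<in> verts S))"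
    if "S \<in> sccs" for S
    using that inj_on_verts_sccs unfolding source_sccs_def arcs_of_def inj_on_def by blast
  show ?thesis
  proof (intro equalityI subsetI)
    fix X assume "X \<in> source_sccs A"
    then obtain S where S: "X = verts S" "S \<in> sccs" unfolding source_sccs_def by blast
    have src: "\<not> (\<exists>S'\<in>sccs. S' \<noteq> S \<and> (\<exists>e\<in>arcs_of A. fst e \<in> verts S' \<and> snd e \<in> verts S))"
      using in_src[OF S(2)] \<open>X \<in> source_sccs A\<close> S(1) by blast
    have X: "X \<in> sccs_verts" unfolding sccs_verts_conv using S by blast
    note X' = X[unfolded sv reach]
    have ne: "X \<noteq> {}" using X' by (elim conjE)
    have mut: "u < dim_row A \<and> (u, v) \<in> ?R" if "u \<in> X" "v \<in> X" for u v
      using conjunct1[OF conjunct2[OF X']] that by blast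
    have max: "v \<in> X" if "u \<in> X" "(u, v) \<in> ?R" "(v, u) \<in> ?R" for u v
    proof -
      have "u < dim_row A" using mut that(1) by blast
      then have "v < dim_row A" using rtrancl_arcs_lt[OF that(2)] by simp
      then show ?thesis using conjunct2[OF conjunct2[OF X']] that \<open>u < dim_row A\<close> by blast
    qed
    obtain r where r: "r \<in> X" using ne by blast
    have up: "i \<in> X" if "(i, r) \<in> ?R" for i
      using that
    proof (induction rule: converse_rtrancl_induct)
      case base
      show ?case by (rule r)
    next
      case (step i l)
      show ?case
      proof (rule ccontr)
        assume "i \<notin> X"
        \<comment> \<open>The component of the predecessor \<open>i\<close>; its arc into
          \<open>X\<close> contradicts that \<open>X\<close> is a source.\<close>
        define Y where "Y = {x. x < dim_row A \<and> (i, x) \<in> ?R \<and> (x, i) \<in> ?R}"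
        have "i < dim_row A" using step.hyps(1) by (simp add: in_arcs_of)
        then have "i \<in> Y" by (simp add: Y_def)
        then have "Y \<in> sccs_verts"
          unfolding sv reach Y_def using rtrancl_arcs_lt by (auto intro: rtrancl_trans)
        then obtain S' where S': "S' \<in> sccs" "Y = verts S'" unfolding sccs_verts_conv by blast
        have "S' \<noteq> S" using \<open>i \<in> Y\<close> \<open>i \<notin> X\<close> S(1) S'(2) by blast
        then show False using src S' S(1) \<open>i \<in> Y\<close> step by force
      qed
    qed
    have "X = ancestors A r"
      using up mut r unfolding ancestors_def by blast
    moreover have "source_vertex A r"
      using up mut r unfolding source_vertex_def by blast
    ultimately show "X \<in> ancestors A ` {r. source_vertex A r}" by blast
  next
    fix X assume "X \<in> ancestors A ` {r. source_vertex A r}"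
    then obtain r where X: "X = ancestors A r" and r: "source_vertex A r" by blast
    have mutual: "(u, v) \<in> ?R" if "u \<in> X" "v \<in> X" for u v
      using that r unfolding X ancestors_def source_vertex_def by (auto intro: rtrancl_trans)
    have down: "u \<in> X" if "(u, v) \<in> ?R" "v \<in> X" for u v
      using that unfolding X ancestors_def by (auto intro: rtrancl_trans)
    have lt: "u < dim_row A" if "u \<in> X" for u
      using that r rtrancl_arcs_lt unfolding X ancestors_def source_vertex_def by blast
    have "r \<in> X" by (simp add: X ancestors_def)
    then have Xv: "X \<in> sccs_verts" unfolding sv reach using mutual lt down by blast
    then obtain S where S: "S \<in> sccs" "X = verts S" unfolding sccs_verts_conv by blast
    have "\<not> (\<exists>S'\<in>sccs. S' \<noteq> S \<and> (\<exists>e\<in>arcs_of A. fst e \<in> verts S' \<and> snd e \<in> verts S))"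
    proof
      assume "\<exists>S'\<in>sccs. S' \<noteq> S \<and> (\<exists>e\<in>arcs_of A. fst e \<in> verts S' \<and> snd e \<in> verts S)"
      then obtain S' u v where S': "S' \<in> sccs" "S' \<noteq> S" "(u, v) \<in> arcs_of A" "u \<in> verts S'" "v \<in> verts S" by force
      then have "u \<in> X" using down S(2) by blast
      moreover have "verts S' \<in> sccs_verts" unfolding sccs_verts_conv using S'(1) by blast
      ultimately have "verts S' = X" using sccs_verts_disjoint[OF _ Xv] S'(4) by blast
      then show False using inj_onD[OF inj_on_verts_sccs _ S'(1) S(1)] S'(2) S(2) by blast
    qed
    then show "X \<in> source_sccs A" using in_src[OF S(1)] S(2) by blast
  qed
qed

lemma source_sccs_disjoint:
  assumes "S \<in> source_sccs A" "S' \<in> source_sccs A" "i \<in> S" "i \<in> S'"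
  shows "S = S'"
proof -
  obtain r r' where r: "S = ancestors A r" "source_vertex A r" "S' = ancestors A r'" "source_vertex A r'"
    using assms(1,2) unfolding source_sccs_eq by blast
  then have "(r, r') \<in> (arcs_of A)\<^sup>*" "(r', r) \<in> (arcs_of A)\<^sup>*"
    using assms(3,4) unfolding ancestors_def source_vertex_def by (auto intro: rtrancl_trans)
  then show ?thesis unfolding r ancestors_def by (auto intro: rtrancl_trans)
qed

lemma source_scc_props:
  assumes "S \<in> source_sccs A"
  shows "S \<noteq> {}" "S \<subseteq> {..<dim_row A}" "\<And>i j. i \<in> S \<Longrightarrow> (j, i) \<in> arcs_of A \<Longrightarrow> j \<in> S"
    "\<And>i j. i \<in> S \<Longrightarrow> j \<in> S \<Longrightarrow> (i, j) \<in> (arcs_of A)\<^sup>*"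
proof -
  obtain r where r: "S = ancestors A r" "source_vertex A r" using assms unfolding source_sccs_eq by blast
  show "S \<noteq> {}" unfolding r ancestors_def by blast
  show "S \<subseteq> {..<dim_row A}"
    using r(2) rtrancl_arcs_lt unfolding r(1) ancestors_def source_vertex_def by blast
  show "j \<in> S" if "i \<in> S" "(j, i) \<in> arcs_of A" for i j
    using that unfolding r ancestors_def by (auto intro: converse_rtrancl_into_rtrancl)
  show "(i, j) \<in> (arcs_of A)\<^sup>*" if "i \<in> S" "j \<in> S" for i j
    using that r(2) unfolding r(1) ancestors_def source_vertex_def by (auto intro: rtrancl_trans)
qed

text \<open>Among the ancestors of \<open>i\<close>, one with the fewest ancestors is a source
  vertex: the ancestors of any \<open>j\<close> above it form a subset, which equals the whole set
  by minimality.\<close>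

lemma reachable_from_source:
  assumes "i < dim_row A"
  shows "\<exists>S\<in>source_sccs A. \<forall>j\<in>S. (j, i) \<in> (arcs_of A)\<^sup>*"
proof -
  let ?up = "\<lambda>r. {j. (j, r) \<in> (arcs_of A)\<^sup>*}"
  obtain r where r: "(r, i) \<in> (arcs_of A)\<^sup>*"
    and least: "\<And>j. (j, i) \<in> (arcs_of A)\<^sup>* \<Longrightarrow> card (?up r) \<le> card (?up j)"
    using ex_has_least_nat[of "\<lambda>r. (r, i) \<in> (arcs_of A)\<^sup>*" i "\<lambda>r. card (?up r)"] by blast
  have "r < dim_row A" using rtrancl_arcs_lt[OF r] assms by simp
  moreover have "(r, j) \<in> (arcs_of A)\<^sup>*" if j: "(j, r) \<in> (arcs_of A)\<^sup>*" for j
  proof -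
    have "?up r \<subseteq> {..<dim_row A}" using \<open>r < dim_row A\<close> rtrancl_arcs_lt by blast
    then have "finite (?up r)" using finite_subset by blast
    moreover have "?up j \<subseteq> ?up r" using j by (auto intro: rtrancl_trans)
    moreover have "card (?up r) \<le> card (?up j)" using least j r by (blast intro: rtrancl_trans)
    ultimately have "?up j = ?up r" by (rule card_seteq)
    then show ?thesis by blast
  qed
  ultimately have "source_vertex A r" by (simp add: source_vertex_def)
  then have "ancestors A r \<in> source_sccs A" unfolding source_sccs_eq by blast
  moreover have "\<forall>j\<in>ancestors A r. (j, i) \<in> (arcs_of A)\<^sup>*"
    using r unfolding ancestors_def by (auto intro: rtrancl_trans)
  ultimately show ?thesis by (rule rev_bexI)
qed


section \<open>Component selection\<close>

lemma result_if: "result (if P then p else q) = (if P then result p else result q)"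
  by simp

lemma result_heads:
  assumes r: "r < d"
  shows "result (heads_alg d R) r \<longleftrightarrow> (\<forall>i<d. \<not> (R (i, r) \<and> (\<not> R (r, i) \<or> i < r)))"
proof -
  let ?bad = "\<lambda>r i. R (i, r) \<and> (\<not> R (r, i) \<or> i < r)"
  let ?f = "\<lambda>r i hds. do {
       ir \<leftarrow> op (R (i, r));
       ri \<leftarrow> op (R (r, i));
       nri \<leftarrow> op (\<not> ri);
       lt \<leftarrow> op (i < r);
       bad \<leftarrow> op (nri \<or> lt);
       b \<leftarrow> op (ir \<and> bad);
       if b then op (hds(r := False)) else return hds }"
  have inner: "result (loop n (?f r) h) = h(r := h r \<and> (\<forall>i<n. \<not> ?bad r i))" for n r h
    by (rule loop_invariant[where I = "\<lambda>n h'. h' = h(r := h r \<and> (\<forall>i<n. \<not> ?bad r i))"])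
      (auto simp: fun_eq_iff less_Suc_eq)
  have "result (heads_alg d R) = (\<lambda>r. r < d \<longrightarrow> (\<forall>i<d. \<not> ?bad r i))"
    unfolding heads_alg_def result_bind result_new_array
    by (rule loop_invariant[where I = "\<lambda>n h. h = (\<lambda>r. r < n \<longrightarrow> (\<forall>i<d. \<not> ?bad r i))"])
      (auto simp: inner fun_eq_iff less_Suc_eq)
  then show ?thesis using r by simp
qed

text \<open>The least vertex as canonical representative: heads and source components correspond one
  to one, so each component is processed once.\<close>

definition scc_head :: "entry mat \<Rightarrow> nat \<Rightarrow> bool" where
  "scc_head A r \<longleftrightarrow> source_vertex A r \<and> (\<forall>i\<in>ancestors A r. r \<le> i)"

lemma head_Min:
  assumes "S \<in> source_sccs A"
  shows "scc_head A (Min S)" "ancestors A (Min S) = S"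
proof -
  have fin: "finite S" using source_scc_props(2)[OF assms] finite_subset by blast
  then have m: "Min S \<in> S" using source_scc_props(1)[OF assms] by simp
  obtain r where r: "S = ancestors A r" "source_vertex A r" using assms unfolding source_sccs_eq by blast
  then have mr: "(Min S, r) \<in> (arcs_of A)\<^sup>*" "(r, Min S) \<in> (arcs_of A)\<^sup>*"
    using m unfolding ancestors_def source_vertex_def by blast+
  show S: "ancestors A (Min S) = S"
    using mr unfolding r(1) ancestors_def by (auto intro: rtrancl_trans)
  have "source_vertex A (Min S)"
    unfolding source_vertex_def
  proof (intro conjI allI impI)
    show "Min S < dim_row A" using m source_scc_props(2)[OF assms] by blast
    fix i assume "(i, Min S) \<in> (arcs_of A)\<^sup>*"
    then have "i \<in> S" using S unfolding ancestors_def by blast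
    then show "(Min S, i) \<in> (arcs_of A)\<^sup>*" using source_scc_props(4)[OF assms m] by blast
  qed
  then show "scc_head A (Min S)" unfolding scc_head_def S using fin by simp
qed

lemma head_source_scc:
  assumes "scc_head A r"
  shows "ancestors A r \<in> source_sccs A" "Min (ancestors A r) = r"
proof -
  show S: "ancestors A r \<in> source_sccs A" using assms unfolding source_sccs_eq scc_head_def by blast
  have "finite (ancestors A r)" using source_scc_props(2)[OF S] finite_subset by blast
  moreover have "r \<in> ancestors A r" by (simp add: ancestors_def)
  ultimately show "Min (ancestors A r) = r" using assms unfolding scc_head_def by (intro Min_eqI) auto
qed

lemma result_cheapest_input:
  "(0 < m \<longrightarrow> result (cheapest_input_alg m W i) < m) \<and>
    (\<forall>k<m. W (i, result (cheapest_input_alg m W i)) \<le> (W (i, k) :: real))"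
proof -
  have "(m = 0 \<and> result (cheapest_input_alg m W i) = 0 \<or> result (cheapest_input_alg m W i) < m) \<and>
    (\<forall>k<m. W (i, result (cheapest_input_alg m W i)) \<le> W (i, k))"
    unfolding cheapest_input_alg_def
    by (rule loop_invariant[where I = "\<lambda>n b. (n = 0 \<and> b = 0 \<or> b < n) \<and> (\<forall>k<n. W (i, b) \<le> W (i, k))"])
      (auto simp: less_Suc_eq not_less result_if intro: order_trans less_imp_le split: if_splits)
  then show ?thesis by auto
qed

definition selection_array :: "nat \<Rightarrow> nat \<Rightarrow> entry mat \<Rightarrow> (nat \<Rightarrow> nat \<Rightarrow> real) \<Rightarrow> nat \<times> nat \<Rightarrow> real" where
  "selection_array d m B w = result (cost_array_alg d m B w (result (max_cost_alg d m B w) + 1))"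

text \<open>The replacement value exceeds the cost of every star and so acts as infinity: a cell not
  more expensive than a star is a star itself.\<close>

lemma ext_cost_mono:
  assumes W: "selection_array d m B w (i, k) \<le> selection_array d m B w (i', k')"
    and lt: "i < d" "i' < d" "k < m" "k' < m"
  shows "ext_cost B w i k \<le> ext_cost B w i' k'"
proof (cases "B $$ (i', k') = Star")
  case True
  then have "w i' k' \<le> result (max_cost_alg d m B w)" using result_max_cost lt by blast
  then have "B $$ (i, k) = Star" using W True lt by (auto simp: selection_array_def result_cost_array split: if_splits)
  then show ?thesis using W True lt by (simp add: selection_array_def result_cost_array ext_cost_def)
qed (simp add: ext_cost_def)

lemma result_same_scc [simp]: "result (same_scc_alg R i j) \<longleftrightarrow> R (i, j) \<and> R (j, i)"
  by (simp add: same_scc_alg_def)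

context
  fixes d m :: nat and A B :: "entry mat" and R hds
  assumes A: "A \<in> carrier_mat d d" and B: "B \<in> carrier_mat d m"
    and R: "R = result (reach_alg d A)" and hds: "hds = result (heads_alg d R)"
begin

lemma R_iff: "i < d \<Longrightarrow> j < d \<Longrightarrow> R (i, j) \<longleftrightarrow> (i, j) \<in> (arcs_of A)\<^sup>*"
  unfolding R by (rule result_reach[OF A])

lemma ancestors_lt: "r < d \<Longrightarrow> i \<in> ancestors A r \<Longrightarrow> i < d"
  using rtrancl_arcs_lt A unfolding ancestors_def by fastforce

lemma hds_iff: "r < d \<Longrightarrow> hds r \<longleftrightarrow> scc_head A r"
proof -
  assume r: "r < d"
  have "hds r \<longleftrightarrow> (\<forall>i<d. \<not> ((i, r) \<in> (arcs_of A)\<^sup>* \<and> ((r, i) \<notin> (arcs_of A)\<^sup>* \<or> i < r)))"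
    unfolding hds result_heads[OF r] using R_iff r by auto
  also have "\<dots> \<longleftrightarrow> scc_head A r"
    using r A ancestors_lt[OF r] unfolding scc_head_def source_vertex_def ancestors_def by (auto simp: not_less)
  finally show ?thesis .
qed

lemma same_scc_iff:
  assumes "scc_head A r" "i < d"
  shows "R (r, i) \<and> R (i, r) \<longleftrightarrow> i \<in> ancestors A r"
proof -
  have "r < d" using assms(1) A unfolding scc_head_def source_vertex_def by simp
  then show ?thesis
    using assms R_iff unfolding scc_head_def source_vertex_def ancestors_def by auto
qed

lemma head_lt: "scc_head A r \<Longrightarrow> r < d"
  using A unfolding scc_head_def source_vertex_def by simp

text \<open>The hypothesis on \<open>m\<close> makes the result of \<open>cheapest_input_alg\<close>
  a valid column; its start value 0 is one only if there is an input.\<close>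

lemma sscc_selection_alg_correct:
  assumes m: "source_sccs A \<noteq> {} \<Longrightarrow> 0 < m"
  shows "sscc_selection_output A B w (mat d m (result (sscc_selection_alg d m R hds B w)))"
proof -
  let ?W = "selection_array d m B w"
  define ch where "ch i = result (cheapest_input_alg m ?W i)" for i
  define step where "step r i = (\<lambda>(l, k). do {
           b \<leftarrow> same_scc_alg R r i;
           if b then do {
             k' \<leftarrow> cheapest_input_alg m ?W i;
             x \<leftarrow> op (?W (i, k'));
             y \<leftarrow> op (?W (l, k));
             c \<leftarrow> op (x < y);
             if c then return (i, k') else return (l, k) }
           else return (l, k) })" for r i
  define inner where "inner r = loop d (step r) (r, ch r)" for r
  define l where "l r = fst (result (inner r))" for r
  let ?best = "\<lambda>r n s. \<exists>l. s = (l, ch l) \<and> l \<in> ancestors A r \<and>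
      (\<forall>i<n. i \<in> ancestors A r \<longrightarrow> ?W (l, ch l) \<le> ?W (i, ch i))"
  have l: "result (inner r) = (l r, ch (l r)) \<and> l r \<in> ancestors A r \<and>
      (\<forall>i\<in>ancestors A r. ?W (l r, ch (l r)) \<le> ?W (i, ch i))" if r: "scc_head A r" for r
  proof -
    have "d \<le> d \<and> ?best r d (result (inner r))"
      unfolding inner_def
    proof (rule loop_invariant[where I = "\<lambda>n s. n \<le> d \<and> ?best r n s"])
      show "0 \<le> d \<and> ?best r 0 (r, ch r)" by (auto simp: ancestors_def)
    next
      fix i s assume i: "i < d" and "i \<le> d \<and> ?best r i s"
      then obtain l where s: "s = (l, ch l)" and l: "l \<in> ancestors A r"
        and le: "\<And>i'. i' < i \<Longrightarrow> i' \<in> ancestors A r \<Longrightarrow> ?W (l, ch l) \<le> ?W (i', ch i')" by blast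
      define s' where "s' = (if i \<in> ancestors A r \<and> ?W (i, ch i) < ?W (l, ch l) then (i, ch i) else (l, ch l))"
      have "Suc i \<le> d \<and> ?best r (Suc i) s'"
      proof (cases "i \<in> ancestors A r \<and> ?W (i, ch i) < ?W (l, ch l)")
        case True
        then have "?W (i, ch i) \<le> ?W (i', ch i')" if "i' < Suc i" "i' \<in> ancestors A r" for i'
          using le[of i'] that by (cases "i' = i") auto
        then show ?thesis using True i by (auto simp: s'_def)
      next
        case False
        then have "?W (l, ch l) \<le> ?W (i', ch i')" if "i' < Suc i" "i' \<in> ancestors A r" for i'
          using le[of i'] that by (cases "i' = i") auto
        moreover have "s' = (l, ch l)" using False by (simp only: s'_def if_False)
        ultimately show ?thesis using i l by auto
      qed
      moreover have "result (step r i s) = s'"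
        using same_scc_iff[OF r i] by (simp add: s s'_def step_def result_if flip: ch_def)
      ultimately show "Suc i \<le> d \<and> ?best r (Suc i) (result (step r i s))" by (simp only:)
    qed
    then obtain l' where l': "result (inner r) = (l', ch l')" "l' \<in> ancestors A r"
      "\<And>i. i < d \<Longrightarrow> i \<in> ancestors A r \<Longrightarrow> ?W (l', ch l') \<le> ?W (i, ch i)" by blast
    moreover have "l r = l'" using l'(1) by (simp add: l_def)
    ultimately show ?thesis using ancestors_lt[OF head_lt[OF r]] by blast
  qed
  have X: "result (sscc_selection_alg d m R hds B w) =
      (\<lambda>x. if \<exists>r<d. hds r \<and> x = (l r, ch (l r)) then Star else Zero)"
  proof -
    let ?g = "\<lambda>r X. do {
       h \<leftarrow> op (hds r);
       if h then do {
         k0 \<leftarrow> cheapest_input_alg m ?W r;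
         (l, k) \<leftarrow> loop d (step r) (r, k0);
         op (X((l, k) := Star)) }
       else return X }"
    have g: "result (?g r X) = (if hds r then X((l r, ch (l r)) := Star) else X)" if "r < d" for r X
    proof (cases "hds r")
      case True
      then have "result (inner r) = (l r, ch (l r))" using l hds_iff that by blast
      then show ?thesis using True by (simp flip: ch_def inner_def)
    qed simp
    have "d \<le> d \<and> result (loop d ?g (\<lambda>_. Zero)) = (\<lambda>x. if \<exists>r<d. hds r \<and> x = (l r, ch (l r)) then Star else Zero)"
    proof (rule loop_invariant[where I = "\<lambda>n X. n \<le> d \<and> X = (\<lambda>x. if \<exists>r<n. hds r \<and> x = (l r, ch (l r)) then Star else Zero)"])
      fix n X assume n: "n < d" and X: "n \<le> d \<and> X = (\<lambda>x. if \<exists>r<n. hds r \<and> x = (l r, ch (l r)) then Star else Zero)"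
      show "Suc n \<le> d \<and> result (?g n X) = (\<lambda>x. if \<exists>r<Suc n. hds r \<and> x = (l r, ch (l r)) then Star else Zero)"
        unfolding g[OF n] using n X by (auto simp: fun_eq_iff less_Suc_eq)
    qed simp
    then show ?thesis
      unfolding sscc_selection_alg_def step_def[abs_def] result_bind result_op result_new_array selection_array_def[symmetric] by blast
  qed
  have ch: "ch i < m" "\<forall>k<m. ?W (i, ch i) \<le> ?W (i, k)" if "0 < m" for i
    using result_cheapest_input[of m ?W i] that unfolding ch_def by blast+
  \<comment> \<open>The program selects per head, the specification per component; the head of a
    component is its minimum.\<close>
  define sel where "sel S = l (Min S)" for S
  have dims: "dim_row B = d" "dim_col B = m" using B by auto
  have sel: "sel S \<in> S" "\<forall>i\<in>S. ?W (sel S, ch (sel S)) \<le> ?W (i, ch i)" if S: "S \<in> source_sccs A" for S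
    using l[OF head_Min(1)[OF S]] unfolding head_Min(2)[OF S] sel_def by blast+
  show ?thesis
    unfolding sscc_selection_output_def dims
  proof (intro exI[of _ ch] exI[of _ sel] conjI ballI allI impI)
    fix S assume S: "S \<in> source_sccs A"
    then have m: "0 < m" using m by blast
    have S_lt: "i < d" if "i \<in> S" for i using that source_scc_props(2)[OF S] A by auto
    show "sel S \<in> S" by (rule sel(1)[OF S])
    fix i assume i: "i \<in> S"
    show "ch i < m" by (rule ch(1)[OF m])
    show "ext_cost B w (sel S) (ch (sel S)) \<le> ext_cost B w i (ch i)"
      using sel[OF S] S_lt i ch(1)[OF m] by (intro ext_cost_mono) auto
    fix k assume "k < m"
    then show "ext_cost B w i (ch i) \<le> ext_cost B w i k"
      using ch[OF m] S_lt[OF i] by (intro ext_cost_mono) auto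
  next
    have "(\<exists>r<d. hds r \<and> (i, k) = (l r, ch (l r))) \<longleftrightarrow> (k, i) \<in> {(ch (sel S), sel S) |S. S \<in> source_sccs A}" for i k
    proof
      assume "\<exists>r<d. hds r \<and> (i, k) = (l r, ch (l r))"
      then obtain r where r: "scc_head A r" "i = l r" "k = ch (l r)" using hds_iff by auto
      then have "sel (ancestors A r) = l r" using head_source_scc[OF r(1)] by (simp add: sel_def)
      then show "(k, i) \<in> {(ch (sel S), sel S) |S. S \<in> source_sccs A}"
        using r head_source_scc(1)[OF r(1)] by force
    next
      assume "(k, i) \<in> {(ch (sel S), sel S) |S. S \<in> source_sccs A}"
      then obtain S where S: "S \<in> source_sccs A" "k = ch (sel S)" "i = sel S" by blast
      have "Min S < d" "hds (Min S)" using head_Min(1)[OF S(1)] head_lt hds_iff by blast+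
      then show "\<exists>r<d. hds r \<and> (i, k) = (l r, ch (l r))" using S(2,3) unfolding sel_def by blast
    qed
    then show "let L = {(ch (sel S), sel S) |S. S \<in> source_sccs A}
      in mat d m (result (sscc_selection_alg d m R hds B w)) = mat d m (\<lambda>(l, k). if (k, l) \<in> L then Star else Zero)"
      unfolding X Let_def by (intro eq_matI) auto
  qed
qed

end

lemma result_clear_row:
  "result (loop m (\<lambda>k X. op (X((l, k) := z))) X) = (\<lambda>(l', k). if l' = l \<and> k < m then z else X (l', k))"
  by (rule loop_invariant[where I = "\<lambda>n X'. X' = (\<lambda>(l', k). if l' = l \<and> k < n then z else X (l', k))"])
    (auto simp: fun_eq_iff less_Suc_eq)

text \<open>Whether a component is hit depends on \<open>Bt\<close>, which stays unchanged, so the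
  clearing steps of different heads do not interfere.\<close>

lemma result_clear_hit:
  "result (clear_hit_alg d m R hds Bt X) =
    (\<lambda>(l, k). if l < d \<and> k < m \<and> (\<exists>r<d. hds r \<and> (R (r, l) \<and> R (l, r)) \<and>
        (\<exists>l'<d. (R (r, l') \<and> R (l', r)) \<and> (\<exists>k'<m. Bt (l', k') = Star))) then Zero else X (l, k))"
proof -
  let ?same = "\<lambda>r l. R (r, l) \<and> R (l, r)"
  let ?hit = "\<lambda>r. \<exists>l<d. ?same r l \<and> (\<exists>k<m. Bt (l, k) = Star)"
  let ?hits = "\<lambda>r l hit. do {
           b \<leftarrow> same_scc_alg R r l;
           if b then loop m (\<lambda>k hit. do {
             e \<leftarrow> op (Bt (l, k));
             star \<leftarrow> op (e = Star);
             op (hit \<or> star) }) hit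
           else return hit }"
  let ?clear = "\<lambda>r l X. do {
           b \<leftarrow> same_scc_alg R r l;
           if b then loop m (\<lambda>k X. op (X((l, k) := Zero))) X
           else return X }"
  have star: "result (loop n (\<lambda>k hit. do {
             e \<leftarrow> op (Bt (l, k));
             star \<leftarrow> op (e = Star);
             op (hit \<or> star) }) h) \<longleftrightarrow> h \<or> (\<exists>k<n. Bt (l, k) = Star)" for n l h
    by (induction n) (auto simp: less_Suc_eq)
  have hit: "result (loop n (?hits r) False) \<longleftrightarrow> (\<exists>l<n. ?same r l \<and> (\<exists>k<m. Bt (l, k) = Star))" for n r
    by (induction n) (auto simp: less_Suc_eq star)
  have clear: "result (loop n (?clear r) X) = (\<lambda>(l, k). if l < n \<and> k < m \<and> ?same r l then Zero else X (l, k))" for n r X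
    by (rule loop_invariant[where I = "\<lambda>n X'. X' = (\<lambda>(l, k). if l < n \<and> k < m \<and> ?same r l then Zero else X (l, k))"])
      (auto simp: fun_eq_iff less_Suc_eq result_clear_row)
  let ?g = "\<lambda>r X. do {
       h \<leftarrow> op (hds r);
       if h then do {
         hit \<leftarrow> loop d (?hits r) False;
         if hit then loop d (?clear r) X
         else return X }
       else return X }"
  have g: "result (?g r X) = (\<lambda>(l, k). if l < d \<and> k < m \<and> hds r \<and> ?same r l \<and> ?hit r then Zero else X (l, k))" for r X
    unfolding result_bind result_op result_if hit clear by (auto simp: fun_eq_iff)
  show ?thesis
    unfolding clear_hit_alg_def
  proof (rule loop_invariant[where I = "\<lambda>n X'. X' =
        (\<lambda>(l, k). if l < d \<and> k < m \<and> (\<exists>r<n. hds r \<and> ?same r l \<and> ?hit r) then Zero else X (l, k))"])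
    fix n X' assume X': "X' = (\<lambda>(l, k). if l < d \<and> k < m \<and> (\<exists>r<n. hds r \<and> ?same r l \<and> ?hit r) then Zero else X (l, k))"
    show "result (?g n X') = (\<lambda>(l, k). if l < d \<and> k < m \<and> (\<exists>r<Suc n. hds r \<and> ?same r l \<and> ?hit r) then Zero else X (l, k))"
      unfolding g X' by (auto simp: fun_eq_iff less_Suc_eq)
  qed (simp add: fun_eq_iff)
qed

lemma result_join:
  "result (join_alg d m Bt X) = (\<lambda>(l, k). if l < d \<and> k < m \<and> Bt (l, k) = Star then Star else X (l, k))"
proof -
  have "result (join_alg d m Bt X) =
      (\<lambda>(l, k). if l < d \<and> 0 \<le> k \<and> k < 0 + m \<and> Bt (l, k - 0) = Star then Star else X (l, k))"
    unfolding join_alg_def by (rule result_fill) simp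
  then show ?thesis by (simp add: fun_eq_iff)
qed


section \<open>The combined algorithm\<close>

text \<open>A source component is closed under predecessors; without a star in its rows no input
  could influence it.\<close>

lemma source_scc_star:
  assumes "struct_controllable A X" "A \<in> carrier_mat d d" "X \<in> carrier_mat d m" "S \<in> source_sccs A"
  shows "\<exists>i\<in>S. \<exists>k<m. X $$ (i, k) = Star"
  using struct_controllable_closed_set[OF assms(1-3), of S] source_scc_props[OF assms(4)] assms(2) by auto

lemma combined_alg_correct:
  assumes A: "A \<in> carrier_mat d d" and B: "B \<in> carrier_mat d m" and sc: "struct_controllable A B"
    and w: "\<And>i k. i < d \<Longrightarrow> k < m \<Longrightarrow> B $$ (i, k) = Star \<Longrightarrow> 0 \<le> w i k"
  shows "combined_output A B w (result (combined_alg d m A B w))"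
proof -
  define R where "R = result (reach_alg d A)"
  define hds where "hds = result (heads_alg d R)"
  define X where "X = result (sscc_selection_alg d m R hds B w)"
  define Y where "Y = result (matching_alg d m A B w)"
  note same = same_scc_iff[OF A B R_def hds_def] and hds_head = hds_iff[OF A B R_def hds_def]
  have "0 < m" if "source_sccs A \<noteq> {}"
    using that source_scc_star[OF sc A B] by fastforce
  then have sel: "sscc_selection_output A B w (mat d m X)"
    unfolding X_def by (rule sscc_selection_alg_correct[OF A B R_def hds_def])
  obtain f where f: "inj_on f {..<d}" "\<And>i. i < d \<Longrightarrow> (f i, i) \<in> state_edges A \<union> input_edges B"
    using struct_controllable_matching[OF sc A B] by blast
  have mat: "matching_output A B w (mat d m Y)"
    unfolding Y_def by (rule matching_alg_correct[OF A B w f])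
  let ?hit = "\<lambda>l. \<exists>r<d. hds r \<and> (R (r, l) \<and> R (l, r)) \<and> (\<exists>l'<d. (R (r, l') \<and> R (l', r)) \<and> (\<exists>k'<m. Y (l', k') = Star))"
  have hit: "?hit l
      \<longleftrightarrow> l \<in> \<Union> (hit_sccs A (mat d m Y))" if l: "l < d" for l
  proof
    assume "?hit l"
    then obtain r l' k' where r: "r < d" "hds r" "R (r, l) \<and> R (l, r)" "l' < d" "R (r, l') \<and> R (l', r)" "k' < m" "Y (l', k') = Star"
      by blast
    then have h: "scc_head A r" using hds_head by blast
    then have "l \<in> ancestors A r" "l' \<in> ancestors A r" using same r l by blast+
    then show "l \<in> \<Union> (hit_sccs A (mat d m Y))"
      using head_source_scc(1)[OF h] r unfolding hit_sccs_def by force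
  next
    assume "l \<in> \<Union> (hit_sccs A (mat d m Y))"
    then obtain S l' k' where S: "S \<in> source_sccs A" "l \<in> S" "l' \<in> S" "k' < m" "mat d m Y $$ (l', k') = Star"
      unfolding hit_sccs_def by auto
    then have l': "l' < d" using source_scc_props(2)[OF S(1)] A by auto
    note h = head_Min[OF S(1)]
    have "l \<in> ancestors A (Min S)" "l' \<in> ancestors A (Min S)" using S h by auto
    then have "R (Min S, l) \<and> R (l, Min S)" "R (Min S, l') \<and> R (l', Min S)"
      using same[OF h(1)] l l' by blast+
    moreover have "Min S < d" using head_lt[OF A B R_def hds_def h(1)] .
    moreover have "hds (Min S)" using hds_head \<open>Min S < d\<close> h(1) by blast
    moreover have "Y (l', k') = Star" using S l' by simp
    ultimately show "?hit l"
      using l' S(4) by blast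
  qed
  have "result (combined_alg d m A B w) = mat d m (result (join_alg d m Y (result (clear_hit_alg d m R hds Y X))))"
    by (simp add: combined_alg_def R_def hds_def X_def Y_def)
  also have "\<dots> = join (clear_rows (\<Union> (hit_sccs A (mat d m Y))) (mat d m X)) (mat d m Y)"
  proof (rule eq_matI)
    fix l k assume "l < dim_row (join (clear_rows (\<Union> (hit_sccs A (mat d m Y))) (mat d m X)) (mat d m Y))"
      "k < dim_col (join (clear_rows (\<Union> (hit_sccs A (mat d m Y))) (mat d m X)) (mat d m Y))"
    then have lk: "l < d" "k < m" by (simp_all add: join_def clear_rows_def)
    show "mat d m (result (join_alg d m Y (result (clear_hit_alg d m R hds Y X)))) $$ (l, k) =
        join (clear_rows (\<Union> (hit_sccs A (mat d m Y))) (mat d m X)) (mat d m Y) $$ (l, k)"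
      using lk hit[OF lk(1)]
      by (cases "X (l, k)"; cases "Y (l, k)"; simp only: result_join result_clear_hit join_def clear_rows_def index_mat dim_row_mat dim_col_mat prod.case)
        (simp_all only: simp_thms if_True if_False entry.distinct refl split: if_split)
  qed (simp_all add: join_def clear_rows_def)
  finally show ?thesis unfolding combined_output_def using sel mat by blast
qed

section \<open>Star positions and the comparison of costs\<close>

definition stars :: "entry mat \<Rightarrow> (nat \<times> nat) set" where
  "stars X = {(i, k). i < dim_row X \<and> k < dim_col X \<and> X $$ (i, k) = Star}"

lemma wnorm_stars: "wnorm w X = (\<Sum>(i, k)\<in>stars X. w i k)"
  by (simp add: wnorm_def stars_def)

lemma finite_stars: "finite (stars X)"
  by (rule finite_subset[of _ "{..<dim_row X} \<times> {..<dim_col X}"]) (auto simp: stars_def)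

lemma stars_mono:
  assumes "zeros B \<subseteq> zeros X" "X \<in> carrier_mat (dim_row B) (dim_col B)"
  shows "stars X \<subseteq> stars B"
proof
  fix x assume "x \<in> stars X"
  then have "x \<notin> zeros B" and x: "fst x < dim_row B" "snd x < dim_col B"
    using assms by (auto simp: stars_def zeros_def)
  then have "B $$ x \<noteq> Zero" by (cases x) (auto simp: zeros_def)
  then show "x \<in> stars B" using x by (cases x) (auto simp: stars_def)
qed

definition input_part :: "nat \<Rightarrow> (nat \<Rightarrow> left_vertex) \<Rightarrow> (nat \<times> nat) set" where
  "input_part d f = {(i, k). i < d \<and> f i = U k}"

text \<open>State edges are free and each row has one edge, so the sum over rows is a sum over
  distinct positions of the input matrix.\<close>

lemma sum_edge_cost: "(\<Sum>i<d. edge_cost w (f i, i)) = (\<Sum>(i, k)\<in>input_part d f. w i k)"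
proof -
  define I where "I = {i \<in> {..<d}. \<exists>k. f i = U k}"
  define g where "g i = (i, case f i of U k \<Rightarrow> k | V1 j \<Rightarrow> j)" for i
  have "(\<Sum>i<d. edge_cost w (f i, i)) = (\<Sum>i\<in>I. edge_cost w (f i, i))"
  proof (rule sum.mono_neutral_right)
    show "\<forall>i\<in>{..<d} - I. edge_cost w (f i, i) = 0"
    proof
      fix i assume "i \<in> {..<d} - I"
      then show "edge_cost w (f i, i) = 0" by (cases "f i") (auto simp: I_def)
    qed
  qed (auto simp: I_def)
  also have "\<dots> = (\<Sum>i\<in>I. case g i of (i, k) \<Rightarrow> w i k)"
    by (rule sum.cong) (auto simp: I_def g_def)
  also have "\<dots> = (\<Sum>(i, k)\<in>g ` I. w i k)"
    by (rule sum.reindex[symmetric, unfolded o_def]) (auto simp: g_def inj_on_def)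
  also have "g ` I = input_part d f" by (auto simp: g_def I_def input_part_def image_iff)
  finally show ?thesis .
qed

lemma input_part_stars:
  assumes "A \<in> carrier_mat d d" "X \<in> carrier_mat d m"
    and "\<And>i. i < d \<Longrightarrow> (f i, i) \<in> state_edges A \<union> input_edges X"
  shows "input_part d f \<subseteq> stars X"
proof
  fix x assume "x \<in> input_part d f"
  then obtain i k where x: "x = (i, k)" "i < d" "f i = U k" by (auto simp: input_part_def)
  then have "(U k, i) \<in> state_edges A \<union> input_edges X" using assms(3)[of i] by simp
  then show "x \<in> stars X"
    using assms(2) by (auto simp: x(1) stars_def state_edges_def input_edges_def)
qed

lemma finite_feasible: "finite (feasible A B)"
proof -
  let ?d = "dim_row B" and ?m = "dim_col B"
  let ?F = "\<lambda>P. mat ?d ?m (\<lambda>x. if x \<in> P then Star else Zero)"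
  have "feasible A B \<subseteq> ?F ` Pow ({..<?d} \<times> {..<?m})"
  proof
    fix X assume "X \<in> feasible A B"
    then have X: "X \<in> carrier_mat ?d ?m" by (simp add: feasible_def)
    have "X = ?F (stars X)"
      using X by (intro eq_matI) (auto simp: stars_def)
    moreover have "stars X \<in> Pow ({..<?d} \<times> {..<?m})" using X by (auto simp: stars_def)
    ultimately show "X \<in> ?F ` Pow ({..<?d} \<times> {..<?m})" by blast
  qed
  then show ?thesis by (rule finite_subset) simp
qed

lemma combined_output_bound:
  assumes A: "A \<in> carrier_mat d d" and B: "B \<in> carrier_mat d m" and sc: "struct_controllable A B"
    and w: "\<And>i k. (i, k) \<in> stars B \<Longrightarrow> 0 \<le> w i k"
    and out: "combined_output A B w Bs"
  shows "Bs \<in> feasible A B" "\<And>X. X \<in> feasible A B \<Longrightarrow> wnorm w Bs \<le> 2 * wnorm w X"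
proof -
  have dims: "dim_row B = d" "dim_col B = m" using B by auto
  obtain B' Bt where B': "sscc_selection_output A B w B'" and Bt: "matching_output A B w Bt"
    and Bs: "Bs = join (clear_rows (\<Union> (hit_sccs A Bt)) B') Bt"
    using out unfolding combined_output_def by blast
  obtain ch sel where
    ch: "\<And>S i. S \<in> source_sccs A \<Longrightarrow> i \<in> S \<Longrightarrow> ch i < m \<and> (\<forall>k<m. ext_cost B w i (ch i) \<le> ext_cost B w i k)"
    and sel: "\<And>S. S \<in> source_sccs A \<Longrightarrow> sel S \<in> S"
    and sel_le: "\<And>S i. S \<in> source_sccs A \<Longrightarrow> i \<in> S \<Longrightarrow> ext_cost B w (sel S) (ch (sel S)) \<le> ext_cost B w i (ch i)"
    and B'_eq: "B' = mat d m (\<lambda>(l, k). if (k, l) \<in> {(ch (sel S), sel S) |S. S \<in> source_sccs A} then Star else Zero)"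
    using B' unfolding sscc_selection_output_def Let_def dims by blast
  have cheapest: "ext_cost B w (sel S) (ch (sel S)) \<le> ext_cost B w i k" if "S \<in> source_sccs A" "i \<in> S" "k < m" for S i k
    using ch[OF that(1,2)] sel_le[OF that(1,2)] that(3) by (meson order_trans)
  have S_lt: "i < d" if "S \<in> source_sccs A" "i \<in> S" for S i
    using source_scc_props(2)[OF that(1)] that(2) A by auto
  define t where "t S = (sel S, ch (sel S))" for S
  \<comment> \<open>Structural controllability of \<open>(A, B)\<close> puts a star of
    \<open>B\<close> into the component; the cheapest entry then has finite cost and is a
    star.\<close>
  have t_star: "t S \<in> stars B" if S: "S \<in> source_sccs A" for S
  proof -
    obtain i k where "i \<in> S" "k < m" "B $$ (i, k) = Star" using source_scc_star[OF sc A B S] by blast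
    then have "ext_cost B w (sel S) (ch (sel S)) \<noteq> \<infinity>"
      using cheapest[OF S, of i k] by (cases "B $$ (sel S, ch (sel S))") (auto simp: ext_cost_def)
    then show ?thesis
      using ch[OF S sel[OF S]] S_lt[OF S sel[OF S]] by (cases "B $$ (sel S, ch (sel S))") (auto simp: t_def stars_def dims ext_cost_def)
  qed
  have stars_B': "stars B' = t ` source_sccs A"
    using t_star by (auto simp: stars_def B'_eq t_def image_iff dims split: if_splits)
  have t_inj: "inj_on t (source_sccs A)"
    using sel source_sccs_disjoint unfolding inj_on_def t_def by (metis prod.inject)
  obtain f0 where f0: "inj_on f0 {..<d}" "\<And>i. i < d \<Longrightarrow> (f0 i, i) \<in> state_edges A \<union> input_edges B"
    using struct_controllable_matching[OF sc A B] by blast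
  have E: "state_edges A \<union> input_edges B \<subseteq> UNIV \<times> {..<d}" using A B by (auto simp: state_edges_def input_edges_def)
  obtain M where M: "is_mcmm (state_edges A \<union> input_edges B) (edge_cost w) M"
    and Bt_eq: "Bt = mat d m (\<lambda>(l, k). if (U k, l) \<in> M \<inter> input_edges B then Star else Zero)"
    using Bt unfolding matching_output_def dims by blast
  have "is_maximum_matching (state_edges A \<union> input_edges B) M" using M unfolding is_mcmm_def by blast
  then obtain g where g: "inj_on g {..<d}" "\<And>i. i < d \<Longrightarrow> (g i, i) \<in> state_edges A \<union> input_edges B"
    and M_eq: "M = row_matching d g"
    using maximum_matching_rows[OF E f0] by blast
  have g_part: "input_part d g \<subseteq> stars B" by (rule input_part_stars[OF A B g(2)])
  have stars_Bt: "stars Bt = input_part d g"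
  proof -
    have "(l, k) \<in> stars Bt \<longleftrightarrow> (l, k) \<in> input_part d g" for l k
    proof -
      have "(U k, l) \<in> M \<longleftrightarrow> l < d \<and> g l = U k" by (auto simp: M_eq row_matching_def image_iff)
      moreover have "(U k, l) \<in> input_edges B \<and> k < m" if "l < d" "g l = U k"
        using g(2)[OF that(1)] that B by (auto simp: state_edges_def input_edges_def)
      ultimately show ?thesis by (auto simp: stars_def Bt_eq input_part_def)
    qed
    then show ?thesis by auto
  qed
  have dim': "dim_row B' = d" "dim_col B' = m" "dim_row Bt = d" "dim_col Bt = m"
    by (simp_all add: B'_eq Bt_eq)
  have Bs_car: "Bs \<in> carrier_mat d m" by (simp add: Bs join_def clear_rows_def dim')
  have stars_Bs: "(l, k) \<in> stars Bs \<longleftrightarrow> (l, k) \<in> stars Bt \<or> (l, k) \<in> stars B' \<and> l \<notin> \<Union> (hit_sccs A Bt)" for l k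
    by (auto simp: Bs stars_def join_def clear_rows_def dim' split: if_splits)
  have sub: "stars Bs \<subseteq> stars B"
    using stars_Bs stars_B' t_star stars_Bt g_part by (auto 4 4)
  have "struct_controllable A Bs"
  proof (rule struct_controllable_if_matching_and_access[OF A Bs_car g(1)])
    fix i assume i: "i < d"
    show "(g i, i) \<in> state_edges A \<union> input_edges Bs"
    proof (cases "g i")
      case (V1 j)
      then show ?thesis using g(2)[OF i] by (auto simp: input_edges_def)
    next
      case (U k)
      then have "(i, k) \<in> stars Bs" using stars_Bs stars_Bt i by (auto simp: input_part_def)
      then show ?thesis using U by (auto simp: stars_def input_edges_def)
    qed
    have "i < dim_row A" using i A by simp
    then obtain S where S: "S \<in> source_sccs A" "\<forall>j\<in>S. (j, i) \<in> (arcs_of A)\<^sup>*"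
      using reachable_from_source by blast
    have "\<exists>l\<in>S. \<exists>k. (l, k) \<in> stars Bs"
    proof (cases "S \<in> hit_sccs A Bt")
      case True
      then obtain l k where l: "l \<in> S" "k < dim_col Bt" "Bt $$ (l, k) = Star" unfolding hit_sccs_def by blast
      then have "(l, k) \<in> stars Bt" using S_lt[OF S(1)] by (simp add: stars_def dim')
      then show ?thesis using stars_Bs l(1) by blast
    next
      case False
      have "sel S \<notin> \<Union> (hit_sccs A Bt)"
      proof
        assume "sel S \<in> \<Union> (hit_sccs A Bt)"
        then obtain S' where S': "S' \<in> hit_sccs A Bt" "sel S \<in> S'" by blast
        then have "S' = S" using source_sccs_disjoint[of S' A S "sel S"] S(1) sel[OF S(1)] by (simp add: hit_sccs_def)
        then show False using False S'(1) by simp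
      qed
      moreover have "(sel S, ch (sel S)) \<in> stars B'" using S(1) stars_B' by (auto simp: t_def)
      ultimately show ?thesis using stars_Bs sel[OF S(1)] by blast
    qed
    then obtain l k where "l \<in> S" "(l, k) \<in> stars Bs" by blast
    then show "\<exists>l<d. \<exists>k<m. Bs $$ (l, k) \<noteq> Zero \<and> (l, i) \<in> (arcs_of A)\<^sup>*"
      using S Bs_car by (auto simp: stars_def)
  qed
  moreover have "zeros B \<subseteq> zeros Bs"
  proof
    fix x assume x: "x \<in> zeros B"
    then have "x \<notin> stars Bs" using sub by (auto simp: zeros_def stars_def)
    then show "x \<in> zeros Bs" using x Bs_car B by (auto simp: zeros_def stars_def)
  qed
  ultimately show "Bs \<in> feasible A B" using Bs_car by (simp add: feasible_def dims)
  fix X assume "X \<in> feasible A B"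
  then have X: "X \<in> carrier_mat d m" "zeros B \<subseteq> zeros X" "struct_controllable A X"
    by (simp_all add: feasible_def dims)
  have XB: "stars X \<subseteq> stars B" using X(1,2) by (intro stars_mono) (simp_all add: dims)
  have le_X: "(\<Sum>(i, k)\<in>Q. w i k) \<le> wnorm w X" if "Q \<subseteq> stars X" for Q
    unfolding wnorm_stars using that XB w by (intro sum_mono2 finite_stars) auto
  have "(\<Sum>(i, k)\<in>stars Bt. w i k) \<le> wnorm w X"
  proof -
    \<comment> \<open>A row-covering matching for \<open>X\<close> uses only stars of
      \<open>B\<close>; covering all rows, it is a maximum matching for \<open>B\<close> and
      competes with \<open>M\<close>.\<close>
    obtain f where f: "inj_on f {..<d}" "\<And>i. i < d \<Longrightarrow> (f i, i) \<in> state_edges A \<union> input_edges X"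
      using struct_controllable_matching[OF X(3) A X(1)] by blast
    have "(f i, i) \<in> state_edges A \<union> input_edges B" if i: "i < d" for i
    proof (cases "f i")
      case (V1 j)
      then show ?thesis using f(2)[OF i] by (auto simp: input_edges_def)
    next
      case (U k)
      then have "(i, k) \<in> stars B" using input_part_stars[OF A X(1) f(2)] XB i by (auto simp: input_part_def)
      then show ?thesis using U by (auto simp: stars_def input_edges_def)
    qed
    then have "is_maximum_matching (state_edges A \<union> input_edges B) (row_matching d f)"
      by (rule row_matching_maximum[OF E f(1)])
    then have "sum (edge_cost w) M \<le> sum (edge_cost w) (row_matching d f)" using M unfolding is_mcmm_def by blast
    then have "(\<Sum>(i, k)\<in>stars Bt. w i k) \<le> (\<Sum>(i, k)\<in>input_part d f. w i k)"
      unfolding M_eq sum_row_matching sum_edge_cost stars_Bt .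
    also have "\<dots> \<le> wnorm w X" by (rule le_X[OF input_part_stars[OF A X(1) f(2)]])
    finally show ?thesis .
  qed
  moreover have "(\<Sum>(i, k)\<in>stars B'. w i k) \<le> wnorm w X"
  proof -
    have "\<forall>S\<in>source_sccs A. \<exists>x. fst x \<in> S \<and> x \<in> stars X"
    proof
      fix S assume S: "S \<in> source_sccs A"
      obtain i k where "i \<in> S" "k < m" "X $$ (i, k) = Star" using source_scc_star[OF X(3) A X(1) S] by blast
      then show "\<exists>x. fst x \<in> S \<and> x \<in> stars X"
        using S_lt[OF S] X(1) by (intro exI[of _ "(i, k)"]) (auto simp: stars_def)
    qed
    \<comment> \<open>One star of \<open>X\<close> per source component. Disjointness makes the
      positions distinct, so their total cost is at most \<open>wnorm w X\<close>.\<close>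
    from bchoice[OF this] obtain s where s: "\<And>S. S \<in> source_sccs A \<Longrightarrow> fst (s S) \<in> S \<and> s S \<in> stars X" by blast
    have s_inj: "inj_on s (source_sccs A)"
    proof (rule inj_onI)
      fix S S' assume S: "S \<in> source_sccs A" "S' \<in> source_sccs A" "s S = s S'"
      then have "fst (s S) \<in> S" "fst (s S) \<in> S'" using s[OF S(1)] s[OF S(2)] by simp_all
      then show "S = S'" by (rule source_sccs_disjoint[OF S(1,2)])
    qed
    have "(\<Sum>(i, k)\<in>stars B'. w i k) = (\<Sum>S\<in>source_sccs A. case t S of (i, k) \<Rightarrow> w i k)"
      unfolding stars_B' by (subst sum.reindex[OF t_inj]) simp
    also have "\<dots> \<le> (\<Sum>S\<in>source_sccs A. case s S of (i, k) \<Rightarrow> w i k)"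
    proof (rule sum_mono)
      fix S assume S: "S \<in> source_sccs A"
      obtain i k where ik: "s S = (i, k)" by force
      then have "i \<in> S" "k < m" "B $$ (i, k) = Star" using s[OF S] XB by (auto simp: stars_def dims)
      moreover have "B $$ (sel S, ch (sel S)) = Star" using t_star[OF S] by (simp add: t_def stars_def)
      ultimately have "w (sel S) (ch (sel S)) \<le> w i k" using cheapest[OF S, of i k] by (simp add: ext_cost_def)
      then show "(case t S of (i, k) \<Rightarrow> w i k) \<le> (case s S of (i, k) \<Rightarrow> w i k)" by (simp add: ik t_def)
    qed
    also have "\<dots> = (\<Sum>(i, k)\<in>s ` source_sccs A. w i k)" by (subst sum.reindex[OF s_inj]) simp
    also have "\<dots> \<le> wnorm w X" using s by (intro le_X) blast
    finally show ?thesis .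
  qed
  moreover have "wnorm w Bs \<le> (\<Sum>(i, k)\<in>stars B'. w i k) + (\<Sum>(i, k)\<in>stars Bt. w i k)"
  proof -
    have sub': "stars B' \<subseteq> stars B" "stars Bt \<subseteq> stars B" using stars_B' t_star stars_Bt g_part by auto
    have "wnorm w Bs \<le> (\<Sum>(i, k)\<in>stars B' \<union> stars Bt. w i k)"
      unfolding wnorm_stars using sub' w stars_Bs by (intro sum_mono2) (auto simp: finite_stars)
    also have "\<dots> \<le> (\<Sum>(i, k)\<in>stars B'. w i k) + (\<Sum>(i, k)\<in>stars Bt. w i k)"
    proof -
      have "0 \<le> (\<Sum>(i, k)\<in>stars B' \<inter> stars Bt. w i k)" using sub' w by (intro sum_nonneg) auto
      then show ?thesis using sum.union_inter[OF finite_stars finite_stars, of "\<lambda>(i, k). w i k" B' Bt] by linarith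
    qed
    finally show ?thesis .
  qed
  ultimately show "wnorm w Bs \<le> 2 * wnorm w X" by linarith
qed

theorem theorem4p15:
  "\<exists>C :: nat. \<forall>(d :: nat) (m :: nat) (A :: entry mat) (B :: entry mat) (w :: nat \<Rightarrow> nat \<Rightarrow> real).
     A \<in> carrier_mat d d \<longrightarrow> B \<in> carrier_mat d m \<longrightarrow> struct_controllable A B \<longrightarrow>
     (\<forall>i < d. \<forall>j < m. B $$ (i, j) \<noteq> Zero \<longrightarrow> 0 \<le> w i j) \<longrightarrow>
     (\<forall>Bs. combined_output A B w Bs \<longrightarrow>
        Bs \<in> feasible A B \<and> wnorm w Bs \<le> 2 * Min (wnorm w ` feasible A B)) \<and>
     combined_output A B w (result (combined_alg d m A B w)) \<and>
     (1 \<le> d \<longrightarrow> steps (combined_alg d m A B w) \<le> C * (d + m) ^ 3)"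
proof (intro exI[of _ 1500] allI impI)
  fix d m :: nat and A B :: "entry mat" and w :: "nat \<Rightarrow> nat \<Rightarrow> real"
  assume A: "A \<in> carrier_mat d d" and B: "B \<in> carrier_mat d m" and sc: "struct_controllable A B"
    and "\<forall>i<d. \<forall>j<m. B $$ (i, j) \<noteq> Zero \<longrightarrow> 0 \<le> w i j"
  then have w: "\<And>i k. i < d \<Longrightarrow> k < m \<Longrightarrow> B $$ (i, k) = Star \<Longrightarrow> 0 \<le> w i k" by simp
  then have w': "\<And>i k. (i, k) \<in> stars B \<Longrightarrow> 0 \<le> w i k" using B by (auto simp: stars_def)
  \<comment> \<open>There are finitely many feasible matrices and \<open>B\<close> is one of them,
    so the minimum is attained.\<close>
  have "B \<in> feasible A B" using B sc by (auto simp: feasible_def)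
  then have "Min (wnorm w ` feasible A B) \<in> wnorm w ` feasible A B"
    using finite_feasible by (intro Min_in) auto
  then obtain X where X: "X \<in> feasible A B" "Min (wnorm w ` feasible A B) = wnorm w X" by blast
  have "Bs \<in> feasible A B \<and> wnorm w Bs \<le> 2 * Min (wnorm w ` feasible A B)"
    if "combined_output A B w Bs" for Bs
    using combined_output_bound[OF A B sc w' that] X by simp
  moreover have "combined_output A B w (result (combined_alg d m A B w))"
    by (rule combined_alg_correct[OF A B sc w])
  ultimately show "(\<forall>Bs. combined_output A B w Bs \<longrightarrow>
        Bs \<in> feasible A B \<and> wnorm w Bs \<le> 2 * Min (wnorm w ` feasible A B)) \<and>
     combined_output A B w (result (combined_alg d m A B w)) \<and>
     (1 \<le> d \<longrightarrow> steps (combined_alg d m A B w) \<le> 1500 * (d + m) ^ 3)"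
    using time_combined by blast
qed

end
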